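(* (i) If $f\in L^p(G(n,j))$, $1\le p<(n-j)/k$, then $(\mathcal R_{j,k}f)(\zeta)$ is finite for almost all $\zeta\in G(n,k)$. (ii) If $\varphi\in L^q(G(n,k))$, $1\le q<(n-k)/j$, then $(\mathcal R_{k,j}\varphi)(\tau)$ is finite for almost all $\tau\in G(n,j)$. The bounds $p<(n-j)/k$ and $q<(n-k)/j$ in these statements are sharp (that is, (i) fails for $p\ge (n-j)/k$ and (ii) fails for $q\ge (n-k)/j$).
   Context: Throughout, $n,j,k$ are integers with $j>0$, $k>0$, $j+k<n$, and all integrals are Lebesgue integrals. $G_{n,j}$ is the Grassmannian of $j$-dimensional linear subspaces of $\mathbb R^n$; $G(n,j)$ is the manifold of $j$-dimensional unoriented affine planes in $\mathbb R^n$. Every $\tau\in G(n,j)$ is written uniquely as $\tau=\tau(\xi,u)=\xi+u$ with $\xi\in G_{n,j}$, $u\in\xi^\perp$. $G(n,j)$ carries the measure $d\tau=d\xi\,du$, with $d\xi$ the $O(n)$-invariant probability measure on $G_{n,j}$ and $du$ Lebesgue measure on $\xi^\perp$. Similarly $\zeta=\zeta(\eta,v)=\eta+v\in G(n,k)$, $\eta\in G_{n,k}$, $v\in\eta^\perp$, $d\zeta=d\eta\,dv$. The $L^p$ spaces are taken with respect to these measures. The mixed Radon transforms are $$(\mathcal R_{j,k}f)(\eta+v)=\int_{G_j(\eta^\perp)}d\xi\int_\eta f(\xi+u+v)\,du,\qquad (\mathcal R_{k,j}\varphi)(\xi+u)=\int_{G_k(\xi^\perp)}d\eta\int_\xi \varphi(\eta+u+v)\,dv,$$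 where $G_j(\eta^\perp)$, $G_k(\xi^\perp)$ are the Grassmannians of linear subspaces of $\eta^\perp$, $\xi^\perp$ of dimension $j$, $k$ with their invariant probability measures, and the inner integrals are with respect to Lebesgue measure on $\eta$ and $\xi$, respectively. *)

theory Defs
  imports "HOL-Probability.Probability"
begin

text \<open>Planes are represented as point sets. On a family of planes of one fixed dimension, the sets
  of planes hitting a given open set form a subbase of the usual (second countable) manifold
  topology, hence they generate its Borel sigma-algebra.\<close>

definition plane_algebra :: "'a::euclidean_space set set \<Rightarrow> 'a set measure" where
  "plane_algebra S = sigma S {{\<tau> \<in> S. \<tau> \<inter> U \<noteq> {}} | U. open U}"

definition grassmannian :: "'a::euclidean_space set \<Rightarrow> nat \<Rightarrow> 'a set set" where
  "grassmannian V j = {\<xi>. subspace \<xi> \<and> \<xi> \<subseteq> V \<and> dim \<xi> = j}"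

text \<open>The orthogonal maps of a subspace \<open>V\<close> are the restrictions to \<open>V\<close> of those orthogonal maps
  of the whole space that preserve \<open>V\<close>.\<close>

definition invariant_probability :: "'a::euclidean_space set \<Rightarrow> nat \<Rightarrow> 'a set measure \<Rightarrow> bool" where
  "invariant_probability V j M \<longleftrightarrow>
     prob_space M \<and>
     space M = grassmannian V j \<and>
     sets M = sets (plane_algebra (grassmannian V j)) \<and>
     (\<forall>T. orthogonal_transformation T \<and> T ` V = V \<longrightarrow>
        (\<forall>A\<in>sets M. emeasure M ((`) T ` A) = emeasure M A))"

definition grassmann_measure :: "'a::euclidean_space set \<Rightarrow> nat \<Rightarrow> 'a set measure" where
  "grassmann_measure V j = (THE M. invariant_probability V j M)"

text \<open>Lebesgue measure of a subspace \<open>V\<close>, on the Borel sets of the ambient space and concentrated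
  on \<open>V\<close>: Lebesgue measure in the coordinates of an orthonormal basis of \<open>V\<close>. It does not depend
  on the chosen basis.\<close>

definition orthonormal_basis :: "'a::euclidean_space set \<Rightarrow> 'a set \<Rightarrow> bool" where
  "orthonormal_basis V B \<longleftrightarrow>
     pairwise orthogonal B \<and> (\<forall>b\<in>B. norm b = 1) \<and> span B = V"

definition subspace_lborel :: "'a::euclidean_space set \<Rightarrow> 'a measure" where
  "subspace_lborel V =
     (let B = (SOME B. orthonormal_basis V B)
      in distr (\<Pi>\<^sub>M b\<in>B. lborel) borel (\<lambda>x. \<Sum>b\<in>B. x b *\<^sub>R b))"

definition affine_grassmannian :: "nat \<Rightarrow> 'a::euclidean_space set set" where
  "affine_grassmannian j = {(+) u ` \<xi> | \<xi> u. \<xi> \<in> grassmannian UNIV j \<and> u \<in> \<xi>\<^sup>\<bottom>}"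

text \<open>The measure \<open>d\<tau> = d\<xi> du\<close>, where \<open>\<tau> = \<xi> + u\<close> with \<open>u\<close> orthogonal to \<open>\<xi>\<close>, completed so
  that measurable functions are the Lebesgue measurable ones.\<close>

definition affine_measure :: "nat \<Rightarrow> 'a::euclidean_space set measure" where
  "affine_measure j = completion (measure_of
     (affine_grassmannian j)
     (sets (plane_algebra (affine_grassmannian j)))
     (\<lambda>A. \<integral>\<^sup>+\<xi>. (\<integral>\<^sup>+u. indicator A ((+) u ` \<xi>) \<partial>subspace_lborel (\<xi>\<^sup>\<bottom>))
            \<partial>grassmann_measure UNIV j))"

text \<open>Membership in \<open>L\<^sup>p\<close> for \<open>p\<close> in \<open>[1, \<infinity>]\<close>; for \<open>p = \<infinity>\<close>, essential boundedness.\<close>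

definition in_Lp :: "ennreal \<Rightarrow> 'c measure \<Rightarrow> ('c \<Rightarrow> 'b::real_normed_vector) \<Rightarrow> bool" where
  "in_Lp p M f \<longleftrightarrow> f \<in> borel_measurable M \<and>
     (if p = \<infinity> then \<exists>C. AE x in M. norm (f x) \<le> C
      else (\<integral>\<^sup>+x. ennreal (norm (f x) powr enn2real p) \<partial>M) < \<infinity>)"

text \<open>\<open>has_mixed_radon j f \<zeta> y\<close>: at the plane \<open>\<zeta> = \<eta> + v\<close>, with \<open>v\<close> orthogonal to \<open>\<eta>\<close>, the iterated
  Lebesgue integral of \<open>f(\<xi> + u + v)\<close>, over \<open>u\<close> in \<open>\<eta>\<close> and then over the \<open>j\<close>-dimensional subspaces
  \<open>\<xi>\<close> of the orthogonal complement of \<open>\<eta>\<close>, exists (with finite value) and equals \<open>y\<close>. For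
  \<open>dim \<eta> = k\<close> this is the transform from \<open>j\<close>-planes to \<open>k\<close>-planes; the transform in the
  opposite direction is obtained by exchanging the roles of \<open>j\<close> and \<open>k\<close>. The \<open>AE\<close> clause is
  needed because the Bochner integral of a non-integrable function is 0 by convention.\<close>

definition has_mixed_radon ::
    "nat \<Rightarrow> ('a::euclidean_space set \<Rightarrow> 'b::{banach, second_countable_topology})
      \<Rightarrow> 'a set \<Rightarrow> 'b \<Rightarrow> bool" where
  "has_mixed_radon j f \<zeta> y \<longleftrightarrow>
     (\<exists>\<eta> v. subspace \<eta> \<and> v \<in> \<eta>\<^sup>\<bottom> \<and> \<zeta> = (+) v ` \<eta> \<and>
        (AE \<xi> in grassmann_measure (\<eta>\<^sup>\<bottom>) j.
           integrable (completion (subspace_lborel \<eta>)) (\<lambda>u. f ((+) (u + v) ` \<xi>))) \<and>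
        has_bochner_integral (completion (grassmann_measure (\<eta>\<^sup>\<bottom>) j))
          (\<lambda>\<xi>. \<integral>u. f ((+) (u + v) ` \<xi>) \<partial>completion (subspace_lborel \<eta>)) y)"

definition mixed_radon_finite ::
    "nat \<Rightarrow> ('a::euclidean_space set \<Rightarrow> 'b::{banach, second_countable_topology})
      \<Rightarrow> 'a set \<Rightarrow> bool" where
  "mixed_radon_finite j f \<zeta> \<longleftrightarrow> (\<exists>y. has_mixed_radon j f \<zeta> y)"

end

theory Submission
  imports Defs
begin

text \<open>
  Both transforms are studied through their adjoint. Parametrizing \<open>\<tau> = \<xi> + x\<close> and
  \<open>\<zeta> = \<eta> + x\<close> by an arbitrary point \<open>x\<close> of the plane, both sides of the duality relation become
  the integral of \<open>f(\<xi> + x) \<phi>(\<eta> + x)\<close> over \<open>x \<in> \<real>\<^sup>n\<close> and over all orthogonal pairs \<open>(\<xi>, \<eta>)\<close>, and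
  the order in which \<open>\<xi>\<close> and \<open>\<eta>\<close> are drawn is irrelevant because an invariant probability measure on a
  homogeneous space is unique. Taking for \<open>\<phi>\<close> the indicator of \<open>{\<bar>\<zeta>\<bar> < a}\<close>, the adjoint transform
  of \<open>\<phi>\<close> at \<open>\<xi> + u\<close> is at most a constant times the probability that \<open>u\<close> is within distance \<open>a\<close> of a
  random \<open>k\<close>-plane of \<open>\<xi>\<^sup>\<bottom>\<close>, hence \<open>O(\<bar>u\<bar>\<^sup>k\<^sup>-\<^sup>m)\<close> with \<open>m = n - j\<close>. This lies in the dual of \<open>L\<^sup>p\<close>
  exactly for \<open>p < m/k\<close>, and Young's inequality gives finiteness. The bound is sharp because
  \<open>\<bar>\<tau>\<bar>\<^sup>-\<^sup>k / log \<bar>\<tau>\<bar>\<close> (discretized to dyadic-like shells) is in \<open>L\<^sup>p\<close> for all \<open>p \<ge> m/k\<close>, while its integral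
  over \<open>u\<close> in a \<open>k\<close>-plane diverges. The invariant measure on \<open>G\<^sub>j(V)\<close> is realized as the law of the span of the
  projections to \<open>V\<close> of \<open>j\<close> independent Gaussian vectors, which makes it depend measurably on \<open>V\<close>.
\<close>

section \<open>Orthogonal projections\<close>

text \<open>Everything that varies with a subspace V must be jointly measurable in V, yet
  \<open>subspace_lborel\<close> rests on an arbitrarily chosen basis and
  \<open>grassmann_measure\<close> on a definite description. The first obstacle is removed by a
  Gaussian weight of total mass 1 in every dimension: an integral over V becomes one over the whole
  space, with the coordinate orthogonal to V integrated out against the weight. The basis disappears
  and V enters only through \<open>proj V x\<close>, which is measurable in V because distance
  functions are and polarization recovers the projection from them. The second is removed by an
  explicit model together with a uniqueness theorem which works without Haar measure on the
  orthogonal group: it needs a metric preserved by that group, and the distance between projection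
  matrices is one. A further obstacle is that f is measurable only for the completed measure.
  Changing f on a null set of j-planes must change the transform only on a null set of k-planes; the
  dual estimate, applied to the indicator of a null set, gives this as well.\<close>

definition proj :: "'a::euclidean_space set \<Rightarrow> 'a \<Rightarrow> 'a" where
  "proj V x = (THE y. y \<in> V \<and> x - y \<in> V\<^sup>\<bottom>)"

lemma orthogonal_compD: "x \<in> V\<^sup>\<bottom> \<Longrightarrow> y \<in> V \<Longrightarrow> x \<bullet> y = 0"
  by (simp add: orthogonal_comp_def orthogonal_def inner_commute[of x])

lemma orthogonal_compI: "(\<And>y. y \<in> V \<Longrightarrow> x \<bullet> y = 0) \<Longrightarrow> x \<in> V\<^sup>\<bottom>"
  by (simp add: orthogonal_comp_def orthogonal_def inner_commute[of x])

lemma proj_unique: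
  assumes V: "subspace V" and y: "y \<in> V" "x - y \<in> V\<^sup>\<bottom>"
  shows "proj V x = y"
  unfolding proj_def
proof (rule the_equality)
  fix z assume z: "z \<in> V \<and> x - z \<in> V\<^sup>\<bottom>"
  then have "(x - z) - (x - y) \<in> V\<^sup>\<bottom>"
    using y by (blast intro: subspace_diff[OF subspace_orthogonal_comp])
  then have "y - z \<in> V\<^sup>\<bottom>" by (simp add: algebra_simps)
  moreover have "y - z \<in> V" using y z V by (simp add: subspace_diff)
  ultimately have "y - z = 0" using orthogonal_Int_0[OF V] by blast
  then show "z = y" by simp
qed (use y in simp)

lemma
  assumes V: "subspace V"
  shows proj_mem: "proj V x \<in> V" and proj_diff_mem: "x - proj V x \<in> V\<^sup>\<bottom>"
proof -
  obtain a b where "x = a + b" "a \<in> V" "b \<in> V\<^sup>\<bottom>"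
    using subspace_sum_orthogonal_comp[OF V] by (metis UNIV_I set_plus_elim)
  moreover from this have "proj V x = a" by (intro proj_unique[OF V]) auto
  ultimately show "proj V x \<in> V" "x - proj V x \<in> V\<^sup>\<bottom>" by auto
qed

lemma linear_proj: "subspace V \<Longrightarrow> linear (proj V)"
proof (rule linearI)
  assume V: "subspace V"
  fix x y c
  have "(x - proj V x) + (y - proj V y) \<in> V\<^sup>\<bottom>"
    by (intro subspace_add[OF subspace_orthogonal_comp] proj_diff_mem V)
  then show "proj V (x + y) = proj V x + proj V y"
    by (intro proj_unique[OF V] subspace_add[OF V] proj_mem V) (simp add: algebra_simps del: diff_self)
  have "c *\<^sub>R (x - proj V x) \<in> V\<^sup>\<bottom>"
    by (intro subspace_scale[OF subspace_orthogonal_comp] proj_diff_mem V)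
  then show "proj V (c *\<^sub>R x) = c *\<^sub>R proj V x"
    by (intro proj_unique[OF V] subspace_scale[OF V] proj_mem V) (simp add: algebra_simps)
qed

lemma proj_id: "subspace V \<Longrightarrow> x \<in> V \<Longrightarrow> proj V x = x"
  by (rule proj_unique) (auto simp: subspace_0 subspace_orthogonal_comp)

lemma proj_zero: "subspace V \<Longrightarrow> x \<in> V\<^sup>\<bottom> \<Longrightarrow> proj V x = 0"
  by (rule proj_unique) (auto simp: subspace_0)

lemma proj_orthogonal_comp: "subspace V \<Longrightarrow> proj (V\<^sup>\<bottom>) x = x - proj V x"
  by (rule proj_unique) (auto simp: subspace_orthogonal_comp proj_diff_mem orthogonal_comp_self proj_mem)

lemma proj_add: "subspace V \<Longrightarrow> proj V (x + y) = proj V x + proj V y"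
  and proj_diff: "subspace V \<Longrightarrow> proj V (x - y) = proj V x - proj V y"
  and proj_scaleR: "subspace V \<Longrightarrow> proj V (c *\<^sub>R x) = c *\<^sub>R proj V x"
  by (simp_all add: linear_add linear_diff linear_scale linear_proj)

lemma norm_proj_Pythagoras:
  "subspace V \<Longrightarrow> (norm x)\<^sup>2 = (norm (proj V x))\<^sup>2 + (norm (x - proj V x))\<^sup>2"
proof -
  assume V: "subspace V"
  have "orthogonal (proj V x) (x - proj V x)"
    using proj_mem[OF V] proj_diff_mem[OF V] by (simp add: orthogonal_comp_def)
  from norm_add_Pythagorean[OF this] show ?thesis by simp
qed

lemma norm_proj_le: "subspace V \<Longrightarrow> norm (proj V x) \<le> norm x"
  using norm_proj_Pythagoras[of V x] by (smt (verit) norm_ge_zero power2_le_imp_le zero_le_power2)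

lemma norm_diff_proj_le: "subspace V \<Longrightarrow> norm (x - proj V x) \<le> norm x"
  using norm_proj_Pythagoras[of V x] by (smt (verit) norm_ge_zero power2_le_imp_le zero_le_power2)

lemma continuous_on_proj: "subspace V \<Longrightarrow> continuous_on S (proj V)"
  by (intro linear_continuous_on linear_conv_bounded_linear[THEN iffD1] linear_proj)

lemma borel_measurable_proj [measurable]: "subspace V \<Longrightarrow> proj V \<in> borel_measurable borel"
  by (intro borel_measurable_continuous_onI continuous_on_proj)

text \<open>Distances to a moving plane are measurable in the plane almost by definition of
  \<open>plane_algebra\<close>; this identity passes that on to projections.\<close>

lemma infdist_eq_norm_proj:
  assumes V: "subspace V" shows "infdist x V = norm (x - proj V x)"
proof (rule antisym)
  show "infdist x V \<le> norm (x - proj V x)"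
    using infdist_le[OF proj_mem[OF V, of x], of x] by (simp add: dist_norm)
  have "norm (x - proj V x) \<le> dist x a" if "a \<in> V" for a
  proof -
    have "x - a - proj V (x - a) = x - proj V x"
      using V that by (simp add: proj_diff proj_id)
    then show ?thesis using norm_diff_proj_le[OF V, of "x - a"] by (metis dist_norm)
  qed
  then show "norm (x - proj V x) \<le> infdist x V"
    using subspace_0[OF V] by (subst infdist_notempty) (blast intro: cINF_greatest)+
qed

section \<open>Orthogonal maps and their action on subspaces\<close>

lemma orthogonal_comp_image:
  fixes T :: "'a::euclidean_space \<Rightarrow> 'a"
  assumes T: "orthogonal_transformation T" shows "T ` (V\<^sup>\<bottom>) = (T ` V)\<^sup>\<bottom>"
proof -
  have "x \<in> T ` (V\<^sup>\<bottom>)" if "x \<in> (T ` V)\<^sup>\<bottom>" for x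
  proof -
    obtain y where x: "x = T y" using orthogonal_transformation_surj[OF T] by (metis surjD)
    have "y \<in> V\<^sup>\<bottom>" using that T unfolding x
      by (auto simp: orthogonal_comp_def orthogonal_orthogonal_transformation)
    then show ?thesis using x by blast
  qed
  then show ?thesis using T by (auto simp: orthogonal_comp_def orthogonal_orthogonal_transformation)
qed

lemma proj_image:
  fixes T :: "'a::euclidean_space \<Rightarrow> 'a"
  assumes T: "orthogonal_transformation T" and V: "subspace V"
  shows "proj (T ` V) (T x) = T (proj V x)"
proof (rule proj_unique)
  have lin: "linear T" using T by (rule orthogonal_transformation_linear)
  show "subspace (T ` V)" using V lin by (rule linear_subspace_image[rotated])
  show "T (proj V x) \<in> T ` V" using proj_mem[OF V] by blast
  show "T x - T (proj V x) \<in> (T ` V)\<^sup>\<bottom>"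
    using proj_diff_mem[OF V, of x]
    by (simp add: orthogonal_comp_image[OF T, symmetric] linear_diff[OF lin, symmetric])
qed

lemma dim_orthogonal_comp:
  fixes V :: "'a::euclidean_space set"
  assumes "subspace V" shows "dim (V\<^sup>\<bottom>) = DIM('a) - dim V"
proof -
  have "{y \<in> UNIV. \<forall>x\<in>V. orthogonal x y} = V\<^sup>\<bottom>" by (auto simp: orthogonal_comp_def)
  with dim_subspace_orthogonal_to_vectors[of V UNIV] assms show ?thesis by simp
qed

lemma norm_add_orthogonal3:
  fixes a b c :: "'a::real_inner"
  assumes "a \<bullet> b = 0" "a \<bullet> c = 0" "b \<bullet> c = 0"
  shows "(norm (a + b + c))\<^sup>2 = (norm a)\<^sup>2 + (norm b)\<^sup>2 + (norm c)\<^sup>2"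
  using assms by (simp add: power2_norm_eq_inner inner_add_left inner_add_right inner_commute)

text \<open>The space is the orthogonal sum of A, B and the complement C of A + B; linear isometries
  of the three pieces are glued. Besides orthogonal pairs of planes, this covers planes inside a
  fixed V (with the complement of V as B) and lines inside V.\<close>

lemma orthogonal_flag_transitive:
  fixes A B A' B' :: "'a::euclidean_space set"
  assumes A: "subspace A" "subspace A'" "dim A = dim A'"
    and B: "subspace B" "subspace B'" "dim B = dim B'"
    and AB: "A \<subseteq> B\<^sup>\<bottom>" "A' \<subseteq> B'\<^sup>\<bottom>"
  obtains T where "orthogonal_transformation T" "T ` A = A'" "T ` B = B'"
proof -
  define C C' where "C = {y. \<forall>x\<in>A \<union> B. x \<bullet> y = 0}" and "C' = {y. \<forall>x\<in>A' \<union> B'. x \<bullet> y = 0}"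
  have dimC: "dim {y. \<forall>x\<in>P \<union> Q. x \<bullet> y = 0} = DIM('a) - (dim P + dim Q)"
    "subspace {y. \<forall>x\<in>P \<union> Q. x \<bullet> y = 0}"
    if PQ: "subspace P" "subspace Q" "P \<subseteq> Q\<^sup>\<bottom>" for P Q :: "'a set"
  proof -
    have orth: "x \<bullet> y = 0" if "x \<in> P" "y \<in> Q" for x y using PQ(3) that by (auto dest: orthogonal_compD)
    have "{y. \<forall>x\<in>P \<union> Q. x \<bullet> y = 0} = {y \<in> UNIV. \<forall>x\<in>span (P \<union> Q). orthogonal x y}"
      by (auto simp: span_base orthogonal_def[symmetric] orthogonal_commute[of _ "_::'a"]
          intro: orthogonal_to_span)
    moreover have "dim (span (P \<union> Q)) = dim P + dim Q"
    proof -
      have "span (P \<union> Q) = {x + y |x y. x \<in> P \<and> y \<in> Q}"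
        using span_Un[of P Q] by (simp only: span_eq_iff[THEN iffD2, OF PQ(1)] span_eq_iff[THEN iffD2, OF PQ(2)])
      moreover have "P \<inter> Q = {0}"
        using orth[of x x for x] subspace_0[OF PQ(1)] subspace_0[OF PQ(2)] by auto
      ultimately show ?thesis using dim_sums_Int[OF PQ(1,2)] by simp
    qed
    ultimately show "dim {y. \<forall>x\<in>P \<union> Q. x \<bullet> y = 0} = DIM('a) - (dim P + dim Q)"
      using dim_subspace_orthogonal_to_vectors[of "span (P \<union> Q)" UNIV] by simp
    show "subspace {y. \<forall>x\<in>P \<union> Q. x \<bullet> y = 0}"
      by (auto simp: subspace_def inner_add_right)
  qed
  have C: "subspace C" "subspace C'" "dim C = dim C'"
    unfolding C_def C'_def using dimC A B AB by auto
  obtain f where f: "linear f" "f ` A = A'" "\<And>x. x \<in> A \<Longrightarrow> norm (f x) = norm x"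
    using isometry_subspaces[OF A] by metis
  obtain g where g: "linear g" "g ` B = B'" "\<And>x. x \<in> B \<Longrightarrow> norm (g x) = norm x"
    using isometry_subspaces[OF B] by metis
  obtain h where h: "linear h" "h ` C = C'" "\<And>x. x \<in> C \<Longrightarrow> norm (h x) = norm x"
    using isometry_subspaces[OF C] by metis
  define T where "T x = f (proj A x) + g (proj B x) + h (x - proj A x - proj B x)" for x
  have orth: "a \<bullet> b = 0" if "a \<in> A" "b \<in> B" for a b using AB(1) that by (auto dest: orthogonal_compD)
  have orth': "a \<bullet> b = 0" if "a \<in> A'" "b \<in> B'" for a b using AB(2) that by (auto dest: orthogonal_compD)
  have memC: "x - proj A x - proj B x \<in> C" for x
  proof -
    have "a \<bullet> (x - proj A x - proj B x) = 0" if "a \<in> A" for a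
      using orthogonal_compD[OF proj_diff_mem[OF A(1), of x] that] orth[OF that proj_mem[OF B(1), of x]]
      by (simp add: inner_diff_right inner_commute inner_diff_left)
    moreover have "b \<bullet> (x - proj A x - proj B x) = 0" if "b \<in> B" for b
      using orthogonal_compD[OF proj_diff_mem[OF B(1), of x] that] orth[OF proj_mem[OF A(1), of x] that]
      by (simp add: inner_diff_right inner_commute inner_diff_left)
    ultimately show ?thesis unfolding C_def by auto
  qed
  have linT: "linear T"
  proof -
    have "linear (\<lambda>x. f (proj A x))" "linear (\<lambda>x. g (proj B x))"
      using linear_compose[OF linear_proj[OF A(1)] f(1)] linear_compose[OF linear_proj[OF B(1)] g(1)]
      by (auto simp: o_def)
    moreover have "linear (\<lambda>x. x - proj A x - proj B x)"
      by (intro linear_compose_sub linear_proj A B linear_ident)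
    then have "linear (\<lambda>x. h (x - proj A x - proj B x))"
      using linear_compose[OF _ h(1)] by (auto simp: o_def)
    ultimately show ?thesis unfolding T_def by (intro linear_compose_add)
  qed
  have "norm (T x) = norm x" for x
  proof -
    let ?a = "proj A x" and ?b = "proj B x" let ?c = "x - ?a - ?b"
    have m: "?a \<in> A" "?b \<in> B" "?c \<in> C" using proj_mem A B memC by auto
    have "f ?a \<in> A'" "g ?b \<in> B'" "h ?c \<in> C'" using f g h m by auto
    then have "(norm (T x))\<^sup>2 = (norm (f ?a))\<^sup>2 + (norm (g ?b))\<^sup>2 + (norm (h ?c))\<^sup>2"
      unfolding T_def using orth' by (intro norm_add_orthogonal3) (auto simp: C'_def)
    also have "\<dots> = (norm ?a)\<^sup>2 + (norm ?b)\<^sup>2 + (norm ?c)\<^sup>2" using f g h m by simp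
    also have "\<dots> = (norm (?a + ?b + ?c))\<^sup>2"
      using m orth by (intro norm_add_orthogonal3[symmetric]) (auto simp: C_def)
    finally show ?thesis by simp
  qed
  then have T: "orthogonal_transformation T" using linT by (simp add: orthogonal_transformation)
  have "T x = f x" if "x \<in> A" for x
  proof -
    have "proj B x = 0" using AB(1) that B by (intro proj_zero) auto
    then show ?thesis unfolding T_def using that A g h by (simp add: proj_id linear_0)
  qed
  moreover have "T x = g x" if "x \<in> B" for x
  proof -
    have "proj A x = 0" using orth that A
      by (intro proj_zero orthogonal_compI) (auto simp: inner_commute)
    then show ?thesis unfolding T_def using that B f h by (simp add: proj_id linear_0)
  qed
  ultimately have "T ` A = A'" "T ` B = B'" using f g by force+
  with T show ?thesis by (rule that)
qed

section \<open>Lebesgue measure on subspaces\<close>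

text \<open>The factor \<open>pi\<close> makes the total mass 1 in every dimension, so integrating
  out a Gaussian leaves no constant that depends on the subspace.\<close>

definition gauss :: "'a::euclidean_space \<Rightarrow> real" where
  "gauss x = exp (- pi * (norm x)\<^sup>2)"

text \<open>\<open>subspace_lborel\<close> with the basis as an explicit parameter; independence of
  the basis is \<open>subspace_lborel_eq\<close>.\<close>

definition frame_lborel :: "'a::euclidean_space set \<Rightarrow> 'a measure" where
  "frame_lborel B = distr (\<Pi>\<^sub>M b\<in>B. lborel) borel (\<lambda>x. \<Sum>b\<in>B. x b *\<^sub>R b)"

lemma gauss_nonneg [simp]: "0 \<le> gauss x" and gauss_le_1: "gauss x \<le> 1"
  and gauss_minus [simp]: "gauss (- x) = gauss x"
  by (auto simp: gauss_def)

lemma borel_measurable_gauss [measurable]: "gauss \<in> borel_measurable borel"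
  unfolding gauss_def[abs_def] by measurable

lemma gauss_orthogonal_transformation: "orthogonal_transformation T \<Longrightarrow> gauss (T x) = gauss x"
  by (simp add: gauss_def orthogonal_transformation_norm)

lemma nn_integral_gauss_real: "(\<integral>\<^sup>+x. ennreal (exp (- pi * x\<^sup>2)) \<partial>lborel) = 1"
proof -
  \<comment> \<open>The standard deviation 1 / sqrt (2 pi) turns the normal density into the
    function in question, normalization included.\<close>
  have eq: "normal_density 0 (1 / sqrt (2 * pi)) x = exp (- pi * x\<^sup>2)" for x
    by (simp add: normal_density_def power_divide)
  have "(\<integral>\<^sup>+x. ennreal (normal_density 0 (1 / sqrt (2 * pi)) x) \<partial>lborel) = 1"
    by (subst nn_integral_eq_integral) auto
  then show ?thesis unfolding eq .
qed

interpretation lborel_product: product_sigma_finite "\<lambda>_::'i. lborel :: real measure"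
  by standard

section \<open>Coordinates in an orthonormal basis\<close>

lemma orthonormal_basis_finite: "orthonormal_basis V B \<Longrightarrow> finite B"
  unfolding orthonormal_basis_def by (auto intro: pairwise_orthogonal_imp_finite)

lemma orthonormal_basis_card:
  assumes "orthonormal_basis V B" shows "card B = dim V"
proof -
  have "0 \<notin> B" using assms by (force simp: orthonormal_basis_def)
  then have "independent B"
    using assms pairwise_orthogonal_independent[of B] unfolding orthonormal_basis_def by simp
  then show ?thesis using assms dim_span[of B] dim_eq_card_independent[of B]
    by (simp add: orthonormal_basis_def)
qed

lemma orthonormal_basis_exists:
  assumes "subspace V" obtains B where "orthonormal_basis V B"
  using orthonormal_basis_subspace[OF assms] unfolding orthonormal_basis_def by metis

lemma orthonormal_basis_inner:
  "orthonormal_basis V B \<Longrightarrow> a \<in> B \<Longrightarrow> b \<in> B \<Longrightarrow> a \<bullet> b = (if a = b then 1 else 0)"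
  unfolding orthonormal_basis_def pairwise_def orthogonal_def by (auto simp: norm_eq_1)

lemma orthonormal_basis_coord:
  assumes B: "orthonormal_basis V B" and "a \<in> B"
  shows "(\<Sum>b\<in>B. c b *\<^sub>R b) \<bullet> a = c a"
proof -
  have "(\<Sum>b\<in>B. c b *\<^sub>R b) \<bullet> a = (\<Sum>b\<in>B. if b = a then c b else 0)"
    using orthonormal_basis_inner[OF B _ \<open>a \<in> B\<close>] by (auto simp: inner_sum_left intro!: sum.cong)
  then show ?thesis using orthonormal_basis_finite[OF B] \<open>a \<in> B\<close> by simp
qed

lemma orthonormal_basis_norm:
  assumes B: "orthonormal_basis V B"
  shows "(norm (\<Sum>b\<in>B. c b *\<^sub>R b))\<^sup>2 = (\<Sum>b\<in>B. (c b)\<^sup>2)"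
proof -
  have "(norm (\<Sum>b\<in>B. c b *\<^sub>R b))\<^sup>2 = (\<Sum>a\<in>B. (\<Sum>b\<in>B. c b *\<^sub>R b) \<bullet> (c a *\<^sub>R a))"
    by (simp only: power2_norm_eq_inner inner_sum_right)
  also have "\<dots> = (\<Sum>b\<in>B. (c b)\<^sup>2)"
    using orthonormal_basis_coord[OF B] by (simp add: power2_eq_square)
  finally show ?thesis .
qed

lemma orthonormal_basis_sum_mem: "orthonormal_basis V B \<Longrightarrow> (\<Sum>b\<in>B. c b *\<^sub>R b) \<in> V"
  unfolding orthonormal_basis_def by (auto intro!: span_sum span_scale intro: span_base)

lemma subspace_orthonormal_basis: "orthonormal_basis V B \<Longrightarrow> subspace V"
  unfolding orthonormal_basis_def by auto

lemma orthonormal_basis_Un: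
  assumes W: "subspace W" "subspace V" "W \<subseteq> V"
    and B: "orthonormal_basis W B" and C: "orthonormal_basis (V \<inter> W\<^sup>\<bottom>) C"
  shows "orthonormal_basis V (B \<union> C)" "B \<inter> C = {}"
proof -
  have BC: "B \<subseteq> W" "C \<subseteq> W\<^sup>\<bottom>" "C \<subseteq> V"
    using B C span_base unfolding orthonormal_basis_def by blast+
  then have orth: "b \<bullet> c = 0" if "b \<in> B" "c \<in> C" for b c
    using that by (auto simp: orthogonal_comp_def orthogonal_def)
  then show "B \<inter> C = {}" using B by (force simp: orthonormal_basis_def)
  have "V \<subseteq> span (B \<union> C)"
  proof
    fix x assume "x \<in> V"
    have "proj W x \<in> span B" using proj_mem[OF W(1)] B by (simp add: orthonormal_basis_def)
    moreover have "x - proj W x \<in> V"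
      using proj_mem[OF W(1), of x] W \<open>x \<in> V\<close> by (auto intro: subspace_diff)
    then have "x - proj W x \<in> span C"
      using proj_diff_mem[OF W(1)] C by (simp add: orthonormal_basis_def)
    ultimately have "proj W x + (x - proj W x) \<in> span (B \<union> C)"
      by (meson span_add span_mono subsetD sup_ge1 sup_ge2)
    then show "x \<in> span (B \<union> C)" by simp
  qed
  moreover have "span (B \<union> C) \<subseteq> V" using BC W by (intro span_minimal) auto
  ultimately show "orthonormal_basis V (B \<union> C)"
    using B C orth unfolding orthonormal_basis_def pairwise_def orthogonal_def
    by (safe; simp add: inner_commute; metis inner_commute)
qed

section \<open>Lebesgue measure in the coordinates of an orthonormal frame\<close>

lemma sets_frame_lborel [measurable_cong, simp]: "sets (frame_lborel B) = sets borel"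
  and space_frame_lborel [simp]: "space (frame_lborel B) = UNIV"
  by (simp_all add: frame_lborel_def)

lemma nn_integral_frame_lborel:
  "g \<in> borel_measurable borel \<Longrightarrow>
    (\<integral>\<^sup>+x. g x \<partial>frame_lborel B) = (\<integral>\<^sup>+x. g (\<Sum>b\<in>B. x b *\<^sub>R b) \<partial>(\<Pi>\<^sub>M b\<in>B. lborel))"
  unfolding frame_lborel_def by (subst nn_integral_distr) auto

lemma nn_integral_gauss_frame_lborel:
  assumes B: "orthonormal_basis V B"
  shows "(\<integral>\<^sup>+x. gauss x \<partial>frame_lborel B) = 1"
proof -
  note fin = orthonormal_basis_finite[OF B]
  have "(\<integral>\<^sup>+x. gauss x \<partial>frame_lborel B) = (\<integral>\<^sup>+x. (\<Prod>b\<in>B. ennreal (exp (- pi * (x b)\<^sup>2))) \<partial>(\<Pi>\<^sub>M b\<in>B. lborel))"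
    using fin by (simp add: nn_integral_frame_lborel gauss_def orthonormal_basis_norm[OF B] prod_ennreal
        exp_sum[symmetric] sum_distrib_left sum_negf)
  also have "\<dots> = 1"
    using fin nn_integral_gauss_real
    by (subst lborel_product.product_nn_integral_prod) (auto simp del: mult_minus_left)
  finally show ?thesis .
qed

lemma nn_integral_frame_lborel_Un:
  fixes g :: "'a::euclidean_space \<Rightarrow> ennreal"
  assumes "finite B" "finite C" "B \<inter> C = {}" and g [measurable]: "g \<in> borel_measurable borel"
  shows "(\<integral>\<^sup>+x. g x \<partial>frame_lborel (B \<union> C)) = (\<integral>\<^sup>+x. (\<integral>\<^sup>+y. g (x + y) \<partial>frame_lborel C) \<partial>frame_lborel B)"
proof -
  let ?S = "\<lambda>B x. (\<Sum>b\<in>B. x b *\<^sub>R b) :: 'a"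
  have sf: "sigma_finite_measure (\<Pi>\<^sub>M b\<in>C. lborel :: real measure)"
    using \<open>finite C\<close> by (rule lborel_product.sigma_finite)
  have "(\<lambda>x. \<integral>\<^sup>+y. g (x + y) \<partial>frame_lborel C) = (\<lambda>x. \<integral>\<^sup>+y. g (x + ?S C y) \<partial>(\<Pi>\<^sub>M b\<in>C. lborel))"
    by (subst nn_integral_frame_lborel) auto
  moreover have "(\<lambda>x. \<integral>\<^sup>+y. g (x + ?S C y) \<partial>(\<Pi>\<^sub>M b\<in>C. lborel)) \<in> borel_measurable borel"
    using sigma_finite_measure.borel_measurable_nn_integral_fst[OF sf, of "\<lambda>p. g (fst p + ?S C (snd p))" borel]
    by simp
  ultimately have "(\<integral>\<^sup>+x. (\<integral>\<^sup>+y. g (x + y) \<partial>frame_lborel C) \<partial>frame_lborel B)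
      = (\<integral>\<^sup>+x. (\<integral>\<^sup>+y. g (?S B x + ?S C y) \<partial>(\<Pi>\<^sub>M b\<in>C. lborel)) \<partial>(\<Pi>\<^sub>M b\<in>B. lborel))"
    by (simp add: nn_integral_frame_lborel)
  also have "\<dots> = (\<integral>\<^sup>+x. (\<integral>\<^sup>+y. g (?S (B \<union> C) (merge B C (x, y))) \<partial>(\<Pi>\<^sub>M b\<in>C. lborel)) \<partial>(\<Pi>\<^sub>M b\<in>B. lborel))"
  proof -
    have "?S (B \<union> C) (merge B C (x, y)) = ?S B x + ?S C y" for x y
      using assms(1-3) by (subst sum.union_disjoint) (auto simp: merge_def intro!: arg_cong2[where f="(+)"] sum.cong)
    then show ?thesis by simp
  qed
  also have "\<dots> = (\<integral>\<^sup>+x. g (?S (B \<union> C) x) \<partial>(\<Pi>\<^sub>M b\<in>B \<union> C. lborel))"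
    using assms by (subst lborel_product.product_nn_integral_fold) auto
  finally show ?thesis by (simp add: nn_integral_frame_lborel)
qed

text \<open>Fubini on \<open>\<integral>\<integral> f(x) gauss(y - x) dy dM(x)\<close>.\<close>

lemma translation_invariant_eq_lborel:
  fixes M :: "'a::euclidean_space measure"
  assumes [measurable_cong]: "sets M = sets borel" and "sigma_finite_measure M"
    and inv: "\<And>c f. f \<in> borel_measurable borel \<Longrightarrow> (\<integral>\<^sup>+x. f (c + x) \<partial>M) = (\<integral>\<^sup>+x. f x \<partial>M)"
    and gauss: "(\<integral>\<^sup>+x. gauss x \<partial>M) = 1" "(\<integral>\<^sup>+x. gauss (x::'a) \<partial>lborel) = 1"
  shows "M = lborel"
proof (rule measure_eqI)
  fix A assume "A \<in> sets M"
  then have [measurable]: "A \<in> sets borel" using assms(1) by simp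
  interpret M: sigma_finite_measure M by fact
  interpret P: pair_sigma_finite M lborel by standard
  have invl: "(\<integral>\<^sup>+x. f (c + x) \<partial>lborel) = (\<integral>\<^sup>+x. f x \<partial>lborel)"
    if [measurable]: "f \<in> borel_measurable borel" for c :: 'a and f :: "'a \<Rightarrow> ennreal"
    by (subst (2) lborel_distr_plus[symmetric, of c]) (simp add: nn_integral_distr)
  have "emeasure M A = (\<integral>\<^sup>+x. indicator A x * (\<integral>\<^sup>+y. gauss (- x + y) \<partial>lborel) \<partial>M)"
    by (subst invl) (auto simp: gauss)
  also have "\<dots> = (\<integral>\<^sup>+x. (\<integral>\<^sup>+y. indicator A x * ennreal (gauss (- x + y)) \<partial>lborel) \<partial>M)"
    by (simp add: nn_integral_cmult)
  also have "\<dots> = (\<integral>\<^sup>+y. (\<integral>\<^sup>+x. indicator A x * ennreal (gauss (- x + y)) \<partial>M) \<partial>lborel)"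
    by (subst P.Fubini') auto
  \<comment> \<open>Invariance of M, for fixed y, substitutes y + x for x. The weight then depends
    on x alone, and after another exchange the invariance of Lebesgue measure removes x from the
    indicator.\<close>
  also have "\<dots> = (\<integral>\<^sup>+y. (\<integral>\<^sup>+x. indicator A (y + x) * ennreal (gauss (- (y + x) + y)) \<partial>M) \<partial>lborel)"
    by (subst inv) auto
  also have "\<dots> = (\<integral>\<^sup>+y. (\<integral>\<^sup>+x. indicator A (y + x) * ennreal (gauss x) \<partial>M) \<partial>lborel)"
    by simp
  also have "\<dots> = (\<integral>\<^sup>+x. (\<integral>\<^sup>+y. indicator A (y + x) * ennreal (gauss x) \<partial>lborel) \<partial>M)"
    by (subst P.Fubini') auto
  also have "\<dots> = (\<integral>\<^sup>+x. (\<integral>\<^sup>+y. indicator A (x + y) \<partial>lborel) * gauss x \<partial>M)"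
    by (simp add: nn_integral_multc add.commute)
  also have "\<dots> = emeasure lborel A"
    by (subst invl) (auto simp: gauss nn_integral_cmult)
  finally show "emeasure M A = emeasure lborel A" .
qed (simp add: assms)

lemma frame_lborel_Basis: "frame_lborel Basis = (lborel :: 'a::euclidean_space measure)"
  unfolding frame_lborel_def by (simp add: lborel_eq[symmetric])

lemma orthonormal_basis_Basis: "orthonormal_basis (UNIV::'a::euclidean_space set) Basis"
  by (auto simp: orthonormal_basis_def pairwise_def orthogonal_def inner_Basis)

lemma nn_integral_gauss_lborel: "(\<integral>\<^sup>+x. gauss (x::'a::euclidean_space) \<partial>lborel) = 1"
  using nn_integral_gauss_frame_lborel[OF orthonormal_basis_Basis] by (simp add: frame_lborel_Basis)

text \<open>The ball lies in the cube of side 2 R, since each coordinate is bounded by the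
  norm.\<close>

lemma emeasure_frame_lborel_ball_le:
  assumes B: "orthonormal_basis V B" and "0 \<le> R"
  shows "emeasure (frame_lborel B) (ball 0 R) \<le> ennreal ((2 * R) ^ dim V)"
proof -
  note fin = orthonormal_basis_finite[OF B]
  have sub: "{x \<in> space (\<Pi>\<^sub>M b\<in>B. lborel). (\<Sum>b\<in>B. x b *\<^sub>R b) \<in> ball 0 R} \<subseteq> (\<Pi>\<^sub>E b\<in>B. {-R..R})"
  proof
    fix x assume x: "x \<in> {x \<in> space (\<Pi>\<^sub>M b\<in>B. lborel). (\<Sum>b\<in>B. x b *\<^sub>R b) \<in> ball 0 R}"
    define y where "y = (\<Sum>b\<in>B. x b *\<^sub>R b)"
    have y: "norm y < R" and ext: "x \<in> extensional B" using x by (auto simp: y_def space_PiM PiE_def)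
    have "\<bar>x b\<bar> \<le> R" if "b \<in> B" for b
    proof -
      have "\<bar>y \<bullet> b\<bar> \<le> norm y * norm b" by (rule Cauchy_Schwarz_ineq2)
      moreover have "y \<bullet> b = x b" unfolding y_def using B that by (rule orthonormal_basis_coord)
      moreover have "norm b = 1" using B that by (simp add: orthonormal_basis_def)
      ultimately show ?thesis using y by simp
    qed
    then show "x \<in> (\<Pi>\<^sub>E b\<in>B. {-R..R})" using ext by (simp add: PiE_iff abs_le_iff minus_le_iff)
  qed
  have "emeasure (frame_lborel B) (ball 0 R)
      = emeasure (\<Pi>\<^sub>M b\<in>B. lborel) {x \<in> space (\<Pi>\<^sub>M b\<in>B. lborel). (\<Sum>b\<in>B. x b *\<^sub>R b) \<in> ball 0 R}"
    unfolding frame_lborel_def by (subst emeasure_distr) (simp_all add: vimage_def Int_def conj_commute)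
  also have "\<dots> \<le> emeasure (\<Pi>\<^sub>M b\<in>B. lborel) (\<Pi>\<^sub>E b\<in>B. {-R..R})"
    using sub fin by (intro emeasure_mono) auto
  also have "\<dots> = ennreal ((2 * R) ^ dim V)"
    using fin \<open>0 \<le> R\<close> orthonormal_basis_card[OF B]
    by (subst lborel_product.emeasure_PiM) (auto simp: ennreal_power)
  finally show ?thesis .
qed

text \<open>By the triangle inequality the ball contains the cube of half side R / dim V.\<close>

lemma emeasure_frame_lborel_ball_ge:
  assumes B: "orthonormal_basis V B" and "0 < R" "0 < dim V"
  shows "ennreal ((2 * R / dim V) ^ dim V) \<le> emeasure (frame_lborel B) (ball 0 R)"
proof -
  note fin = orthonormal_basis_finite[OF B]
  define r where "r = R / dim V"
  have r: "0 < r" using assms by (simp add: r_def)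
  have sub: "(\<Pi>\<^sub>E b\<in>B. {-r<..<r}) \<subseteq> {x \<in> space (\<Pi>\<^sub>M b\<in>B. lborel). (\<Sum>b\<in>B. x b *\<^sub>R b) \<in> ball 0 R}"
  proof
    fix x assume x: "x \<in> (\<Pi>\<^sub>E b\<in>B. {-r<..<r})"
    have "norm (\<Sum>b\<in>B. x b *\<^sub>R b) \<le> (\<Sum>b\<in>B. norm (x b *\<^sub>R b))" by (rule norm_sum)
    also have "\<dots> < (\<Sum>b\<in>B. r)"
    proof (rule sum_strict_mono)
      show "B \<noteq> {}" using orthonormal_basis_card[OF B] assms(3) by (metis card.empty less_irrefl)
      fix b assume "b \<in> B"
      then have "-r < x b" "x b < r" "norm b = 1" using x B by (auto simp: orthonormal_basis_def)
      then show "norm (x b *\<^sub>R b) < r" by simp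
    qed fact
    also have "\<dots> = R" using orthonormal_basis_card[OF B] assms(3) by (simp add: r_def del: dim_eq_0)
    finally show "x \<in> {x \<in> space (\<Pi>\<^sub>M b\<in>B. lborel). (\<Sum>b\<in>B. x b *\<^sub>R b) \<in> ball 0 R}"
      using x by (auto simp: space_PiM)
  qed
  have "ennreal ((2 * R / dim V) ^ dim V) = emeasure (\<Pi>\<^sub>M b\<in>B. lborel) (\<Pi>\<^sub>E b\<in>B. {-r<..<r})"
    using fin r orthonormal_basis_card[OF B]
    by (subst lborel_product.emeasure_PiM) (auto simp: ennreal_power r_def)
  also have "\<dots> \<le> emeasure (\<Pi>\<^sub>M b\<in>B. lborel) {x \<in> space (\<Pi>\<^sub>M b\<in>B. lborel). (\<Sum>b\<in>B. x b *\<^sub>R b) \<in> ball 0 R}"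
  proof (rule emeasure_mono[OF sub])
    show "{x \<in> space (\<Pi>\<^sub>M b\<in>B. lborel). (\<Sum>b\<in>B. x b *\<^sub>R b) \<in> ball 0 R} \<in> sets (\<Pi>\<^sub>M b\<in>B. lborel)"
      unfolding mem_ball dist_0_norm by measurable
  qed
  also have "\<dots> = emeasure (frame_lborel B) (ball 0 R)"
    unfolding frame_lborel_def by (subst emeasure_distr) (simp_all add: vimage_def Int_def conj_commute)
  finally show ?thesis .
qed

lemma sigma_finite_measure_ballsI:
  fixes M :: "'a::euclidean_space measure"
  assumes "sets M = sets borel" "\<And>i::nat. emeasure M (ball 0 (real i)) \<noteq> \<infinity>"
  shows "sigma_finite_measure M"
proof
  have "(\<Union>i::nat. ball 0 (real i)) = (UNIV :: 'a set)"
    using reals_Archimedean2 by (auto simp: dist_norm)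
  then show "\<exists>A. countable A \<and> A \<subseteq> sets M \<and> \<Union> A = space M \<and> (\<forall>a\<in>A. emeasure M a \<noteq> \<infinity>)"
    using assms sets_eq_imp_space_eq[OF assms(1)]
    by (intro exI[of _ "range (\<lambda>i::nat. ball 0 (real i))"]) auto
qed

lemma sigma_finite_frame_lborel:
  assumes B: "orthonormal_basis V B" shows "sigma_finite_measure (frame_lborel B)"
proof (rule sigma_finite_measure_ballsI)
  show "emeasure (frame_lborel B) (ball 0 (real i)) \<noteq> \<infinity>" for i
    using emeasure_frame_lborel_ball_le[OF B, of "real i"] by (auto simp: top_unique)
qed simp

text \<open>Translating by c shifts the coordinate along b by \<open>c \<bullet> b\<close>, so the
  frame measure is translation invariant; it gives \<open>gauss\<close> mass 1 and therefore is
  Lebesgue measure.\<close>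

lemma frame_lborel_UNIV:
  fixes B :: "'a::euclidean_space set"
  assumes B: "orthonormal_basis UNIV B" shows "frame_lborel B = lborel"
proof (rule translation_invariant_eq_lborel)
  note fin = orthonormal_basis_finite[OF B]
  fix c :: 'a and f :: "'a \<Rightarrow> ennreal" assume [measurable]: "f \<in> borel_measurable borel"
  \<comment> \<open>The restriction to B keeps the shifted tuple extensional, that is, inside the
    product space.\<close>
  define t where "t x = (\<lambda>b\<in>B. c \<bullet> b + x b)" for x :: "'a \<Rightarrow> real"
  have [measurable]: "t \<in> (\<Pi>\<^sub>M b\<in>B. lborel) \<rightarrow>\<^sub>M (\<Pi>\<^sub>M b\<in>B. lborel)"
    unfolding t_def by measurable
  have c: "c = (\<Sum>b\<in>B. (c \<bullet> b) *\<^sub>R b)"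
  proof -
    have "c \<in> span B" using B by (simp add: orthonormal_basis_def)
    then show ?thesis
      using orthonormal_basis_expand[of B c] B fin by (auto simp: orthonormal_basis_def)
  qed
  have "distr (\<Pi>\<^sub>M b\<in>B. lborel) (\<Pi>\<^sub>M b\<in>B. lborel) t = (\<Pi>\<^sub>M b\<in>B. lborel)"
  proof (rule lborel_product.PiM_eqI)
    fix A :: "'a \<Rightarrow> real set" assume A: "\<And>i. i \<in> B \<Longrightarrow> A i \<in> sets lborel"
    have m: "(\<lambda>x. c \<bullet> b + x) -` A b \<in> sets lborel" if "b \<in> B" for b
    proof -
      have "(\<lambda>x. c \<bullet> b + x) \<in> borel_measurable borel" by simp
      from measurable_sets[OF this, of "A b"] A[OF that] show ?thesis by simp
    qed
    have "t -` Pi\<^sub>E B A \<inter> space (\<Pi>\<^sub>M b\<in>B. lborel) = (\<Pi>\<^sub>E b\<in>B. (\<lambda>x. c \<bullet> b + x) -` A b)"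
      by (auto simp: t_def space_PiM PiE_iff extensional_def)
    then have "emeasure (distr (\<Pi>\<^sub>M b\<in>B. lborel) (\<Pi>\<^sub>M b\<in>B. lborel) t) (Pi\<^sub>E B A)
        = emeasure (\<Pi>\<^sub>M b\<in>B. lborel) (\<Pi>\<^sub>E b\<in>B. (\<lambda>x. c \<bullet> b + x) -` A b)"
      using fin A by (subst emeasure_distr) (auto intro!: sets_PiM_I_finite)
    also have "\<dots> = (\<Prod>b\<in>B. emeasure lborel ((\<lambda>x. c \<bullet> b + x) -` A b))"
      using fin m by (subst lborel_product.emeasure_PiM) auto
    also have "\<dots> = (\<Prod>b\<in>B. emeasure lborel (A b))"
    proof (rule prod.cong)
      fix b assume "b \<in> B"
      then show "emeasure lborel ((\<lambda>x. c \<bullet> b + x) -` A b) = emeasure lborel (A b)"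
        by (subst (2) lborel_distr_plus[symmetric, of "c \<bullet> b"]) (use A in \<open>simp add: emeasure_distr\<close>)
    qed simp
    finally show "emeasure (distr (\<Pi>\<^sub>M b\<in>B. lborel) (\<Pi>\<^sub>M b\<in>B. lborel) t) (Pi\<^sub>E B A)
        = (\<Prod>b\<in>B. emeasure lborel (A b))" .
  qed (use fin in auto)
  note t = this
  have "(\<integral>\<^sup>+x. f (c + x) \<partial>frame_lborel B) = (\<integral>\<^sup>+x. f (\<Sum>b\<in>B. t x b *\<^sub>R b) \<partial>(\<Pi>\<^sub>M b\<in>B. lborel))"
    by (subst nn_integral_frame_lborel) (auto simp: t_def scaleR_add_left sum.distrib c[symmetric])
  also have "\<dots> = (\<integral>\<^sup>+x. f (\<Sum>b\<in>B. x b *\<^sub>R b) \<partial>distr (\<Pi>\<^sub>M b\<in>B. lborel) (\<Pi>\<^sub>M b\<in>B. lborel) t)"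
    by (subst nn_integral_distr) auto
  finally show "(\<integral>\<^sup>+x. f (c + x) \<partial>frame_lborel B) = (\<integral>\<^sup>+x. f x \<partial>frame_lborel B)"
    unfolding t by (simp add: nn_integral_frame_lborel)
qed (use nn_integral_gauss_frame_lborel[OF B] nn_integral_gauss_lborel sigma_finite_frame_lborel[OF B] in auto)

text \<open>The image of Lebesgue measure under T is again translation invariant, and T preserves
  \<open>gauss\<close>, so the same characterization of Lebesgue measure applies.\<close>

lemma nn_integral_lborel_orthogonal_transformation:
  fixes T :: "'a::euclidean_space \<Rightarrow> 'a"
  assumes T: "orthogonal_transformation T" and f: "f \<in> borel_measurable borel"
  shows "(\<integral>\<^sup>+x. f (T x) \<partial>lborel) = (\<integral>\<^sup>+x. f x \<partial>lborel)"
proof -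
  have [measurable]: "T \<in> borel_measurable borel"
    using T by (intro borel_measurable_continuous_onI linear_continuous_on)
      (auto simp: linear_conv_bounded_linear[symmetric] orthogonal_transformation_linear)
  have "distr lborel borel T = lborel"
  proof (rule translation_invariant_eq_lborel)
    show "sigma_finite_measure (distr lborel borel T)"
    proof (rule sigma_finite_measure_ballsI)
      fix i :: nat
      have "T -` ball 0 (real i) = ball 0 (real i)"
        using T by (auto simp: orthogonal_transformation_norm)
      then show "emeasure (distr lborel borel T) (ball 0 (real i)) \<noteq> \<infinity>"
        using emeasure_lborel_ball_finite[of "0::'a" "real i"] by (simp add: emeasure_distr)
    qed simp
    fix c :: 'a and f :: "'a \<Rightarrow> ennreal" assume [measurable]: "f \<in> borel_measurable borel"
    obtain d where d: "c = T d" using orthogonal_transformation_surj[OF T] by (metis surjD)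
    have "(\<integral>\<^sup>+x. f (c + x) \<partial>distr lborel borel T) = (\<integral>\<^sup>+x. f (T (d + x)) \<partial>lborel)"
      using T by (simp add: nn_integral_distr d linear_add orthogonal_transformation_linear)
    also have "\<dots> = (\<integral>\<^sup>+x. f (T x) \<partial>lborel)"
      by (subst (2) lborel_distr_plus[symmetric, of d]) (simp add: nn_integral_distr)
    finally show "(\<integral>\<^sup>+x. f (c + x) \<partial>distr lborel borel T) = (\<integral>\<^sup>+x. f x \<partial>distr lborel borel T)"
      by (simp add: nn_integral_distr)
  qed (use T nn_integral_gauss_lborel in \<open>auto simp: nn_integral_distr gauss_orthogonal_transformation\<close>)
  moreover have "(\<integral>\<^sup>+x. f (T x) \<partial>lborel) = (\<integral>\<^sup>+x. f x \<partial>distr lborel borel T)"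
    using f by (simp add: nn_integral_distr)
  ultimately show ?thesis by simp
qed

lemma AE_frame_lborel:
  assumes B: "orthonormal_basis V B" shows "AE x in frame_lborel B. x \<in> V"
proof -
  have "V \<in> sets borel" using subspace_orthonormal_basis[OF B] by (simp add: closed_subspace)
  then show ?thesis unfolding frame_lborel_def
    using orthonormal_basis_sum_mem[OF B] by (subst AE_distr_iff) auto
qed

text \<open>B is extended by an orthonormal basis of the complement, over which the Gaussian
  integrates to 1. The right-hand side knows V only through \<open>proj V\<close>: this yields
  independence of the basis and, later, measurability in V.\<close>

lemma nn_integral_frame_lborel_gauss:
  fixes g :: "'a::euclidean_space \<Rightarrow> ennreal"
  assumes B: "orthonormal_basis V B" and [measurable]: "g \<in> borel_measurable borel"
  shows "(\<integral>\<^sup>+x. g x \<partial>frame_lborel B) = (\<integral>\<^sup>+x. g (proj V x) * gauss (x - proj V x) \<partial>lborel)"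
proof -
  have V: "subspace V" using B by (rule subspace_orthonormal_basis)
  note borel_measurable_proj[OF V, measurable]
  obtain C where C: "orthonormal_basis (V\<^sup>\<bottom>) C"
    using orthonormal_basis_exists[OF subspace_orthogonal_comp] .
  have U: "orthonormal_basis UNIV (B \<union> C)" "B \<inter> C = {}"
    using orthonormal_basis_Un[of V UNIV B C] B C V by auto
  have m: "(\<lambda>x. g (proj V x) * gauss (x - proj V x)) \<in> borel_measurable borel"
    by measurable
  have "(\<integral>\<^sup>+x. g (proj V x) * gauss (x - proj V x) \<partial>lborel)
      = (\<integral>\<^sup>+x. (\<integral>\<^sup>+y. g (proj V (x + y)) * gauss ((x + y) - proj V (x + y)) \<partial>frame_lborel C) \<partial>frame_lborel B)"
    using nn_integral_frame_lborel_Un[OF orthonormal_basis_finite[OF B] orthonormal_basis_finite[OF C] U(2) m]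
    by (simp only: frame_lborel_UNIV[OF U(1)])
  also have "\<dots> = (\<integral>\<^sup>+x. (\<integral>\<^sup>+y. g x * gauss y \<partial>frame_lborel C) \<partial>frame_lborel B)"
  proof (rule nn_integral_cong_AE, rule eventually_mono[OF AE_frame_lborel[OF B]])
    fix x assume "x \<in> V"
    then show "(\<integral>\<^sup>+y. g (proj V (x + y)) * gauss ((x + y) - proj V (x + y)) \<partial>frame_lborel C)
        = (\<integral>\<^sup>+y. g x * gauss y \<partial>frame_lborel C)"
      using V by (intro nn_integral_cong_AE eventually_mono[OF AE_frame_lborel[OF C]])
        (simp add: proj_add proj_id proj_zero)
  qed
  also have "\<dots> = (\<integral>\<^sup>+x. g x \<partial>frame_lborel B)"
    by (simp add: nn_integral_cmult nn_integral_gauss_frame_lborel[OF C])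
  finally show ?thesis ..
qed

section \<open>Lebesgue measure of a subspace, independent of the basis\<close>

lemma sets_subspace_lborel [measurable_cong, simp]: "sets (subspace_lborel V) = sets borel"
  and space_subspace_lborel [simp]: "space (subspace_lborel V) = UNIV"
  by (simp_all add: subspace_lborel_def Let_def)

lemma subspace_lborel_eq:
  assumes B: "orthonormal_basis V B" shows "subspace_lborel V = frame_lborel B"
proof (rule measure_eqI)
  let ?B = "SOME B. orthonormal_basis V B"
  have B': "orthonormal_basis V ?B" using B by (rule someI)
  fix A assume "A \<in> sets (subspace_lborel V)"
  then have [measurable]: "A \<in> sets borel" by simp
  have "emeasure (subspace_lborel V) A = (\<integral>\<^sup>+x. indicator A x \<partial>frame_lborel ?B)"
    by (simp add: subspace_lborel_def frame_lborel_def[symmetric])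
  also have "\<dots> = (\<integral>\<^sup>+x. indicator A x \<partial>frame_lborel B)"
    using nn_integral_frame_lborel_gauss[OF B', of "indicator A"] nn_integral_frame_lborel_gauss[OF B, of "indicator A"] by simp
  finally show "emeasure (subspace_lborel V) A = emeasure (frame_lborel B) A" by simp
qed simp

lemma subspace_lborel_eqE:
  assumes "subspace V" obtains B where "orthonormal_basis V B" "subspace_lborel V = frame_lborel B"
  using orthonormal_basis_exists[OF assms] subspace_lborel_eq by metis

lemma AE_subspace_lborel: "subspace V \<Longrightarrow> AE x in subspace_lborel V. x \<in> V"
  by (metis subspace_lborel_eqE AE_frame_lborel)

lemma sigma_finite_subspace_lborel: "subspace V \<Longrightarrow> sigma_finite_measure (subspace_lborel V)"
  by (metis subspace_lborel_eqE sigma_finite_frame_lborel)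

lemma nn_integral_gauss_subspace_lborel: "subspace V \<Longrightarrow> (\<integral>\<^sup>+x. gauss x \<partial>subspace_lborel V) = 1"
  by (metis subspace_lborel_eqE nn_integral_gauss_frame_lborel)

lemma emeasure_subspace_lborel_ball_le:
  "subspace V \<Longrightarrow> 0 \<le> R \<Longrightarrow> emeasure (subspace_lborel V) (ball 0 R) \<le> ennreal ((2 * R) ^ dim V)"
  by (metis subspace_lborel_eqE emeasure_frame_lborel_ball_le)

lemma emeasure_subspace_lborel_ball_ge:
  "subspace V \<Longrightarrow> 0 < R \<Longrightarrow> 0 < dim V \<Longrightarrow>
    ennreal ((2 * R / dim V) ^ dim V) \<le> emeasure (subspace_lborel V) (ball 0 R)"
  by (metis subspace_lborel_eqE emeasure_frame_lborel_ball_ge)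

lemma nn_integral_subspace_lborel_gauss:
  fixes g :: "'a::euclidean_space \<Rightarrow> ennreal"
  assumes "subspace V" "g \<in> borel_measurable borel"
  shows "(\<integral>\<^sup>+x. g x \<partial>subspace_lborel V) = (\<integral>\<^sup>+x. g (proj V x) * gauss (x - proj V x) \<partial>lborel)"
  using assms nn_integral_frame_lborel_gauss by (metis subspace_lborel_eqE)

lemma subspace_lborel_UNIV: "subspace_lborel (UNIV :: 'a::euclidean_space set) = lborel"
  by (simp only: subspace_lborel_eq[OF orthonormal_basis_Basis] frame_lborel_Basis)

lemma nn_integral_subspace_lborel_split:
  fixes g :: "'a::euclidean_space \<Rightarrow> ennreal"
  assumes W: "subspace W" "subspace V" "W \<subseteq> V" and g: "g \<in> borel_measurable borel"
  shows "(\<integral>\<^sup>+x. g x \<partial>subspace_lborel V)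
    = (\<integral>\<^sup>+x. (\<integral>\<^sup>+y. g (x + y) \<partial>subspace_lborel (V \<inter> W\<^sup>\<bottom>)) \<partial>subspace_lborel W)"
proof -
  obtain B where B: "orthonormal_basis W B" "subspace_lborel W = frame_lborel B"
    using subspace_lborel_eqE[OF W(1)] .
  obtain C where C: "orthonormal_basis (V \<inter> W\<^sup>\<bottom>) C" "subspace_lborel (V \<inter> W\<^sup>\<bottom>) = frame_lborel C"
    using subspace_lborel_eqE[of "V \<inter> W\<^sup>\<bottom>"] W by (auto simp: subspace_orthogonal_comp subspace_inter)
  have U: "orthonormal_basis V (B \<union> C)" "B \<inter> C = {}"
    using orthonormal_basis_Un[OF W B(1) C(1)] .
  then show ?thesis
    unfolding B C subspace_lborel_eq[OF U(1)] using B C g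
    by (intro nn_integral_frame_lborel_Un) (auto simp: orthonormal_basis_finite)
qed

lemma nn_integral_lborel_split:
  fixes g :: "'a::euclidean_space \<Rightarrow> ennreal"
  assumes W: "subspace W" and g: "g \<in> borel_measurable borel"
  shows "(\<integral>\<^sup>+x. g x \<partial>lborel) = (\<integral>\<^sup>+x. (\<integral>\<^sup>+y. g (x + y) \<partial>subspace_lborel (W\<^sup>\<bottom>)) \<partial>subspace_lborel W)"
  using nn_integral_subspace_lborel_split[OF W subspace_UNIV _ g] by (simp add: subspace_lborel_UNIV)

section \<open>Uniqueness of invariant measures\<close>

text \<open>The density argument of Mattila (\<^emph>\<open>Geometry of Sets and Measures in Euclidean Spaces\<close>,
  Theorem 3.4): balls of equal radius have equal mass, so \<open>N (U \<inter> ball x r) / M (ball x r)\<close> tends to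
  1 on \<open>U\<close>, and Fatou and Fubini apply.\<close>

lemma uniformly_distributed_le:
  fixes e :: "'p \<Rightarrow> 'e::{metric_space, second_countable_topology}"
  defines "B x r \<equiv> {y. dist (e x) (e y) < r}"
  assumes "prob_space M" "prob_space N" and MN [measurable_cong]: "sets N = sets M"
    and e [measurable]: "e \<in> borel_measurable M"
    and S: "AE x in M. x \<in> S" "AE x in N. x \<in> S"
    and uM: "\<And>x y r. x \<in> S \<Longrightarrow> y \<in> S \<Longrightarrow> emeasure M (B x r \<inter> space M) = emeasure M (B y r \<inter> space M)"
    and uN: "\<And>x y r. x \<in> S \<Longrightarrow> y \<in> S \<Longrightarrow> emeasure N (B x r \<inter> space M) = emeasure N (B y r \<inter> space M)"
    and "open V"
  shows "emeasure M (e -` V \<inter> space M) \<le> emeasure N (e -` V \<inter> space M)"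
proof -
  define U where "U = e -` V \<inter> space M"
  interpret M: prob_space M by fact
  interpret N: prob_space N by fact
  interpret P: pair_sigma_finite M N by standard
  have sp [simp]: "space N = space M"
    using MN by (rule sets_eq_imp_space_eq)
  have [measurable]: "e \<in> borel_measurable N" using e MN by (simp cong: measurable_cong_sets)
  have U [measurable]: "U \<in> sets M" unfolding U_def using \<open>open V\<close> by measurable
  have mB [measurable]: "B x r \<inter> space M \<in> sets M" for x r
  proof -
    have "B x r \<inter> space M = {y\<in>space M. dist (e x) (e y) < r}" by (auto simp: B_def)
    then show ?thesis by simp
  qed
  have mB' [measurable]: "A \<inter> B x r \<in> sets M" if "A \<in> sets M" for A x r
  proof -
    have "A \<inter> B x r = A \<inter> (B x r \<inter> space M)" using sets.sets_into_space[OF that] by auto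
    then show ?thesis using that mB by (metis sets.Int)
  qed
  have "S \<noteq> {}" using S(1) by (auto simp: M.AE_const)
  then obtain s where s: "s \<in> S" by auto
  define m where "m r = emeasure M (B s r \<inter> space M)" for r
  have m: "emeasure M (B x r \<inter> space M) = m r" if "x \<in> S" for x r
    using uM[OF that s] by (simp add: m_def)
  have pred [measurable]: "Measurable.pred (Q \<Otimes>\<^sub>M Q') (\<lambda>z. dist (e (fst z)) (e (snd z)) < r)"
    if [measurable_cong]: "sets Q = sets M" "sets Q' = sets M" for r Q Q'
  proof -
    have [measurable]: "e \<in> borel_measurable Q" "e \<in> borel_measurable Q'" using e that by (simp_all cong: measurable_cong_sets)
    show ?thesis by measurable
  qed
  \<comment> \<open>In this form the mass of the part of A in a ball is a section integral, hence
    measurable in the centre x and open to Fubini.\<close>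
  have slice: "emeasure Q (A \<inter> B x r) = (\<integral>\<^sup>+y. indicator A y * indicator {z\<in>space (M \<Otimes>\<^sub>M M). dist (e (fst z)) (e (snd z)) < r} (x, y) \<partial>Q)"
    if [measurable_cong]: "sets Q = sets M" and "x \<in> space M" and A: "A \<in> sets M" for x r A Q
  proof -
    have "A \<inter> B x r \<in> sets Q" using mB'[OF A] that(1) by simp
    then have "emeasure Q (A \<inter> B x r) = (\<integral>\<^sup>+y. indicator (A \<inter> B x r) y \<partial>Q)" by simp
    also have "\<dots> = (\<integral>\<^sup>+y. indicator A y * indicator {z\<in>space (M \<Otimes>\<^sub>M M). dist (e (fst z)) (e (snd z)) < r} (x, y) \<partial>Q)"
      using sets.sets_into_space[OF A] that(2)
      by (intro nn_integral_cong) (auto simp: B_def space_pair_measure split: split_indicator)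
    finally show ?thesis .
  qed
  \<comment> \<open>The relation \<open>dist (e x) (e y) < r\<close> is symmetric, so Fubini
    exchanges the roles of the two measures.\<close>
  have swap: "(\<integral>\<^sup>+x. indicator A x * emeasure N (A \<inter> B x r) \<partial>M) = (\<integral>\<^sup>+y. indicator A y * emeasure M (A \<inter> B y r) \<partial>N)"
    if A [measurable]: "A \<in> sets M" for A r
  proof -
    let ?I = "\<lambda>x y. indicator A x * (indicator A y * indicator {z\<in>space (M \<Otimes>\<^sub>M M). dist (e (fst z)) (e (snd z)) < r} (x, y)) :: ennreal"
    have 1: "indicator A x * emeasure Q (A \<inter> B x r) = (\<integral>\<^sup>+y. ?I x y \<partial>Q)"
      if Q [measurable_cong]: "sets Q = sets M" and x: "x \<in> space M" for x Q
      using slice[OF Q x A, of r] x by (simp add: nn_integral_cmult)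
    have "(\<integral>\<^sup>+x. indicator A x * emeasure N (A \<inter> B x r) \<partial>M) = (\<integral>\<^sup>+x. (\<integral>\<^sup>+y. ?I x y \<partial>N) \<partial>M)"
      using MN by (intro nn_integral_cong 1) auto
    also have "\<dots> = (\<integral>\<^sup>+y. (\<integral>\<^sup>+x. ?I x y \<partial>M) \<partial>N)"
      by (intro P.Fubini'[symmetric]) measurable
    also have "\<dots> = (\<integral>\<^sup>+y. (\<integral>\<^sup>+x. ?I y x \<partial>M) \<partial>N)"
      by (intro nn_integral_cong) (auto split: split_indicator simp: dist_commute space_pair_measure)
    also have "\<dots> = (\<integral>\<^sup>+y. indicator A y * emeasure M (A \<inter> B y r) \<partial>N)"
      by (intro nn_integral_cong 1[symmetric]) auto
    finally show ?thesis .
  qed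
  have swap': "(\<integral>\<^sup>+x. emeasure N (B x r \<inter> space M) \<partial>M) = (\<integral>\<^sup>+y. emeasure M (B y r \<inter> space M) \<partial>N)" for r
  proof -
    have "(\<integral>\<^sup>+x. emeasure N (B x r \<inter> space M) \<partial>M) = (\<integral>\<^sup>+x. indicator (space M) x * emeasure N (space M \<inter> B x r) \<partial>M)"
      by (intro nn_integral_cong) (simp add: Int_commute)
    also have "\<dots> = (\<integral>\<^sup>+y. indicator (space M) y * emeasure M (space M \<inter> B y r) \<partial>N)"
      by (rule swap) simp
    also have "\<dots> = (\<integral>\<^sup>+y. emeasure M (B y r \<inter> space M) \<partial>N)"
      by (intro nn_integral_cong) (simp add: Int_commute)
    finally show ?thesis .
  qed
  \<comment> \<open>The common ball mass of N, averaged over M, equals by Fubini the common ball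
    mass of M averaged over N. So the two normalizations coincide.\<close>
  have mN: "emeasure N (B x r \<inter> space M) = m r" if "x \<in> S" for x r
  proof -
    have "emeasure N (B x r \<inter> space M) = (\<integral>\<^sup>+y. emeasure N (B x r \<inter> space M) \<partial>M)"
      by (simp add: M.emeasure_space_1)
    also have "\<dots> = (\<integral>\<^sup>+y. emeasure N (B y r \<inter> space M) \<partial>M)"
      using uN[OF that] by (intro nn_integral_cong_AE eventually_mono[OF S(1)]) auto
    also have "\<dots> = (\<integral>\<^sup>+y. m r \<partial>N)" unfolding swap'
      using m by (intro nn_integral_cong_AE eventually_mono[OF S(2)]) auto
    also have "\<dots> = m r"
      using N.emeasure_space_1 by simp
    finally show ?thesis .
  qed
  \<comment> \<open>If balls of radius r were null, countably many of them would cover S by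
    Lindelof's theorem, and M would vanish.\<close>
  have pos: "0 < m r" if "0 < r" for r
  proof (rule ccontr)
    assume "\<not> 0 < m r"
    then have 0: "m r = 0" by simp
    obtain F where F: "F \<subseteq> (\<lambda>x. ball (e x) r) ` S" "countable F" "\<Union>F = \<Union>((\<lambda>x. ball (e x) r) ` S)"
      using Lindelof[of "(\<lambda>x. ball (e x) r) ` S"] by auto
    have "e -` G \<inter> space M \<in> null_sets M" if "G \<in> F" for G
    proof -
      obtain x where x: "x \<in> S" "G = ball (e x) r" using F(1) \<open>G \<in> F\<close> by auto
      have "e -` G \<inter> space M = B x r \<inter> space M" by (auto simp: x B_def)
      then show ?thesis using m[OF x(1), of r] 0 mB by (auto intro!: null_setsI)
    qed
    then have "(\<Union>G\<in>F. e -` G \<inter> space M) \<in> null_sets M"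
      using F(2) by (intro null_sets_UN') auto
    from AE_not_in[OF this] S(1) AE_space have "AE x in M. False"
    proof eventually_elim
      case (elim x)
      then have "e x \<in> \<Union>((\<lambda>x. ball (e x) r) ` S)" using \<open>0 < r\<close> by (intro UnionI[of "ball (e x) r"]) auto
      then have "e x \<in> \<Union>F" by (simp only: F(3))
      then show ?case using elim by auto
    qed
    then show False by simp
  qed
  define r where "r i = 1 / real (Suc i)" for i
  have r: "0 < r i" for i by (simp add: r_def)
  have mfin: "m (r i) < \<infinity>" for i by (simp add: m_def less_top[symmetric])
  let ?F = "\<lambda>i x. indicator U x * emeasure N (U \<inter> B x (r i)) / m (r i)"
  have [measurable]: "(\<lambda>x. emeasure N (U \<inter> B x q)) \<in> borel_measurable M" for q
    by (subst measurable_cong[OF slice[OF MN _ U]]) measurable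
  have "emeasure M U = (\<integral>\<^sup>+x. indicator U x \<partial>M)" by simp
  also have "\<dots> \<le> (\<integral>\<^sup>+x. liminf (\<lambda>i. ?F i x) \<partial>M)"
  proof (rule nn_integral_mono_AE, rule eventually_mono[OF S(1)])
    fix x assume x: "x \<in> S"
    show "indicator U x \<le> liminf (\<lambda>i. ?F i x)"
    proof (cases "x \<in> U")
      case True
      then have "e x \<in> V" by (simp add: U_def)
      then obtain d where d: "0 < d" "ball (e x) d \<subseteq> V"
        using openE[OF \<open>open V\<close>] by metis
      obtain n where n: "1 / real (Suc n) < d" using nat_approx_posE[OF d(1)] .
      have "\<forall>\<^sub>F i in sequentially. 1 \<le> ?F i x"
        unfolding eventually_sequentially
      proof (intro exI allI impI)
        fix i assume "n \<le> i"
        then have "r i \<le> 1 / real (Suc n)" unfolding r_def by (intro divide_left_mono) auto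
        then have "r i \<le> d" using n by linarith
        then have "ball (e x) (r i) \<subseteq> V" using d(2) subset_ball by blast
        then have "U \<inter> B x (r i) = B x (r i) \<inter> space M" by (auto simp: U_def B_def subset_eq)
        then show "1 \<le> ?F i x" using True mN[OF x, of "r i"] pos[OF r, of i] mfin[of i] by (simp add: ennreal_divide_self)
      qed
      then have "1 \<le> liminf (\<lambda>i. ?F i x)" by (rule Liminf_bounded)
      then show ?thesis using True by simp
    qed simp
  qed
  also have "\<dots> \<le> liminf (\<lambda>i. \<integral>\<^sup>+x. ?F i x \<partial>M)"
    by (intro nn_integral_liminf) simp
  also have "\<dots> \<le> liminf (\<lambda>i. emeasure N U)"
  proof (rule Liminf_mono, intro always_eventually allI)
    fix i
    have "(\<integral>\<^sup>+x. ?F i x \<partial>M) = (\<integral>\<^sup>+x. indicator U x * emeasure N (U \<inter> B x (r i)) \<partial>M) / m (r i)"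
      by (intro nn_integral_divide) simp
    also have "\<dots> = (\<integral>\<^sup>+y. indicator U y * emeasure M (U \<inter> B y (r i)) \<partial>N) / m (r i)"
      by (subst swap) auto
    also have "\<dots> \<le> (\<integral>\<^sup>+y. m (r i) * indicator U y \<partial>N) / m (r i)"
    proof (intro divide_right_mono_ennreal nn_integral_mono_AE, rule eventually_mono[OF S(2)])
      fix y assume "y \<in> S"
      have "emeasure M (U \<inter> B y (r i)) \<le> emeasure M (B y (r i) \<inter> space M)"
        using sets.sets_into_space[OF U] by (intro emeasure_mono mB) auto
      then show "indicator U y * emeasure M (U \<inter> B y (r i)) \<le> m (r i) * indicator U y"
        using m[OF \<open>y \<in> S\<close>] by (auto split: split_indicator)
    qed
    also have "\<dots> = emeasure N U"
    proof -
      have "(\<integral>\<^sup>+y. m (r i) * indicator U y \<partial>N) = emeasure N U * m (r i)"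
        using MN by (subst nn_integral_cmult_indicator) (auto simp: mult.commute)
      then show ?thesis using pos[OF r, of i] mfin[of i] by (simp add: ennreal_mult_divide_eq)
    qed
    finally show "(\<integral>\<^sup>+x. ?F i x \<partial>M) \<le> emeasure N U" .
  qed
  finally show ?thesis by (simp add: Liminf_const U_def)
qed

text \<open>Maps that are transitive on S and preserve distances and both measures force balls of
  equal radius to have equal mass for each measure; the preceding estimate then applies in both
  directions on open sets. The metric is imported through \<open>e\<close>, and \<open>gen\<close>
  makes agreement on preimages of open sets sufficient. S may be smaller than the space, because
  transitivity on a set of full measure is all that orthogonal pairs offer.\<close>

lemma homogeneous_probability_unique:
  fixes e :: "'p \<Rightarrow> 'e::{metric_space, second_countable_topology}"
  assumes M: "prob_space M" and N: "prob_space N" and eq: "sets N = sets M"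
    and e [measurable]: "e \<in> borel_measurable M"
    and gen: "\<And>A. A \<in> sets M \<Longrightarrow> \<exists>B\<in>sets borel. A = e -` B \<inter> space M"
    and S: "AE x in M. x \<in> S" "AE x in N. x \<in> S"
    and trans: "\<And>x y. x \<in> S \<Longrightarrow> y \<in> S \<Longrightarrow> \<exists>g. g x = y \<and> (\<forall>z\<in>space M. dist (e (g x)) (e (g z)) = dist (e x) (e z)) \<and>
        g \<in> measurable M M \<and> distr M M g = M \<and> distr N N g = N"
  shows "M = N"
proof -
  have sp: "space N = space M" using eq by (rule sets_eq_imp_space_eq)
  have eN [measurable]: "e \<in> borel_measurable N" using e eq by (simp cong: measurable_cong_sets)
  have mB: "{z. dist (e x) (e z) < r} \<inter> space M \<in> sets M" for x r
  proof -
    have "{z\<in>space M. dist (e x) (e z) < r} \<in> sets M" by measurable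
    then show ?thesis by (simp add: Int_def conj_commute)
  qed
  have uni: "emeasure Q ({z. dist (e x) (e z) < r} \<inter> space M) = emeasure Q ({z. dist (e y) (e z) < r} \<inter> space M)"
    if Q: "sets Q = sets M" "\<And>g. distr M M g = M \<Longrightarrow> distr N N g = N \<Longrightarrow> distr Q Q g = Q"
      and xy: "x \<in> S" "y \<in> S" for Q x y r
  proof -
    have spQ: "space Q = space M" using Q(1) by (rule sets_eq_imp_space_eq)
    obtain g where g: "g x = y" "\<And>z. z \<in> space M \<Longrightarrow> dist (e (g x)) (e (g z)) = dist (e x) (e z)"
        "g \<in> measurable M M" "distr M M g = M" "distr N N g = N"
      using trans[OF xy] by auto
    have gQ: "distr Q Q g = Q" using g Q(2) by simp
    have [measurable]: "g \<in> measurable Q Q" using g(3) Q(1) by (simp cong: measurable_cong_sets)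
    have "emeasure Q ({z. dist (e y) (e z) < r} \<inter> space M)
        = emeasure (distr Q Q g) ({z. dist (e y) (e z) < r} \<inter> space M)" by (simp add: gQ)
    also have "\<dots> = emeasure Q (g -` ({z. dist (e y) (e z) < r} \<inter> space M) \<inter> space Q)"
      using mB Q(1) by (intro emeasure_distr) auto
    also have "g -` ({z. dist (e y) (e z) < r} \<inter> space M) \<inter> space Q = {z. dist (e x) (e z) < r} \<inter> space M"
      using g measurable_space[OF g(3)] by (auto simp: spQ)
    finally show ?thesis ..
  qed
  have uniM: "emeasure M ({z. dist (e x) (e z) < r} \<inter> space M) = emeasure M ({z. dist (e y) (e z) < r} \<inter> space M)"
    if "x \<in> S" "y \<in> S" for x y r
    by (rule uni[OF refl _ that])
  have uniN: "emeasure N ({z. dist (e x) (e z) < r} \<inter> space M) = emeasure N ({z. dist (e y) (e z) < r} \<inter> space M)"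
    if "x \<in> S" "y \<in> S" for x y r
    by (rule uni[OF eq _ that])
  have le: "emeasure M (e -` V \<inter> space M) = emeasure N (e -` V \<inter> space M)" if "open V" for V
  proof (rule antisym)
    show "emeasure M (e -` V \<inter> space M) \<le> emeasure N (e -` V \<inter> space M)"
      by (rule uniformly_distributed_le[OF M N eq e S uniM uniN that])
    show "emeasure N (e -` V \<inter> space M) \<le> emeasure M (e -` V \<inter> space M)"
      by (rule uniformly_distributed_le[OF N M eq[symmetric] eN S(2,1), unfolded sp, OF uniN uniM that])
  qed
  have "distr M borel e = distr N borel e"
  proof (rule measure_eqI_generator_eq[where E="{U. open U}" and \<Omega>=UNIV and A="\<lambda>_. UNIV"])
    show "emeasure (distr M borel e) X = emeasure (distr N borel e) X" if "X \<in> {U. open U}" for X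
      using le[of X] that by (simp add: emeasure_distr sp)
    show "emeasure (distr M borel e) UNIV \<noteq> \<infinity>"
      using prob_space.emeasure_space_1[OF prob_space.prob_space_distr[OF M e]] by simp
  qed (auto simp: Int_stable_def borel_def sets_measure_of)
  note d = this
  show ?thesis
  proof (rule measure_eqI)
    fix A assume "A \<in> sets M"
    then obtain B where B: "B \<in> sets borel" "A = e -` B \<inter> space M" using gen by metis
    then have "emeasure M A = emeasure (distr M borel e) B" by (simp add: emeasure_distr)
    also have "\<dots> = emeasure N A" unfolding d using B sp by (simp add: emeasure_distr)
    finally show "emeasure M A = emeasure N A" .
  qed (simp add: eq)
qed

section \<open>Measurable structure of the Grassmannians\<close>

lemma space_plane_algebra [simp]: "space (plane_algebra S) = S"
  by (simp add: plane_algebra_def space_measure_of_conv)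

lemma sets_plane_algebra:
  "sets (plane_algebra S) = sigma_sets S {{\<tau> \<in> S. \<tau> \<inter> U \<noteq> {}} | U. open U}"
  unfolding plane_algebra_def by (intro sets_measure_of) auto

lemma hitting_set_in_plane_algebra:
  "open U \<Longrightarrow> {\<tau> \<in> S. \<tau> \<inter> U \<noteq> {}} \<in> sets (plane_algebra S)"
  unfolding sets_plane_algebra by auto

lemma measurable_plane_algebraI:
  assumes "\<And>x. x \<in> space M \<Longrightarrow> f x \<in> S"
    and "\<And>U. open U \<Longrightarrow> {x \<in> space M. f x \<inter> U \<noteq> {}} \<in> sets M"
  shows "f \<in> measurable M (plane_algebra S)"
  unfolding plane_algebra_def
proof (rule measurable_measure_of)
  fix y assume "y \<in> {{\<tau> \<in> S. \<tau> \<inter> U \<noteq> {}} | U. open U}"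
  then obtain U where "open U" "y = {\<tau> \<in> S. \<tau> \<inter> U \<noteq> {}}" by auto
  moreover have "f -` {\<tau> \<in> S. \<tau> \<inter> U \<noteq> {}} \<inter> space M = {x \<in> space M. f x \<inter> U \<noteq> {}}"
    using assms(1) by auto
  ultimately show "f -` y \<inter> space M \<in> sets M" using assms(2) by simp
qed (use assms(1) in auto)

text \<open>Hitting an open set is an existential statement over uncountably many points. A
  continuous parametrization reduces it to a countable dense set of parameters, which is how
  measurability of plane-valued maps is proved.\<close>

lemma hit_range_iff:
  fixes h :: "'z::topological_space \<Rightarrow> 'a::topological_space"
  assumes D: "\<And>X. open X \<Longrightarrow> X \<noteq> {} \<Longrightarrow> \<exists>d\<in>D. d \<in> X"
    and h: "continuous_on UNIV h" and U: "open U"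
  shows "range h \<inter> U \<noteq> {} \<longleftrightarrow> (\<exists>z\<in>D. h z \<in> U)"
proof
  assume "range h \<inter> U \<noteq> {}"
  then have "h -` U \<noteq> {}" by auto
  moreover have "open (h -` U)" using open_vimage[OF U h] .
  ultimately obtain d where "d \<in> D" "d \<in> h -` U" using D by metis
  then show "\<exists>z\<in>D. h z \<in> U" by auto
qed auto

lemma measurable_hit_range:
  fixes h :: "'x \<Rightarrow> 'z::second_countable_topology \<Rightarrow> 'a::euclidean_space"
  assumes h: "\<And>x. x \<in> space M \<Longrightarrow> continuous_on UNIV (h x)" and U: "open U"
    and [measurable]: "\<And>z. (\<lambda>x. h x z) \<in> borel_measurable M"
  shows "{x \<in> space M. range (h x) \<inter> U \<noteq> {}} \<in> sets M"
proof -
  obtain D :: "'z set" where D: "countable D" "\<And>X. open X \<Longrightarrow> X \<noteq> {} \<Longrightarrow> \<exists>d\<in>D. d \<in> X"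
    using countable_dense_setE by blast
  have "{x \<in> space M. range (h x) \<inter> U \<noteq> {}} = (\<Union>z\<in>D. {x \<in> space M. h x z \<in> U})"
    using hit_range_iff[OF D(2) h U] by blast
  moreover have "{x \<in> space M. h x z \<in> U} \<in> sets M" for z
    using measurable_sets[OF assms(3)[of z], of U] U by (simp add: vimage_def Int_def conj_commute)
  ultimately show ?thesis using D(1) by auto
qed

lemma measurable_plane_range:
  fixes h :: "'x \<Rightarrow> 'z::second_countable_topology \<Rightarrow> 'a::euclidean_space"
  assumes "\<And>x. x \<in> space M \<Longrightarrow> f x \<in> S" "\<And>x. x \<in> space M \<Longrightarrow> f x = range (h x)"
    and "\<And>x. x \<in> space M \<Longrightarrow> continuous_on UNIV (h x)"
    and "\<And>z. (\<lambda>x. h x z) \<in> borel_measurable M"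
  shows "f \<in> measurable M (plane_algebra S)"
proof (rule measurable_plane_algebraI)
  fix U :: "'a set" assume "open U"
  have "{x \<in> space M. f x \<inter> U \<noteq> {}} = {x \<in> space M. range (h x) \<inter> U \<noteq> {}}"
    using assms(2) by auto
  then show "{x \<in> space M. f x \<inter> U \<noteq> {}} \<in> sets M"
    using measurable_hit_range[OF assms(3) \<open>open U\<close> assms(4)] by (simp only:)
qed (rule assms(1))

text \<open>The strict inequality has a countable witness: a point q of a dense set and a rational s
  with x in the ball of radius s about q and the plane hitting the ball of radius r - s. This
  exhibits a countable union of rectangles, hence joint measurability. The empty set is excluded
  because \<open>infdist\<close> to it is 0 by convention.\<close>

lemma borel_measurable_infdist_plane:
  fixes S :: "'a::euclidean_space set set"
  assumes "{} \<notin> S"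
  shows "(\<lambda>p. infdist (snd p) (fst p)) \<in> borel_measurable (plane_algebra S \<Otimes>\<^sub>M borel)"
proof (rule borel_measurableI_less)
  fix r
  obtain D :: "'a set" where D: "countable D" "\<And>X. open X \<Longrightarrow> X \<noteq> {} \<Longrightarrow> \<exists>d\<in>D. d \<in> X"
    using countable_dense_setE by blast
  have iff: "infdist x \<tau> < r \<longleftrightarrow> (\<exists>q\<in>D. \<exists>s\<in>\<rat>. x \<in> ball q s \<and> \<tau> \<inter> ball q (r - s) \<noteq> {})"
    if "\<tau> \<in> S" for x \<tau>
  proof
    have ne: "\<tau> \<noteq> {}" using that assms by auto
    assume "infdist x \<tau> < r"
    then obtain y where y: "y \<in> \<tau>" "dist x y < r"
      using ne cInf_lessD[of "dist x ` \<tau>" r] by (auto simp: infdist_notempty)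
    obtain s where s: "s \<in> \<rat>" "0 < s" "s < (r - dist x y) / 2"
      using Rats_dense_in_real[of 0 "(r - dist x y) / 2"] y by auto
    obtain q where q: "q \<in> D" "q \<in> ball x s" using D(2)[of "ball x s"] s by auto
    have "dist q y \<le> dist q x + dist x y" by (rule dist_triangle)
    then have "y \<in> ball q (r - s)" using s q by (simp add: dist_commute field_simps)
    then have "x \<in> ball q s \<and> \<tau> \<inter> ball q (r - s) \<noteq> {}"
      using q s y by (auto simp: dist_commute)
    then show "\<exists>q\<in>D. \<exists>s\<in>\<rat>. x \<in> ball q s \<and> \<tau> \<inter> ball q (r - s) \<noteq> {}"
      using q(1) s(1) by blast
  next
    assume "\<exists>q\<in>D. \<exists>s\<in>\<rat>. x \<in> ball q s \<and> \<tau> \<inter> ball q (r - s) \<noteq> {}"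
    then obtain q s y where y: "dist q x < s" "y \<in> \<tau>" "dist q y < r - s" by auto
    have "infdist x \<tau> \<le> dist x y" using y by (intro infdist_le)
    also have "\<dots> \<le> dist q x + dist q y" by (rule dist_triangle3)
    finally show "infdist x \<tau> < r" using y by simp
  qed
  have "{p \<in> space (plane_algebra S \<Otimes>\<^sub>M borel). infdist (snd p) (fst p) < r}
      = (\<Union>q\<in>D. \<Union>s\<in>\<rat>. {\<tau> \<in> S. \<tau> \<inter> ball q (r - s) \<noteq> {}} \<times> ball q s)"
    using iff by (simp add: space_pair_measure set_eq_iff) blast
  also have "\<dots> \<in> sets (plane_algebra S \<Otimes>\<^sub>M borel)"
    using D(1) countable_rat by (intro sets.countable_UN'' pair_measureI hitting_set_in_plane_algebra) auto
  finally show "{p \<in> space (plane_algebra S \<Otimes>\<^sub>M borel). infdist (snd p) (fst p) < r}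
      \<in> sets (plane_algebra S \<Otimes>\<^sub>M borel)" .
qed

section \<open>Linear planes and the measurability of their projections\<close>

lemma grassmannian_subspace: "\<xi> \<in> grassmannian V j \<Longrightarrow> subspace \<xi>"
  and grassmannian_subset: "\<xi> \<in> grassmannian V j \<Longrightarrow> \<xi> \<subseteq> V"
  and grassmannian_dim: "\<xi> \<in> grassmannian V j \<Longrightarrow> dim \<xi> = j"
  by (auto simp: grassmannian_def)

lemma grassmannian_UNIV: "\<xi> \<in> grassmannian V j \<Longrightarrow> \<xi> \<in> grassmannian UNIV j"
  by (auto simp: grassmannian_def)

lemma grassmannian_nonempty:
  assumes "subspace V" "j \<le> dim V" shows "grassmannian V j \<noteq> {}"
proof -
  have "span V = V" using assms(1) by simp
  then obtain T where "subspace T" "T \<subseteq> V" "dim T = j"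
    using choose_subspace_of_subspace[OF assms(2)] by metis
  then have "T \<in> grassmannian V j" by (simp add: grassmannian_def)
  then show ?thesis by blast
qed

lemma measurable_grassmannian_UNIV:
  "f \<in> measurable (plane_algebra (grassmannian UNIV j)) N \<Longrightarrow> f \<in> measurable (plane_algebra (grassmannian V j)) N"
proof -
  have "(\<lambda>x. x) \<in> measurable (plane_algebra (grassmannian V j)) (plane_algebra (grassmannian UNIV j))"
    by (rule measurable_plane_algebraI) (auto simp: grassmannian_UNIV hitting_set_in_plane_algebra)
  then show "f \<in> measurable (plane_algebra (grassmannian V j)) N" if "f \<in> measurable (plane_algebra (grassmannian UNIV j)) N"
    using that by (rule measurable_compose)
qed

text \<open>By Pythagoras the squared norm of the projection is a squared norm minus a squared
  distance; polarization recovers the bilinear form of the projection. Only distances to V remain on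
  the right.\<close>

lemma proj_inner_polarization:
  assumes V: "subspace V"
  shows "proj V x \<bullet> b = (((norm (x + b))\<^sup>2 - (infdist (x + b) V)\<^sup>2) - ((norm (x - b))\<^sup>2 - (infdist (x - b) V)\<^sup>2)) / 4"
proof -
  have n: "(norm y)\<^sup>2 - (infdist y V)\<^sup>2 = (norm (proj V y))\<^sup>2" for y
    using norm_proj_Pythagoras[OF V, of y] by (simp add: infdist_eq_norm_proj[OF V])
  have "proj V x \<bullet> b = proj V x \<bullet> proj V b"
    using orthogonal_compD[OF proj_diff_mem[OF V, of b] proj_mem[OF V, of x]]
    by (simp add: inner_diff_left inner_commute[of "proj V x"])
  then show ?thesis unfolding n using V
    by (simp add: proj_add proj_diff power2_norm_eq_inner inner_add_left inner_add_right
        inner_diff_left inner_diff_right inner_commute)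
qed

lemma borel_measurable_proj_plane [measurable (raw)]:
  fixes g :: "'x \<Rightarrow> 'a::euclidean_space"
  assumes f [measurable]: "f \<in> measurable M (plane_algebra (grassmannian V j))" and [measurable]: "g \<in> borel_measurable M"
  shows "(\<lambda>x. proj (f x) (g x)) \<in> borel_measurable M"
proof (subst borel_measurable_euclidean_space, intro ballI)
  fix b :: 'a
  have [measurable]: "(\<lambda>p. infdist (snd p) (fst p)) \<in> borel_measurable (plane_algebra (grassmannian V j) \<Otimes>\<^sub>M borel)"
    using subspace_0 by (intro borel_measurable_infdist_plane) (auto simp: grassmannian_def)
  have [measurable]: "(\<lambda>x. infdist (h x) (f x)) \<in> borel_measurable M" if [measurable]: "h \<in> borel_measurable M" for h
    using measurable_compose[of "\<lambda>x. (f x, h x)" M _ "\<lambda>p. infdist (snd p) (fst p)"] by simp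
  have "(\<lambda>x. (((norm (g x + b))\<^sup>2 - (infdist (g x + b) (f x))\<^sup>2) - ((norm (g x - b))\<^sup>2 - (infdist (g x - b) (f x))\<^sup>2)) / 4)
      \<in> borel_measurable M" by measurable
  note m = this
  have eq: "proj (f x) (g x) \<bullet> b = (((norm (g x + b))\<^sup>2 - (infdist (g x + b) (f x))\<^sup>2) - ((norm (g x - b))\<^sup>2 - (infdist (g x - b) (f x))\<^sup>2)) / 4"
    if "x \<in> space M" for x
    using measurable_space[OF f that] by (intro proj_inner_polarization) (simp add: grassmannian_def)
  show "(\<lambda>x. proj (f x) (g x) \<bullet> b) \<in> borel_measurable M"
    by (rule measurable_cong[OF eq, THEN iffD2, OF _ m])
qed

text \<open>The matrix of the orthogonal projection. Its Euclidean distance is the Hilbert-Schmidt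
  distance of projections, used as the metric on the Grassmannian.\<close>

definition proj_columns :: "(real^'n) set \<Rightarrow> real^'n^'n" where
  "proj_columns V = (\<chi> i. proj V (axis i 1))"

lemma proj_self_adjoint: "subspace V \<Longrightarrow> proj V x \<bullet> y = x \<bullet> proj V y"
proof -
  assume V: "subspace V"
  have "(x - proj V x) \<bullet> proj V y = 0" "(y - proj V y) \<bullet> proj V x = 0"
    using proj_mem[OF V] proj_diff_mem[OF V] by (auto dest: orthogonal_compD)
  then have "x \<bullet> proj V y = proj V x \<bullet> proj V y" "y \<bullet> proj V x = proj V y \<bullet> proj V x"
    by (simp_all only: inner_diff_left diff_eq_eq add_0)
  then show ?thesis by (simp only: inner_commute[of "proj V x" y] inner_commute[of "proj V y" "proj V x"])
qed

lemma norm_vec_sq: "(norm (Q :: 'a::real_normed_vector^'n))\<^sup>2 = (\<Sum>i\<in>UNIV. (norm (Q $ i))\<^sup>2)"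
  by (simp add: norm_vec_def L2_set_def sum_nonneg)

lemma sum_axis_inner: "(\<Sum>i\<in>UNIV. (axis i 1 \<bullet> x)\<^sup>2) = (norm (x :: real^'n))\<^sup>2"
  by (simp add: inner_axis' norm_vec_sq)

text \<open>The Hilbert-Schmidt norm does not depend on the orthonormal basis. Conjugation by T
  replaces the standard basis by its image under the inverse of T; Parseval's identity in both
  bases, with the self-adjointness of the difference of projections in between, returns to the
  standard one.\<close>

lemma dist_proj_columns_image:
  fixes A B :: "(real^'n) set" and T :: "real^'n \<Rightarrow> real^'n"
  assumes T: "orthogonal_transformation T" and A: "subspace A" and B: "subspace B"
  shows "dist (proj_columns (T ` A)) (proj_columns (T ` B)) = dist (proj_columns A) (proj_columns B)"
proof -
  define f where "f x = proj A x - proj B x" for x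
  define R where "R = inv T"
  have R: "orthogonal_transformation R" using orthogonal_transformation_inv[OF T] by (simp add: R_def)
  have TR: "T (R x) = x" for x
    unfolding R_def using orthogonal_transformation_surj[OF T] by (rule surj_f_inv_f)
  have adj: "f x \<bullet> y = x \<bullet> f y" for x y
    using A B by (simp add: f_def inner_diff_left inner_diff_right proj_self_adjoint)
  have d: "proj (T ` A) x - proj (T ` B) x = T (f (R x))" for x
    using proj_image[OF T A, of "R x"] proj_image[OF T B, of "R x"]
    by (simp add: TR f_def linear_diff orthogonal_transformation_linear[OF T])
  have parseval: "(\<Sum>i\<in>UNIV. (R (axis i 1) \<bullet> x)\<^sup>2) = (norm x)\<^sup>2" for x
  proof -
    have "R (axis i 1) \<bullet> x = axis i 1 \<bullet> T x" for i
      using T TR[of "axis i 1"] by (metis orthogonal_transformation_def)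
    then show ?thesis using sum_axis_inner[of "T x"] orthogonal_transformation_norm[OF T, of x] by simp
  qed
  have "(dist (proj_columns (T ` A)) (proj_columns (T ` B)))\<^sup>2 = (\<Sum>i\<in>UNIV. (norm (f (R (axis i 1))))\<^sup>2)"
    by (simp add: dist_norm norm_vec_sq proj_columns_def d orthogonal_transformation_norm[OF T])
  also have "\<dots> = (\<Sum>i\<in>UNIV. \<Sum>k\<in>UNIV. (R (axis i 1) \<bullet> f (axis k 1))\<^sup>2)"
  proof (intro sum.cong refl)
    fix i
    have "axis k 1 \<bullet> f (R (axis i 1)) = R (axis i 1) \<bullet> f (axis k 1)" for k
      by (simp only: adj inner_commute[of "axis k 1"])
    then show "(norm (f (R (axis i 1))))\<^sup>2 = (\<Sum>k\<in>UNIV. (R (axis i 1) \<bullet> f (axis k 1))\<^sup>2)"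
      by (simp only: sum_axis_inner[symmetric])
  qed
  also have "\<dots> = (\<Sum>k\<in>UNIV. (norm (f (axis k 1)))\<^sup>2)"
    by (subst sum.swap) (simp add: parseval)
  also have "\<dots> = (dist (proj_columns A) (proj_columns B))\<^sup>2"
    by (simp add: dist_norm norm_vec_sq proj_columns_def f_def)
  finally show ?thesis by simp
qed

lemma borel_measurable_proj_columns [measurable]:
  fixes V :: "(real^'n) set"
  shows "proj_columns \<in> borel_measurable (plane_algebra (grassmannian V j))"
proof (subst borel_measurable_euclidean_space, intro ballI)
  fix b :: "real^'n^'n" assume "b \<in> Basis"
  then obtain i c where b: "b = axis i c" by (auto simp: Basis_vec_def)
  have "proj_columns \<xi> \<bullet> b = proj \<xi> (axis i 1) \<bullet> c" for \<xi> :: "(real^'n) set"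
    by (simp add: b inner_axis proj_columns_def)
  then show "(\<lambda>\<xi>. proj_columns \<xi> \<bullet> b) \<in> borel_measurable (plane_algebra (grassmannian V j))"
    by simp
qed

text \<open>A subspace hits U exactly if its projection sends some x into U. For each x this is an
  open condition on the matrix, and open conditions survive the uncountable union over x.\<close>

lemma plane_algebra_eq_vimage:
  fixes V :: "(real^'n) set"
  assumes "A \<in> sets (plane_algebra (grassmannian V j))"
  shows "\<exists>B\<in>sets borel. A = proj_columns -` B \<inter> grassmannian V j"
proof -
  let ?S = "grassmannian V j"
  let ?V = "vimage_algebra ?S proj_columns (borel :: (real^'n^'n) measure)"
  have sV: "sets ?V = {proj_columns -` B \<inter> ?S |B. B \<in> sets borel}"
    by (rule sets_vimage_algebra2) simp
  have "{{\<tau> \<in> ?S. \<tau> \<inter> U \<noteq> {}} | U. open U} \<subseteq> sets ?V"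
  proof clarify
    fix U :: "(real^'n) set" assume "open U"
    let ?B = "{Q :: real^'n^'n. \<exists>x. (\<Sum>i\<in>UNIV. (x $ i) *\<^sub>R (Q $ i)) \<in> U}"
    have "?B = (\<Union>x::real^'n. (\<lambda>Q::real^'n^'n. (\<Sum>i\<in>UNIV. (x $ i) *\<^sub>R (Q $ i))) -` U)" by auto
    moreover have "open ((\<lambda>Q::real^'n^'n. (\<Sum>i\<in>UNIV. (x $ i) *\<^sub>R (Q $ i))) -` U)" for x :: "real^'n"
      using \<open>open U\<close> by (intro open_vimage continuous_intros)
    ultimately have "open ?B" by auto
    then have B: "?B \<in> sets borel" by (rule borel_open)
    have eq: "{\<tau> \<in> ?S. \<tau> \<inter> U \<noteq> {}} = proj_columns -` ?B \<inter> ?S"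
    proof -
      have "(\<Sum>i\<in>UNIV. (x $ i) *\<^sub>R (proj_columns \<xi> $ i)) = proj \<xi> x" if "subspace \<xi>" for \<xi> and x :: "real^'n"
      proof -
        have "proj \<xi> x = proj \<xi> (\<Sum>i\<in>UNIV. (x $ i) *\<^sub>R axis i 1)"
          using basis_expansion[of x] by (simp add: scalar_mult_eq_scaleR)
        also have "\<dots> = (\<Sum>i\<in>UNIV. (x $ i) *\<^sub>R proj \<xi> (axis i 1))"
          using linear_proj[OF that] by (simp add: linear_sum linear_scale)
        finally show ?thesis by (simp add: proj_columns_def)
      qed
      moreover have "\<xi> \<inter> U \<noteq> {} \<longleftrightarrow> (\<exists>x. proj \<xi> x \<in> U)" if "subspace \<xi>" for \<xi>
        using proj_mem[OF that] proj_id[OF that] by (metis disjoint_iff)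
      ultimately have "\<xi> \<inter> U \<noteq> {} \<longleftrightarrow> proj_columns \<xi> \<in> ?B" if "\<xi> \<in> ?S" for \<xi>
        using grassmannian_subspace[OF that] by simp
      then show ?thesis by (intro set_eqI) (simp only: mem_Collect_eq Int_iff vimage_eq, metis)
    qed
    show "{\<tau> \<in> ?S. \<tau> \<inter> U \<noteq> {}} \<in> sets ?V"
      unfolding sV mem_Collect_eq by (rule exI, rule conjI[OF eq B])
  qed
  from sets.sigma_sets_subset[OF this] have "sets (plane_algebra ?S) \<subseteq> sets ?V"
    by (simp only: sets_plane_algebra space_vimage_algebra)
  with assms have "A \<in> sets ?V" by blast
  then show ?thesis unfolding sV by blast
qed

section \<open>The invariant measure on a Grassmannian\<close>

definition gaussian :: "'a::euclidean_space measure" where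
  "gaussian = density lborel (\<lambda>x. ennreal (gauss x))"

lemma sets_gaussian [measurable_cong, simp]: "sets gaussian = sets borel"
  and space_gaussian [simp]: "space gaussian = UNIV"
  by (simp_all add: gaussian_def)

lemma nn_integral_gaussian:
  "f \<in> borel_measurable borel \<Longrightarrow> (\<integral>\<^sup>+x. f x \<partial>gaussian) = (\<integral>\<^sup>+x. f x * gauss x \<partial>lborel)"
  by (simp add: gaussian_def nn_integral_density mult.commute)

lemma prob_space_gaussian: "prob_space (gaussian :: 'a::euclidean_space measure)"
proof
  have "emeasure (gaussian :: 'a measure) UNIV = (\<integral>\<^sup>+x. 1 \<partial>(gaussian :: 'a measure))"
    by simp
  also have "\<dots> = 1" by (subst nn_integral_gaussian) (simp_all add: nn_integral_gauss_lborel)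
  finally show "emeasure (gaussian :: 'a measure) (space gaussian) = 1" by simp
qed

interpretation gaussian_product: product_sigma_finite "\<lambda>_::nat. gaussian :: 'a::euclidean_space measure"
  by (simp add: product_sigma_finite_def prob_space_gaussian prob_space_imp_sigma_finite)

abbreviation gaussian_tuple :: "nat \<Rightarrow> (nat \<Rightarrow> 'a::euclidean_space) measure" where
  "gaussian_tuple j \<equiv> \<Pi>\<^sub>M i\<in>{..<j}. gaussian"

lemma measurable_orthogonal_transformation:
  fixes T :: "'a::euclidean_space \<Rightarrow> 'a"
  assumes "orthogonal_transformation T" shows "T \<in> borel_measurable borel"
  using assms by (intro borel_measurable_continuous_onI linear_continuous_on)
    (auto simp: linear_conv_bounded_linear[symmetric] orthogonal_transformation_linear)

lemma distr_gaussian_orthogonal_transformation: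
  fixes T :: "'a::euclidean_space \<Rightarrow> 'a"
  assumes T: "orthogonal_transformation T"
  shows "distr gaussian gaussian T = gaussian"
proof (rule measure_eqI)
  note [measurable] = measurable_orthogonal_transformation[OF T]
  fix A assume "A \<in> sets (distr gaussian gaussian T)"
  then have [measurable]: "A \<in> sets borel" by simp
  have "emeasure (distr gaussian gaussian T) A = (\<integral>\<^sup>+x. indicator A x \<partial>distr gaussian gaussian T)" by simp
  also have "\<dots> = (\<integral>\<^sup>+x. indicator A (T x) \<partial>gaussian)"
    by (subst nn_integral_distr) simp_all
  also have "\<dots> = (\<integral>\<^sup>+x. indicator A (T x) * ennreal (gauss (T x)) \<partial>lborel)"
    by (subst nn_integral_gaussian) (simp_all add: gauss_orthogonal_transformation[OF T])
  also have "\<dots> = (\<integral>\<^sup>+x. indicator A x * ennreal (gauss x) \<partial>lborel)"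
    by (rule nn_integral_lborel_orthogonal_transformation[OF T]) simp
  also have "\<dots> = (\<integral>\<^sup>+x. indicator A x \<partial>gaussian)"
    by (subst nn_integral_gaussian) simp_all
  also have "\<dots> = emeasure gaussian A" by simp
  finally show "emeasure (distr gaussian gaussian T) A = emeasure gaussian A" .
qed simp

lemma nn_integral_gaussian_tuple_orthogonal_transformation:
  fixes T :: "'a::euclidean_space \<Rightarrow> 'a"
  assumes T: "orthogonal_transformation T" and f: "f \<in> borel_measurable (gaussian_tuple j)"
  shows "(\<integral>\<^sup>+X. f (\<lambda>i\<in>{..<j}. T (X i)) \<partial>gaussian_tuple j) = (\<integral>\<^sup>+X. f X \<partial>gaussian_tuple j)"
proof -
  note [measurable] = measurable_orthogonal_transformation[OF T]
  have "distr (gaussian_tuple j) (gaussian_tuple j) (compose {..<j} T) = gaussian_tuple j"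
    using distr_PiM_finite_prob_space'[of "{..<j}" "\<lambda>_. gaussian" "\<lambda>_. gaussian" T]
    by (simp add: prob_space_gaussian distr_gaussian_orthogonal_transformation[OF T])
  moreover have "(\<integral>\<^sup>+X. f X \<partial>distr (gaussian_tuple j) (gaussian_tuple j) (compose {..<j} T))
      = (\<integral>\<^sup>+X. f (\<lambda>i\<in>{..<j}. T (X i)) \<partial>gaussian_tuple j)"
  proof -
    have "compose {..<j} T \<in> measurable (gaussian_tuple j) (gaussian_tuple j)"
      unfolding compose_def by measurable
    then show ?thesis using f by (simp add: nn_integral_distr compose_def)
  qed
  ultimately show ?thesis by simp
qed

text \<open>The value \<open>\<xi>\<close> is a dummy for degenerate tuples; it keeps the map inside a fixed Grassmannian.\<close>

definition generic_tuple :: "nat \<Rightarrow> (nat \<Rightarrow> 'a::euclidean_space) \<Rightarrow> bool" where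
  "generic_tuple j Y \<longleftrightarrow> (\<forall>i<j. Y i \<notin> span (Y ` {..<i}))"

definition tuple_span :: "'a::euclidean_space set \<Rightarrow> nat \<Rightarrow> (nat \<Rightarrow> 'a) \<Rightarrow> 'a set" where
  "tuple_span \<xi> j Y = (if generic_tuple j Y then span (Y ` {..<j}) else \<xi>)"

lemma dim_generic_tuple: "generic_tuple j Y \<Longrightarrow> dim (span (Y ` {..<j})) = j"
proof (induction j)
  case (Suc j)
  have "Y ` {..<Suc j} = insert (Y j) (Y ` {..<j})" by (auto simp: lessThan_Suc)
  moreover have "generic_tuple j Y" "Y j \<notin> span (Y ` {..<j})"
    using Suc.prems by (auto simp: generic_tuple_def)
  ultimately show ?case using Suc.IH by (simp add: dim_insert)
qed simp

text \<open>Coefficients are indexed by all natural numbers so that the parameters form the single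
  type \<open>nat \<Rightarrow> real\<close>, which is second countable, as the criterion with dense
  parameters requires.\<close>

lemma span_tuple_eq_range: "span (Y ` {..<j}) = range (\<lambda>c::nat \<Rightarrow> real. \<Sum>i<j. c i *\<^sub>R Y i)"
proof
  show "range (\<lambda>c::nat \<Rightarrow> real. \<Sum>i<j. c i *\<^sub>R Y i) \<subseteq> span (Y ` {..<j})"
    by (auto intro!: span_sum span_scale intro: span_base)
  let ?R = "range (\<lambda>c::nat \<Rightarrow> real. \<Sum>i<j. c i *\<^sub>R Y i)"
  show "span (Y ` {..<j}) \<subseteq> ?R"
  proof (rule span_minimal)
    show "Y ` {..<j} \<subseteq> ?R"
    proof clarify
      fix i assume "i < j"
      then have "Y i = (\<Sum>l<j. (if l = i then 1 else 0) *\<^sub>R Y l)" by (simp add: if_distrib[of "\<lambda>c. c *\<^sub>R _"] cong: if_cong)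
      then show "Y i \<in> ?R" by (rule range_eqI[of _ _ "\<lambda>l. if l = i then 1 else 0"])
    qed
    show "subspace ?R"
    proof (rule subspaceI)
      show "0 \<in> ?R" by (rule range_eqI[of _ _ "\<lambda>_. 0"]) simp
      fix x y c assume "x \<in> ?R"
      then obtain a where a: "x = (\<Sum>i<j. a i *\<^sub>R Y i)" by auto
      show "c *\<^sub>R x \<in> ?R"
        by (rule range_eqI[of _ _ "\<lambda>i. c * a i"]) (simp add: a scaleR_sum_right)
      assume "y \<in> ?R"
      then obtain b where b: "y = (\<Sum>i<j. b i *\<^sub>R Y i)" by auto
      show "x + y \<in> ?R"
        by (rule range_eqI[of _ _ "\<lambda>i. a i + b i"]) (simp add: a b scaleR_add_left sum.distrib)
    qed
  qed
qed

lemma continuous_on_lincomb: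
  fixes Y :: "nat \<Rightarrow> 'a::euclidean_space"
  shows "continuous_on UNIV (\<lambda>c::nat \<Rightarrow> real. \<Sum>i<j. c i *\<^sub>R Y i)"
  by (intro continuous_on_sum continuous_on_scaleR continuous_on_const continuous_on_product_coordinates)

text \<open>A span is closed, so membership of y means that the span shifted by -y hits every ball
  of radius 1 / (n + 1) about the origin. Each of these hitting events is measurable.\<close>

lemma measurable_in_span_tuple:
  fixes Y :: "'x \<Rightarrow> nat \<Rightarrow> 'a::euclidean_space"
  assumes Y: "\<And>l. l < i \<Longrightarrow> (\<lambda>x. Y x l) \<in> borel_measurable M" and y: "y \<in> borel_measurable M"
  shows "{x \<in> space M. y x \<in> span (Y x ` {..<i})} \<in> sets M"
proof -
  let ?h = "\<lambda>x c. (\<Sum>l<i. c l *\<^sub>R Y x l) - y x"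
  have "y x \<in> span (Y x ` {..<i}) \<longleftrightarrow> (\<forall>n. range (?h x) \<inter> ball 0 (1 / real (Suc n)) \<noteq> {})" for x
  proof -
    have "y x \<in> span (Y x ` {..<i}) \<longleftrightarrow> y x \<in> closure (span (Y x ` {..<i}))"
      by simp
    also have "\<dots> \<longleftrightarrow> (\<forall>n. \<exists>z\<in>span (Y x ` {..<i}). dist z (y x) < 1 / real (Suc n))"
      unfolding closure_approachable
    proof (intro iffI allI impI)
      fix e :: real assume *: "\<forall>n. \<exists>z\<in>span (Y x ` {..<i}). dist z (y x) < 1 / real (Suc n)" and "0 < e"
      obtain n where n: "1 / real (Suc n) < e" using nat_approx_posE[OF \<open>0 < e\<close>] .
      from * obtain z where "z \<in> span (Y x ` {..<i})" "dist z (y x) < 1 / real (Suc n)" by blast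
      with n show "\<exists>z\<in>span (Y x ` {..<i}). dist z (y x) < e" by (meson order_less_trans)
    qed simp
    also have "\<dots> \<longleftrightarrow> (\<forall>n. range (?h x) \<inter> ball 0 (1 / real (Suc n)) \<noteq> {})"
    proof -
      have "range h \<inter> A \<noteq> {} \<longleftrightarrow> (\<exists>c. h c \<in> A)" for h :: "(nat \<Rightarrow> real) \<Rightarrow> 'a" and A by blast
      then show ?thesis unfolding span_tuple_eq_range by (simp add: dist_norm norm_minus_commute)
    qed
    finally show ?thesis .
  qed
  then have "{x \<in> space M. y x \<in> span (Y x ` {..<i})}
      = {x \<in> space M. \<forall>n. range (?h x) \<inter> ball 0 (1 / real (Suc n)) \<noteq> {}}" by simp
  also have "\<dots> \<in> sets M"
  proof (intro sets.sets_Collect_countable_All measurable_hit_range)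
    have [measurable]: "(\<lambda>x. Y x l) \<in> borel_measurable M" if "l \<in> {..<i}" for l using Y that by auto
    show "(\<lambda>x. ?h x z) \<in> borel_measurable M" for z using y by measurable
    show "continuous_on UNIV (?h x)" for x
      by (intro continuous_on_diff continuous_on_lincomb continuous_on_const)
  qed auto
  finally show ?thesis .
qed

lemma measurable_generic_tuple:
  fixes Y :: "'x \<Rightarrow> nat \<Rightarrow> 'a::euclidean_space"
  assumes Y: "\<And>l. l < j \<Longrightarrow> (\<lambda>x. Y x l) \<in> borel_measurable M"
  shows "{x \<in> space M. generic_tuple j (Y x)} \<in> sets M"
proof -
  have "{x \<in> space M. generic_tuple j (Y x)} = space M - (\<Union>i\<in>{..<j}. {x \<in> space M. Y x i \<in> span (Y x ` {..<i})})"
    by (auto simp: generic_tuple_def)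
  moreover have "{x \<in> space M. Y x i \<in> span (Y x ` {..<i})} \<in> sets M" if "i < j" for i
    using Y that by (intro measurable_in_span_tuple) auto
  ultimately show ?thesis by auto
qed

lemma measurable_tuple_span:
  fixes Y :: "'x \<Rightarrow> nat \<Rightarrow> 'a::euclidean_space"
  assumes Y: "\<And>l. l < j \<Longrightarrow> (\<lambda>x. Y x l) \<in> borel_measurable M" and \<xi>: "\<xi> \<in> grassmannian V j"
    and V: "\<And>x l. x \<in> space M \<Longrightarrow> l < j \<Longrightarrow> Y x l \<in> V" "subspace V"
  shows "(\<lambda>x. tuple_span \<xi> j (Y x)) \<in> measurable M (plane_algebra (grassmannian V j))"
proof (rule measurable_plane_algebraI)
  fix x assume x: "x \<in> space M"
  have "span (Y x ` {..<j}) \<subseteq> V" using V x by (intro span_minimal) auto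
  then show "tuple_span \<xi> j (Y x) \<in> grassmannian V j"
    using \<xi> dim_generic_tuple[of j "Y x"] by (auto simp: tuple_span_def grassmannian_def)
next
  fix U :: "'a set" assume U: "open U"
  let ?h = "\<lambda>x c. \<Sum>l<j. c l *\<^sub>R Y x l"
  let ?G = "{x \<in> space M. generic_tuple j (Y x)}"
  have G: "?G \<in> sets M" using Y by (rule measurable_generic_tuple)
  have [measurable]: "(\<lambda>x. Y x l) \<in> borel_measurable M" if "l \<in> {..<j}" for l using Y that by auto
  have R: "{x \<in> space M. range (?h x) \<inter> U \<noteq> {}} \<in> sets M"
    using U by (intro measurable_hit_range continuous_on_lincomb) measurable
  have "{x \<in> space M. tuple_span \<xi> j (Y x) \<inter> U \<noteq> {}}
      = (?G \<inter> {x \<in> space M. range (?h x) \<inter> U \<noteq> {}}) \<union> (if \<xi> \<inter> U \<noteq> {} then space M - ?G else {})"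
    by (auto simp: tuple_span_def span_tuple_eq_range)
  then show "{x \<in> space M. tuple_span \<xi> j (Y x) \<inter> U \<noteq> {}} \<in> sets M"
    using G R by simp
qed

text \<open>The preimage of L under the projection is a subspace that misses any vector of V outside
  L. It is therefore proper, and proper subspaces are Lebesgue null.\<close>

lemma AE_gaussian_proj_notin:
  assumes V: "subspace V" and L: "subspace L" "\<not> V \<subseteq> L"
  shows "AE x in gaussian. proj V x \<notin> L"
proof -
  let ?N = "{x. proj V x \<in> L}"
  have s: "subspace ?N"
    using V L by (auto simp: subspace_def proj_add proj_scaleR proj_id)
  obtain v where "v \<in> V" "v \<notin> L" using L by auto
  then have "v \<notin> ?N" using V by (simp add: proj_id)
  moreover have "span ?N = ?N" using s by (simp only: span_eq_iff)
  ultimately have "span ?N \<noteq> UNIV" by blast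
  then have "dim ?N < DIM('a)" using dim_eq_full[of ?N] dim_subset_UNIV[of ?N] by linarith
  then have "?N \<in> null_sets lebesgue" by (simp add: negligible_lowdim negligible_iff_null_sets[symmetric])
  moreover have "?N \<in> sets lborel" using closed_subspace[OF s] by simp
  ultimately have "?N \<in> null_sets lborel" using null_sets_completion_iff by blast
  then have "AE x in lborel. x \<notin> ?N" by (rule AE_not_in)
  then show ?thesis unfolding gaussian_def by (subst AE_density) auto
qed

text \<open>With all vectors but the i-th fixed, the earlier projections span at most i < dim V
  dimensions and cannot contain V; the i-th projection almost surely avoids their span. Fubini in
  the i-th coordinate and a finite intersection conclude.\<close>

lemma AE_generic_tuple:
  assumes V: "subspace V" "j \<le> dim V"
  shows "AE X in gaussian_tuple j. generic_tuple j (\<lambda>i. proj V (X i))"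
proof -
  note [measurable] = borel_measurable_proj[OF V(1)]
  have "AE X in gaussian_tuple j. proj V (X i) \<notin> span ((\<lambda>l. proj V (X l)) ` {..<i})" if i: "i < j" for i
  proof (rule AE_I)
    let ?N = "{X \<in> space (gaussian_tuple j). proj V (X i) \<in> span ((\<lambda>l. proj V (X l)) ` {..<i})}"
    show N: "?N \<in> sets (gaussian_tuple j)"
      using i by (intro measurable_in_span_tuple) auto
    show "{X \<in> space (gaussian_tuple j). \<not> proj V (X i) \<notin> span ((\<lambda>l. proj V (X l)) ` {..<i})} \<subseteq> ?N" by auto
    let ?I = "{..<j} - {i}"
    have I: "{..<j} = insert i ?I" using i by auto
    have "emeasure (gaussian_tuple j) ?N = (\<integral>\<^sup>+X. indicator ?N X \<partial>(\<Pi>\<^sub>M i\<in>insert i ?I. gaussian))"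
      using N I by simp
    also have "\<dots> = (\<integral>\<^sup>+X. (\<integral>\<^sup>+y. indicator ?N (X(i := y)) \<partial>gaussian) \<partial>(\<Pi>\<^sub>M i\<in>?I. gaussian))"
      using N I by (intro gaussian_product.product_nn_integral_insert) auto
    also have "\<dots> = (\<integral>\<^sup>+X. 0 \<partial>(\<Pi>\<^sub>M i\<in>?I. (gaussian :: 'a measure)))"
    proof (intro nn_integral_cong)
      fix X :: "nat \<Rightarrow> 'a"
      let ?L = "span ((\<lambda>l. proj V (X l)) ` {..<i})"
      have "dim ?L \<le> card ((\<lambda>l. proj V (X l)) ` {..<i})" by (simp add: dim_le_card')
      also have "\<dots> \<le> i" using card_image_le[of "{..<i}" "\<lambda>l. proj V (X l)"] by simp
      also have "\<dots> < dim V" using i V by simp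
      finally have "\<not> V \<subseteq> ?L" using dim_subset[of V ?L] by auto
      then have "AE y in gaussian. proj V y \<notin> ?L"
        using V by (intro AE_gaussian_proj_notin) auto
      moreover have "(\<lambda>l. proj V ((X(i := y)) l)) ` {..<i} = (\<lambda>l. proj V (X l)) ` {..<i}" for y
        by (intro image_cong) auto
      ultimately have "AE y in gaussian. indicator ?N (X(i := y)) = (0::ennreal)"
        by (auto elim!: eventually_mono)
      then show "(\<integral>\<^sup>+y. indicator ?N (X(i := y)) \<partial>gaussian) = 0"
        by (subst nn_integral_cong_AE[of _ "\<lambda>_. 0"]) auto
    qed
    finally show "emeasure (gaussian_tuple j) ?N = 0" by simp
  qed
  then have "AE X in gaussian_tuple j. \<forall>i\<in>{..<j}. proj V (X i) \<notin> span ((\<lambda>l. proj V (X l)) ` {..<i})"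
    by (subst AE_ball_countable) auto
  then show ?thesis by (simp add: generic_tuple_def Ball_def)
qed

text \<open>The vectors are drawn in the ambient space and projected afterwards, so that the source
  \<open>gaussian_tuple j\<close> is the same for every V.\<close>

definition grassmann_law :: "'a::euclidean_space set \<Rightarrow> nat \<Rightarrow> 'a set measure" where
  "grassmann_law V j = distr (gaussian_tuple j) (plane_algebra (grassmannian V j))
     (\<lambda>X. tuple_span (SOME \<xi>. \<xi> \<in> grassmannian V j) j (\<lambda>i. proj V (X i)))"

lemma measurable_tuple_span_proj:
  assumes V: "subspace V" and \<xi>: "\<xi> \<in> grassmannian V j"
  shows "(\<lambda>X. tuple_span \<xi> j (\<lambda>i. proj V (X i))) \<in> measurable (gaussian_tuple j) (plane_algebra (grassmannian V j))"
proof -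
  note [measurable] = borel_measurable_proj[OF V]
  show ?thesis using V \<xi> proj_mem[OF V] by (intro measurable_tuple_span) (auto, measurable)
qed

lemma space_grassmann_law [simp]: "space (grassmann_law V j) = grassmannian V j"
  and sets_grassmann_law [measurable_cong, simp]: "sets (grassmann_law V j) = sets (plane_algebra (grassmannian V j))"
  by (simp_all add: grassmann_law_def)

text \<open>Degenerate tuples are null, so the dummy \<eta> is arbitrary and a single one can serve
  all V at once. Measurability in V relies on this.\<close>

lemma nn_integral_grassmann_law:
  assumes V: "subspace V" "j \<le> dim V" and f: "f \<in> borel_measurable (plane_algebra (grassmannian V j))"
  shows "(\<integral>\<^sup>+\<xi>. f \<xi> \<partial>grassmann_law V j) = (\<integral>\<^sup>+X. f (tuple_span \<eta> j (\<lambda>i. proj V (X i))) \<partial>gaussian_tuple j)"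
proof -
  let ?\<xi> = "SOME \<xi>. \<xi> \<in> grassmannian V j"
  have \<xi>: "?\<xi> \<in> grassmannian V j" using grassmannian_nonempty[OF V] by (simp add: some_in_eq)
  have "(\<integral>\<^sup>+\<xi>. f \<xi> \<partial>grassmann_law V j) = (\<integral>\<^sup>+X. f (tuple_span ?\<xi> j (\<lambda>i. proj V (X i))) \<partial>gaussian_tuple j)"
    unfolding grassmann_law_def using measurable_tuple_span_proj[OF V(1) \<xi>] f
    by (intro nn_integral_distr) auto
  also have "\<dots> = (\<integral>\<^sup>+X. f (tuple_span \<eta> j (\<lambda>i. proj V (X i))) \<partial>gaussian_tuple j)"
    by (intro nn_integral_cong_AE eventually_mono[OF AE_generic_tuple[OF V]]) (simp add: tuple_span_def)
  finally show ?thesis .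
qed

lemma prob_space_grassmann_law:
  assumes V: "subspace V" "j \<le> dim V" shows "prob_space (grassmann_law V j)"
  unfolding grassmann_law_def using grassmannian_nonempty[OF V]
  by (intro prob_space.prob_space_distr prob_space_PiM prob_space_gaussian measurable_tuple_span_proj V)
    (simp add: some_in_eq)

lemma tuple_span_image:
  fixes T :: "'a::euclidean_space \<Rightarrow> 'a"
  assumes T: "orthogonal_transformation T"
  shows "generic_tuple j (\<lambda>i. T (Y i)) \<longleftrightarrow> generic_tuple j Y"
    and "span ((\<lambda>i. T (Y i)) ` {..<j}) = T ` span (Y ` {..<j})"
proof -
  have lin: "linear T" and inj: "inj T"
    using T by (auto intro: orthogonal_transformation_linear orthogonal_transformation_inj)
  show s: "span ((\<lambda>i. T (Y i)) ` {..<j}) = T ` span (Y ` {..<j})" for j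
    using linear_span_image[OF lin, of "Y ` {..<j}"] by (simp add: image_image)
  show "generic_tuple j (\<lambda>i. T (Y i)) \<longleftrightarrow> generic_tuple j Y"
    unfolding generic_tuple_def s using inj by (simp add: inj_image_mem_iff)
qed

lemma orthogonal_transformation_inverse_image:
  fixes T :: "'a::euclidean_space \<Rightarrow> 'a"
  assumes T: "orthogonal_transformation T"
  obtains R where "orthogonal_transformation R" "\<And>\<xi>. R ` (T ` \<xi>) = \<xi>" "\<And>\<xi>. T ` (R ` \<xi>) = \<xi>"
proof
  show "orthogonal_transformation (inv T)" using T by (rule orthogonal_transformation_inv)
  show "inv T ` (T ` \<xi>) = \<xi>" "T ` (inv T ` \<xi>) = \<xi>" for \<xi>
    using orthogonal_transformation_inj[OF T] orthogonal_transformation_surj[OF T]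
    by (auto simp: image_image surj_f_inv_f)
qed

lemma measurable_image_orthogonal_transformation:
  fixes T :: "'a::euclidean_space \<Rightarrow> 'a"
  assumes T: "orthogonal_transformation T"
  shows "(`) T \<in> measurable (plane_algebra (grassmannian V j)) (plane_algebra (grassmannian (T ` V) j))"
proof (rule measurable_plane_range[where h="\<lambda>\<xi> x. T (proj \<xi> x)"])
  note m [measurable] = measurable_orthogonal_transformation[OF T]
  have lin: "linear T" and inj: "inj T"
    using T by (auto intro: orthogonal_transformation_linear orthogonal_transformation_inj)
  show "(\<lambda>\<xi>. T (proj \<xi> z)) \<in> borel_measurable (plane_algebra (grassmannian V j))" for z by measurable
  fix \<xi> assume "\<xi> \<in> space (plane_algebra (grassmannian V j))"
  then have \<xi>: "subspace \<xi>" "\<xi> \<subseteq> V" "dim \<xi> = j" by (auto simp: grassmannian_def)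
  show "T ` \<xi> \<in> grassmannian (T ` V) j"
    using \<xi> lin inj by (auto simp: grassmannian_def linear_subspace_image dim_image_eq[OF lin inj_on_subset[OF inj subset_UNIV]])
  have "range (proj \<xi>) = \<xi>" using proj_mem[OF \<xi>(1)] proj_id[OF \<xi>(1)] by (metis image_subset_iff rangeI subsetI subset_antisym)
  then show "T ` \<xi> = range (\<lambda>x. T (proj \<xi> x))" by (metis image_image)
  show "continuous_on UNIV (\<lambda>x. T (proj \<xi> x))"
    using continuous_on_compose[OF continuous_on_proj[OF \<xi>(1), of UNIV], of T] linear_continuous_on lin
    by (auto simp: o_def linear_conv_bounded_linear)
qed

text \<open>T carries the projection onto V to the projection onto its image, and applying T to
  every vector preserves the Gaussian law. The dummy plane is not carried along, so the integrands
  agree only on generic tuples.\<close>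

lemma nn_integral_grassmann_law_image:
  fixes T :: "'a::euclidean_space \<Rightarrow> 'a"
  assumes T: "orthogonal_transformation T" and V: "subspace V" "j \<le> dim V"
    and f [measurable]: "f \<in> borel_measurable (plane_algebra (grassmannian (T ` V) j))"
  shows "(\<integral>\<^sup>+\<xi>. f \<xi> \<partial>grassmann_law (T ` V) j) = (\<integral>\<^sup>+\<xi>. f (T ` \<xi>) \<partial>grassmann_law V j)"
proof -
  have lin: "linear T" and inj: "inj T"
    using T by (auto intro: orthogonal_transformation_linear orthogonal_transformation_inj)
  have TV: "subspace (T ` V)" "j \<le> dim (T ` V)"
    using V lin inj by (auto simp: linear_subspace_image dim_image_eq[OF lin inj_on_subset[OF inj subset_UNIV]])
  note [measurable] = measurable_image_orthogonal_transformation[OF T]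
  obtain \<xi> where \<xi>: "\<xi> \<in> grassmannian (T ` V) j" using grassmannian_nonempty[OF TV] by auto
  let ?g = "\<lambda>X. f (tuple_span \<xi> j (\<lambda>i. proj (T ` V) (X i)))"
  have "(\<integral>\<^sup>+\<xi>. f \<xi> \<partial>grassmann_law (T ` V) j) = (\<integral>\<^sup>+X. ?g X \<partial>gaussian_tuple j)"
    by (rule nn_integral_grassmann_law[OF TV f])
  also have "\<dots> = (\<integral>\<^sup>+X. ?g (\<lambda>i\<in>{..<j}. T (X i)) \<partial>gaussian_tuple j)"
    using measurable_compose[OF measurable_tuple_span_proj[OF TV(1) \<xi>] f]
    by (intro nn_integral_gaussian_tuple_orthogonal_transformation[OF T, symmetric])
  also have "\<dots> = (\<integral>\<^sup>+X. f (T ` tuple_span \<xi> j (\<lambda>i. proj V (X i))) \<partial>gaussian_tuple j)"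
  proof (intro nn_integral_cong_AE eventually_mono[OF AE_generic_tuple[OF V]])
    fix X assume X: "generic_tuple j (\<lambda>i. proj V (X i))"
    let ?Y = "\<lambda>i. proj (T ` V) ((\<lambda>i\<in>{..<j}. T (X i)) i)" and ?Z = "\<lambda>i. T (proj V (X i))"
    have Y: "?Y i = ?Z i" if "i < j" for i using that by (simp add: proj_image[OF T V(1)])
    then have im: "?Y ` {..<i} = ?Z ` {..<i}" if "i \<le> j" for i using that by (intro image_cong) auto
    have "generic_tuple j ?Y \<longleftrightarrow> generic_tuple j ?Z"
      unfolding generic_tuple_def using Y im by (metis less_imp_le)
    then show "?g (\<lambda>i\<in>{..<j}. T (X i)) = f (T ` tuple_span \<xi> j (\<lambda>i. proj V (X i)))"
      using X tuple_span_image(1)[OF T, of j "\<lambda>i. proj V (X i)"]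
        tuple_span_image(2)[OF T, of "\<lambda>i. proj V (X i)" j] im[of j] by (simp only: tuple_span_def if_True order_refl)
  qed
  also have "\<dots> = (\<integral>\<^sup>+\<xi>. f (T ` \<xi>) \<partial>grassmann_law V j)"
    by (rule nn_integral_grassmann_law[OF V, symmetric]) measurable
  finally show ?thesis .
qed

lemma invariant_probability_grassmann_law:
  fixes V :: "'a::euclidean_space set"
  assumes V: "subspace V" "j \<le> dim V"
  shows "invariant_probability V j (grassmann_law V j)"
  unfolding invariant_probability_def
proof (intro conjI allI impI ballI)
  show "prob_space (grassmann_law V j)" using V by (rule prob_space_grassmann_law)
  fix T :: "'a \<Rightarrow> 'a" and A
  assume T: "orthogonal_transformation T \<and> T ` V = V" and "A \<in> sets (grassmann_law V j)"
  then have A [measurable]: "A \<in> sets (plane_algebra (grassmannian V j))" by simp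
  have T: "orthogonal_transformation T" "T ` V = V" using T by auto
  have inj: "inj T" using T by (auto intro: orthogonal_transformation_inj)
  obtain R where R: "orthogonal_transformation R" and RT: "\<And>\<xi>. R ` (T ` \<xi>) = \<xi>" "\<And>\<xi>. T ` (R ` \<xi>) = \<xi>"
    using orthogonal_transformation_inverse_image[OF T(1)] by blast
  have RV: "R ` V = V" using RT(1)[of V] T(2) by simp
  have "(`) T ` A = (`) R -` A \<inter> grassmannian V j"
  proof -
    have sub: "A \<subseteq> grassmannian V j" using sets.sets_into_space[OF A] by simp
    have "T ` \<xi> \<in> grassmannian V j" if "\<xi> \<in> A" for \<xi>
      using measurable_space[OF measurable_image_orthogonal_transformation[OF T(1), of V j], of \<xi>] sub that T(2) by auto
    then show ?thesis using RT by (auto simp: image_iff) (metis RT(2))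
  qed
  also have "\<dots> \<in> sets (plane_algebra (grassmannian V j))"
    using measurable_sets[OF measurable_image_orthogonal_transformation[OF R, of V j], of A] RV by simp
  finally have TA [measurable]: "(`) T ` A \<in> sets (plane_algebra (grassmannian V j))" .
  have "emeasure (grassmann_law V j) ((`) T ` A) = (\<integral>\<^sup>+\<xi>. indicator ((`) T ` A) \<xi> \<partial>grassmann_law (T ` V) j)"
    by (simp add: T)
  also have "\<dots> = (\<integral>\<^sup>+\<xi>. indicator ((`) T ` A) (T ` \<xi>) \<partial>grassmann_law V j)"
    using TA by (intro nn_integral_grassmann_law_image T V) (simp add: T)
  also have "\<dots> = (\<integral>\<^sup>+\<xi>. indicator A \<xi> \<partial>grassmann_law V j)"
    using inj by (intro nn_integral_cong) (auto simp: inj_image_eq_iff split: split_indicator)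
  also have "\<dots> = emeasure (grassmann_law V j) A" by simp
  finally show "emeasure (grassmann_law V j) ((`) T ` A) = emeasure (grassmann_law V j) A" .
qed simp_all

text \<open>Invariance is defined through images of sets, push-forward through preimages; the
  inverse of T translates between the two.\<close>

lemma distr_image_invariant_probability:
  fixes V :: "'a::euclidean_space set" and T :: "'a \<Rightarrow> 'a"
  assumes M: "invariant_probability V j M" and T: "orthogonal_transformation T" "T ` V = V"
  shows "(`) T \<in> measurable M M" "distr M M ((`) T) = M"
proof -
  have sp: "space M = grassmannian V j" and se: "sets M = sets (plane_algebra (grassmannian V j))"
    and inv: "\<And>T A. orthogonal_transformation T \<Longrightarrow> T ` V = V \<Longrightarrow> A \<in> sets M \<Longrightarrow> emeasure M ((`) T ` A) = emeasure M A"
    using M by (auto simp: invariant_probability_def)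
  show T_meas: "(`) T \<in> measurable M M"
    using measurable_image_orthogonal_transformation[OF T(1), of V j] T(2)
    by (simp add: measurable_cong_sets[OF se se])
  obtain R where R: "orthogonal_transformation R" and RT: "\<And>\<xi>. R ` (T ` \<xi>) = \<xi>" "\<And>\<xi>. T ` (R ` \<xi>) = \<xi>"
    using orthogonal_transformation_inverse_image[OF T(1)] by blast
  have RV: "R ` V = V" using RT(1)[of V] T(2) by simp
  have R_meas: "(`) R \<in> measurable M M"
    using measurable_image_orthogonal_transformation[OF R, of V j] RV
    by (simp add: measurable_cong_sets[OF se se])
  show "distr M M ((`) T) = M"
  proof (rule measure_eqI)
    fix A assume "A \<in> sets (distr M M ((`) T))"
    then have A: "A \<in> sets M" by simp
    have "(`) T -` A \<inter> space M = (`) R ` A"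
    proof (rule set_eqI)
      fix \<xi>
      show "\<xi> \<in> (`) T -` A \<inter> space M \<longleftrightarrow> \<xi> \<in> (`) R ` A"
      proof
        assume "\<xi> \<in> (`) T -` A \<inter> space M"
        then have "T ` \<xi> \<in> A" "\<xi> = R ` (T ` \<xi>)" using RT by auto
        then show "\<xi> \<in> (`) R ` A" by blast
      next
        assume "\<xi> \<in> (`) R ` A"
        then obtain \<eta> where \<eta>: "\<eta> \<in> A" "\<xi> = R ` \<eta>" by blast
        then have "\<xi> \<in> space M" using measurable_space[OF R_meas] sets.sets_into_space[OF A] by blast
        then show "\<xi> \<in> (`) T -` A \<inter> space M" using \<eta> RT by simp
      qed
    qed
    then show "emeasure (distr M M ((`) T)) A = emeasure M A"
      using inv[OF R RV A] A T_meas by (simp add: emeasure_distr)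
  qed simp
qed

theorem invariant_probability_unique:
  fixes V :: "(real^'n) set"
  assumes V: "subspace V" and M: "invariant_probability V j M" and N: "invariant_probability V j N"
  shows "M = N"
proof (rule homogeneous_probability_unique[where e=proj_columns and S="grassmannian V j"])
  have sp: "space M = grassmannian V j" "space N = grassmannian V j"
    and se: "sets M = sets (plane_algebra (grassmannian V j))" "sets N = sets (plane_algebra (grassmannian V j))"
    using M N by (auto simp: invariant_probability_def)
  show "prob_space M" "prob_space N" using M N by (auto simp: invariant_probability_def)
  show "sets N = sets M" using se by simp
  show "proj_columns \<in> borel_measurable M" by (simp add: measurable_cong_sets[OF se(1) refl])
  show "\<exists>B\<in>sets borel. A = proj_columns -` B \<inter> space M" if "A \<in> sets M" for A
    using plane_algebra_eq_vimage[of A V j] that by (simp add: sp se)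
  show "AE \<xi> in M. \<xi> \<in> grassmannian V j" "AE \<xi> in N. \<xi> \<in> grassmannian V j"
    by (rule AE_I2, simp add: sp)+
  fix \<xi> \<eta> assume \<xi>: "\<xi> \<in> grassmannian V j" and \<eta>: "\<eta> \<in> grassmannian V j"
  have "V\<^sup>\<bottom>\<^sup>\<bottom> = V" using V by (rule orthogonal_comp_self)
  \<comment> \<open>With the complement of V as the second plane of both pairs, the resulting T maps
    the complement to itself and hence preserves V.\<close>
  then obtain T where T: "orthogonal_transformation T" "T ` \<xi> = \<eta>" "T ` (V\<^sup>\<bottom>) = V\<^sup>\<bottom>"
    using orthogonal_flag_transitive[of \<xi> \<eta> "V\<^sup>\<bottom>" "V\<^sup>\<bottom>"] \<xi> \<eta>
    by (auto simp: grassmannian_def subspace_orthogonal_comp)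
  have TV: "T ` V = V" using orthogonal_comp_image[OF T(1), of "V\<^sup>\<bottom>"] T(3) \<open>V\<^sup>\<bottom>\<^sup>\<bottom> = V\<close> by simp
  have "dist (proj_columns (T ` \<xi>)) (proj_columns (T ` z)) = dist (proj_columns \<xi>) (proj_columns z)"
    if "z \<in> space M" for z
    using T(1) \<xi> that sp by (intro dist_proj_columns_image) (auto simp: grassmannian_def)
  then show "\<exists>g. g \<xi> = \<eta> \<and> (\<forall>z\<in>space M. dist (proj_columns (g \<xi>)) (proj_columns (g z)) = dist (proj_columns \<xi>) (proj_columns z)) \<and>
      g \<in> measurable M M \<and> distr M M g = M \<and> distr N N g = N"
    using T(2) distr_image_invariant_probability[OF M T(1) TV] distr_image_invariant_probability[OF N T(1) TV]
    by (intro exI[of _ "(`) T"]) auto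
qed

text \<open>Existence and uniqueness together give the definite description in
  \<open>grassmann_measure\<close> its meaning; from here on the Gaussian model replaces it.\<close>

theorem grassmann_measure_eq_law:
  fixes V :: "(real^'n) set"
  assumes V: "subspace V" "j \<le> dim V"
  shows "grassmann_measure V j = grassmann_law V j"
  unfolding grassmann_measure_def
  using invariant_probability_grassmann_law[OF V] invariant_probability_unique[OF V(1)]
  by (intro the_equality) auto

section \<open>Orthogonal pairs of planes\<close>

text \<open>A random orthogonal pair: after \<xi>, the plane \<eta> is spanned by Gaussian vectors
  stripped of their components along \<xi>. As a push-forward of a product measure it needs no
  theory of kernels.\<close>

definition flag_law :: "nat \<Rightarrow> nat \<Rightarrow> ((real^'n) set \<times> (real^'n) set) measure" where
  "flag_law j k = distr (grassmann_law UNIV j \<Otimes>\<^sub>M gaussian_tuple k)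
     (plane_algebra (grassmannian UNIV j) \<Otimes>\<^sub>M plane_algebra (grassmannian UNIV k))
     (\<lambda>p. (fst p, tuple_span (SOME \<eta>. \<eta> \<in> grassmannian UNIV k) k (\<lambda>i. snd p i - proj (fst p) (snd p i))))"

lemma space_flag_law [simp]: "space (flag_law j k) = grassmannian UNIV j \<times> grassmannian UNIV k"
  and sets_flag_law [measurable_cong, simp]: "sets (flag_law j k) =
    sets (plane_algebra (grassmannian UNIV j) \<Otimes>\<^sub>M plane_algebra (grassmannian UNIV k))"
  by (simp_all add: flag_law_def space_pair_measure)

lemma measurable_tuple_span_complement:
  fixes \<eta> :: "(real^'n) set"
  assumes \<eta>: "\<eta> \<in> grassmannian UNIV k"
    and f [measurable]: "f \<in> measurable M (plane_algebra (grassmannian UNIV j))"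
    and g [measurable]: "g \<in> measurable M (gaussian_tuple k)"
  shows "(\<lambda>p. tuple_span \<eta> k (\<lambda>i. g p i - proj (f p) (g p i))) \<in> measurable M (plane_algebra (grassmannian UNIV k))"
proof (rule measurable_tuple_span[OF _ \<eta>])
  fix l assume l: "l < k"
  have "(\<lambda>p. g p l) \<in> measurable M gaussian"
    by (rule measurable_compose[OF g measurable_component_singleton]) (simp add: l)
  then have [measurable]: "(\<lambda>p. g p l) \<in> borel_measurable M"
    by (simp only: measurable_cong_sets[OF refl sets_gaussian])
  show "(\<lambda>p. g p l - proj (f p) (g p l)) \<in> borel_measurable M" by measurable
qed auto

lemma grassmannian_UNIV_nonempty: "k \<le> CARD('n) \<Longrightarrow> (SOME \<eta>. \<eta> \<in> grassmannian UNIV k) \<in> grassmannian (UNIV :: (real^'n) set) k"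
  using grassmannian_nonempty[of "UNIV :: (real^'n) set" k] by (simp add: some_in_eq)

lemma nn_integral_grassmann_law_orthogonal_comp:
  fixes \<xi> \<eta> :: "(real^'n) set"
  assumes "j + k \<le> CARD('n)" and \<xi>: "\<xi> \<in> grassmannian UNIV j"
    and f: "f \<in> borel_measurable (plane_algebra (grassmannian UNIV k))"
  shows "(\<integral>\<^sup>+\<zeta>. f \<zeta> \<partial>grassmann_law (\<xi>\<^sup>\<bottom>) k)
    = (\<integral>\<^sup>+X. f (tuple_span \<eta> k (\<lambda>i. X i - proj \<xi> (X i))) \<partial>gaussian_tuple k)"
proof -
  have s: "subspace \<xi>" using \<xi> by (rule grassmannian_subspace)
  have "k \<le> dim (\<xi>\<^sup>\<bottom>)" using assms(1) dim_orthogonal_comp[OF s] grassmannian_dim[OF \<xi>] by simp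
  then show ?thesis
    using nn_integral_grassmann_law[OF subspace_orthogonal_comp _ measurable_grassmannian_UNIV[OF f], of \<xi> \<eta>]
    by (simp add: proj_orthogonal_comp[OF s])
qed

text \<open>The measure itself depends on x. The Gaussian model moves this dependence into the
  integrand, leaving an integral of a jointly measurable function against one fixed measure.\<close>

lemma borel_measurable_nn_integral_grassmann_law:
  fixes H :: "'x \<Rightarrow> (real^'n) set \<Rightarrow> ennreal"
  assumes jk: "j + k \<le> CARD('n)" and f [measurable]: "f \<in> measurable M (plane_algebra (grassmannian UNIV j))"
    and H: "(\<lambda>p. H (fst p) (snd p)) \<in> borel_measurable (M \<Otimes>\<^sub>M plane_algebra (grassmannian UNIV k))"
  shows "(\<lambda>x. \<integral>\<^sup>+\<eta>. H x \<eta> \<partial>grassmann_law ((f x)\<^sup>\<bottom>) k) \<in> borel_measurable M"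
proof -
  let ?\<eta> = "SOME \<eta>. \<eta> \<in> grassmannian (UNIV :: (real^'n) set) k"
  have \<eta>: "?\<eta> \<in> grassmannian UNIV k" using jk by (intro grassmannian_UNIV_nonempty) simp
  interpret G: sigma_finite_measure "gaussian_tuple k :: (nat \<Rightarrow> real^'n) measure"
    by (rule gaussian_product.sigma_finite) simp
  have eq: "(\<integral>\<^sup>+\<eta>. H x \<eta> \<partial>grassmann_law ((f x)\<^sup>\<bottom>) k)
      = (\<integral>\<^sup>+X. H x (tuple_span ?\<eta> k (\<lambda>i. X i - proj (f x) (X i))) \<partial>gaussian_tuple k)" if x: "x \<in> space M" for x
    using measurable_space[OF f x] measurable_compose[OF measurable_Pair1'[OF x] H]
    by (intro nn_integral_grassmann_law_orthogonal_comp[OF jk]) auto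
  have "(\<lambda>p. (fst p, tuple_span ?\<eta> k (\<lambda>i. snd p i - proj (f (fst p)) (snd p i))))
      \<in> measurable (M \<Otimes>\<^sub>M gaussian_tuple k) (M \<Otimes>\<^sub>M plane_algebra (grassmannian UNIV k))"
    using measurable_tuple_span_complement[OF \<eta> measurable_compose[OF measurable_fst f] measurable_snd]
    by (intro measurable_Pair) auto
  from G.borel_measurable_nn_integral_fst[OF measurable_compose[OF this H]]
  show ?thesis by (simp add: measurable_cong[OF eq])
qed

lemma nn_integral_flag_law:
  fixes H :: "(real^'n) set \<times> (real^'n) set \<Rightarrow> ennreal"
  assumes jk: "j + k \<le> CARD('n)"
    and H: "H \<in> borel_measurable (plane_algebra (grassmannian UNIV j) \<Otimes>\<^sub>M plane_algebra (grassmannian UNIV k))"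
  shows "(\<integral>\<^sup>+p. H p \<partial>flag_law j k) = (\<integral>\<^sup>+\<xi>. (\<integral>\<^sup>+\<eta>. H (\<xi>, \<eta>) \<partial>grassmann_law (\<xi>\<^sup>\<bottom>) k) \<partial>grassmann_law UNIV j)"
proof -
  let ?\<eta> = "SOME \<eta>. \<eta> \<in> grassmannian (UNIV :: (real^'n) set) k"
  let ?g = "\<lambda>p. (fst p, tuple_span ?\<eta> k (\<lambda>i. snd p i - proj (fst p) (snd p i)))"
  let ?J = "plane_algebra (grassmannian (UNIV :: (real^'n) set) j)" and ?K = "plane_algebra (grassmannian (UNIV :: (real^'n) set) k)"
  have \<eta>: "?\<eta> \<in> grassmannian UNIV k" using jk by (intro grassmannian_UNIV_nonempty) simp
  interpret G: sigma_finite_measure "gaussian_tuple k :: (nat \<Rightarrow> real^'n) measure"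
    by (rule gaussian_product.sigma_finite) simp
  have fst_meas: "fst \<in> measurable (grassmann_law UNIV j \<Otimes>\<^sub>M gaussian_tuple k) ?J" by measurable
  have g: "?g \<in> measurable (grassmann_law UNIV j \<Otimes>\<^sub>M gaussian_tuple k) (?J \<Otimes>\<^sub>M ?K)"
    by (intro measurable_Pair fst_meas measurable_tuple_span_complement[OF \<eta> fst_meas measurable_snd])
  have "(\<integral>\<^sup>+p. H p \<partial>flag_law j k) = (\<integral>\<^sup>+p. H (?g p) \<partial>(grassmann_law UNIV j \<Otimes>\<^sub>M gaussian_tuple k))"
    unfolding flag_law_def by (rule nn_integral_distr[OF g]) (simp add: H)
  also have "\<dots> = (\<integral>\<^sup>+\<xi>. (\<integral>\<^sup>+X. H (?g (\<xi>, X)) \<partial>gaussian_tuple k) \<partial>grassmann_law UNIV j)"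
    using measurable_compose[OF g H] by (rule G.nn_integral_fst[symmetric])
  also have "\<dots> = (\<integral>\<^sup>+\<xi>. (\<integral>\<^sup>+\<eta>. H (\<xi>, \<eta>) \<partial>grassmann_law (\<xi>\<^sup>\<bottom>) k) \<partial>grassmann_law UNIV j)"
  proof (intro nn_integral_cong)
    fix \<xi> assume "\<xi> \<in> space (grassmann_law (UNIV :: (real^'n) set) j)"
    then have \<xi>: "\<xi> \<in> grassmannian UNIV j" by simp
    have "(\<lambda>\<eta>. H (\<xi>, \<eta>)) \<in> borel_measurable ?K"
      using H \<xi> by (intro measurable_compose[OF measurable_Pair1' H]) simp
    from nn_integral_grassmann_law_orthogonal_comp[OF jk \<xi> this]
    show "(\<integral>\<^sup>+X. H (?g (\<xi>, X)) \<partial>gaussian_tuple k) = (\<integral>\<^sup>+\<eta>. H (\<xi>, \<eta>) \<partial>grassmann_law (\<xi>\<^sup>\<bottom>) k)" by simp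
  qed
  finally show ?thesis .
qed

lemma nn_integral_flag_law_image:
  fixes H :: "(real^'n) set \<times> (real^'n) set \<Rightarrow> ennreal" and T :: "real^'n \<Rightarrow> real^'n"
  assumes jk: "j + k \<le> CARD('n)" and T: "orthogonal_transformation T"
    and H [measurable]: "H \<in> borel_measurable (plane_algebra (grassmannian UNIV j) \<Otimes>\<^sub>M plane_algebra (grassmannian UNIV k))"
  shows "(\<integral>\<^sup>+p. H (map_prod ((`) T) ((`) T) p) \<partial>flag_law j k) = (\<integral>\<^sup>+p. H p \<partial>flag_law j k)"
proof -
  let ?J = "plane_algebra (grassmannian (UNIV :: (real^'n) set) j)" and ?K = "plane_algebra (grassmannian (UNIV :: (real^'n) set) k)"
  have TU: "T ` UNIV = UNIV" using orthogonal_transformation_surj[OF T] .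
  have TJ [measurable]: "(`) T \<in> measurable ?J ?J" and TK [measurable]: "(`) T \<in> measurable ?K ?K"
    using measurable_image_orthogonal_transformation[OF T, of UNIV] TU by auto
  have "(\<integral>\<^sup>+p. H (map_prod ((`) T) ((`) T) p) \<partial>flag_law j k)
      = (\<integral>\<^sup>+\<xi>. (\<integral>\<^sup>+\<eta>. H (T ` \<xi>, T ` \<eta>) \<partial>grassmann_law (\<xi>\<^sup>\<bottom>) k) \<partial>grassmann_law UNIV j)"
    by (subst nn_integral_flag_law[OF jk]) (simp_all add: map_prod_def split_beta')
  also have "\<dots> = (\<integral>\<^sup>+\<xi>. (\<integral>\<^sup>+\<eta>. H (T ` \<xi>, \<eta>) \<partial>grassmann_law ((T ` \<xi>)\<^sup>\<bottom>) k) \<partial>grassmann_law UNIV j)"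
  proof (intro nn_integral_cong)
    fix \<xi> assume "\<xi> \<in> space (grassmann_law (UNIV :: (real^'n) set) j)"
    then have \<xi>: "\<xi> \<in> grassmannian UNIV j" by simp
    have s: "subspace \<xi>" using \<xi> by (rule grassmannian_subspace)
    have d: "k \<le> dim (\<xi>\<^sup>\<bottom>)" using jk dim_orthogonal_comp[OF s] grassmannian_dim[OF \<xi>] by simp
    have "T ` \<xi> \<in> space ?J" using measurable_space[OF TJ, of \<xi>] \<xi> by simp
    then have "(\<lambda>\<eta>. H (T ` \<xi>, \<eta>)) \<in> borel_measurable ?K"
      by (intro measurable_compose[OF measurable_Pair1' H])
    then show "(\<integral>\<^sup>+\<eta>. H (T ` \<xi>, T ` \<eta>) \<partial>grassmann_law (\<xi>\<^sup>\<bottom>) k) = (\<integral>\<^sup>+\<eta>. H (T ` \<xi>, \<eta>) \<partial>grassmann_law ((T ` \<xi>)\<^sup>\<bottom>) k)"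
      using nn_integral_grassmann_law_image[OF T subspace_orthogonal_comp d, of "\<lambda>\<eta>. H (T ` \<xi>, \<eta>)"]
      by (simp add: orthogonal_comp_image[OF T] measurable_grassmannian_UNIV)
  qed
  also have "\<dots> = (\<integral>\<^sup>+\<xi>. (\<integral>\<^sup>+\<eta>. H (\<xi>, \<eta>) \<partial>grassmann_law (\<xi>\<^sup>\<bottom>) k) \<partial>grassmann_law (T ` UNIV) j)"
    using jk by (intro nn_integral_grassmann_law_image[OF T, symmetric])
      (simp_all add: TU borel_measurable_nn_integral_grassmann_law[OF jk, where f="\<lambda>\<xi>. \<xi>"])
  also have "\<dots> = (\<integral>\<^sup>+p. H p \<partial>flag_law j k)"
    by (simp add: TU nn_integral_flag_law[OF jk H])
  finally show ?thesis .
qed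

text \<open>Orthogonality tested on the finitely many basis vectors, which makes it visibly a
  measurable condition on the pair.\<close>

definition orthogonal_planes :: "'a::euclidean_space set \<times> 'a set \<Rightarrow> bool" where
  "orthogonal_planes p \<longleftrightarrow> (\<forall>b\<in>Basis. proj (snd p) (proj (fst p) b) = 0)"

lemma orthogonal_planes_iff:
  assumes \<xi>: "subspace \<xi>" and \<eta>: "subspace \<eta>" shows "orthogonal_planes (\<xi>, \<eta>) \<longleftrightarrow> \<xi> \<subseteq> \<eta>\<^sup>\<bottom>"
proof
  assume *: "orthogonal_planes (\<xi>, \<eta>)"
  have "(\<lambda>x. proj \<eta> (proj \<xi> x)) = (\<lambda>x. 0)"
  proof (rule linear_eq_stdbasis)
    show "linear (\<lambda>x. proj \<eta> (proj \<xi> x))"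
      using linear_compose[OF linear_proj[OF \<xi>] linear_proj[OF \<eta>]] by (simp add: o_def)
    show "linear (\<lambda>x. 0)" by (rule linear_zero)
  qed (use * in \<open>auto simp: orthogonal_planes_def\<close>)
  then have "proj \<eta> x = 0" if "x \<in> \<xi>" for x using that proj_id[OF \<xi>] by metis
  then show "\<xi> \<subseteq> \<eta>\<^sup>\<bottom>" using proj_diff_mem[OF \<eta>] by (metis diff_zero subsetI)
next
  assume "\<xi> \<subseteq> \<eta>\<^sup>\<bottom>"
  then show "orthogonal_planes (\<xi>, \<eta>)"
    using proj_mem[OF \<xi>] proj_zero[OF \<eta>] by (auto simp: orthogonal_planes_def)
qed

lemma AE_orthogonal_planes_flag_law:
  assumes jk: "j + k \<le> CARD('n)"
  shows "AE p in flag_law j k. orthogonal_planes (p :: (real^'n) set \<times> (real^'n) set)"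
proof -
  let ?N = "{p \<in> space (flag_law j k :: ((real^'n) set \<times> (real^'n) set) measure). \<not> orthogonal_planes p}"
  have N [measurable]: "?N \<in> sets (flag_law j k)" unfolding orthogonal_planes_def by measurable
  have "emeasure (flag_law j k) ?N = (\<integral>\<^sup>+p. indicator ?N p \<partial>flag_law j k)" using N by simp
  also have "\<dots> = (\<integral>\<^sup>+\<xi>. (\<integral>\<^sup>+\<eta>. indicator ?N (\<xi>, \<eta>) \<partial>grassmann_law (\<xi>\<^sup>\<bottom>) k) \<partial>grassmann_law UNIV j)"
    using N by (intro nn_integral_flag_law[OF jk]) simp
  also have "\<dots> = (\<integral>\<^sup>+\<xi>. (\<integral>\<^sup>+\<eta>. 0 \<partial>grassmann_law (\<xi>\<^sup>\<bottom>) k) \<partial>grassmann_law (UNIV :: (real^'n) set) j)"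
  proof (intro nn_integral_cong)
    fix \<xi> \<eta> :: "(real^'n) set" assume "\<xi> \<in> space (grassmann_law UNIV j)" "\<eta> \<in> space (grassmann_law (\<xi>\<^sup>\<bottom>) k)"
    then have "subspace \<xi>" "subspace \<eta>" "\<eta> \<subseteq> \<xi>\<^sup>\<bottom>" by (auto simp: grassmannian_def)
    then have "\<xi> \<subseteq> \<eta>\<^sup>\<bottom>" by (metis orthogonal_comp_anti_mono orthogonal_comp_self)
    then show "indicator ?N (\<xi>, \<eta>) = (0::ennreal)"
      using \<open>subspace \<xi>\<close> \<open>subspace \<eta>\<close> by (simp add: orthogonal_planes_iff)
  qed
  finally show ?thesis using N by (intro AE_I[of _ _ ?N]) auto
qed

lemma prob_space_flag_law:
  assumes jk: "j + k \<le> CARD('n)"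
  shows "prob_space (flag_law j k :: ((real^'n) set \<times> (real^'n) set) measure)"
proof
  have P: "emeasure (grassmann_law V l) (grassmannian V l) = 1" if "subspace V" "l \<le> dim V" for V :: "(real^'n) set" and l
    using prob_space.emeasure_space_1[OF prob_space_grassmann_law[OF that]] by simp
  let ?F = "flag_law j k :: ((real^'n) set \<times> (real^'n) set) measure"
  have "emeasure ?F (space ?F) = (\<integral>\<^sup>+p. 1 \<partial>?F)" by simp
  also have "\<dots> = (\<integral>\<^sup>+\<xi>. (\<integral>\<^sup>+\<eta>. 1 \<partial>grassmann_law (\<xi>\<^sup>\<bottom>) k) \<partial>grassmann_law (UNIV :: (real^'n) set) j)"
    by (intro nn_integral_flag_law[OF jk]) simp
  also have "\<dots> = (\<integral>\<^sup>+\<xi>. 1 \<partial>grassmann_law (UNIV :: (real^'n) set) j)"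
  proof (intro nn_integral_cong)
    fix \<xi> assume "\<xi> \<in> space (grassmann_law (UNIV :: (real^'n) set) j)"
    then have \<xi>: "subspace \<xi>" "dim \<xi> = j" by (auto simp: grassmannian_def)
    then have "k \<le> dim (\<xi>\<^sup>\<bottom>)" using jk dim_orthogonal_comp[OF \<xi>(1)] by simp
    then show "(\<integral>\<^sup>+\<eta>. 1 \<partial>grassmann_law (\<xi>\<^sup>\<bottom>) k) = 1" by (simp add: P subspace_orthogonal_comp)
  qed
  also have "\<dots> = 1" using jk by (simp add: P)
  finally show "emeasure ?F (space ?F) = 1" .
qed

lemma flag_algebra_eq_vimage:
  fixes A :: "((real^'n) set \<times> (real^'n) set) set"
  assumes "A \<in> sets (plane_algebra (grassmannian UNIV j) \<Otimes>\<^sub>M plane_algebra (grassmannian UNIV k))"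
  shows "\<exists>B\<in>sets borel. A = map_prod proj_columns proj_columns -` B \<inter> (grassmannian UNIV j \<times> grassmannian UNIV k)"
proof -
  let ?S = "grassmannian (UNIV :: (real^'n) set) j \<times> grassmannian (UNIV :: (real^'n) set) k"
  let ?e = "map_prod proj_columns proj_columns :: _ \<Rightarrow> (real^'n^'n) \<times> (real^'n^'n)"
  let ?V = "vimage_algebra ?S ?e borel"
  have sV: "sets ?V = {?e -` B \<inter> ?S |B. B \<in> sets borel}"
    by (rule sets_vimage_algebra2) simp
  have "{a \<times> b |a b. a \<in> sets (plane_algebra (grassmannian (UNIV :: (real^'n) set) j)) \<and>
      b \<in> sets (plane_algebra (grassmannian (UNIV :: (real^'n) set) k))} \<subseteq> sets ?V"
  proof clarify
    fix a b assume "a \<in> sets (plane_algebra (grassmannian (UNIV :: (real^'n) set) j))"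
      "b \<in> sets (plane_algebra (grassmannian (UNIV :: (real^'n) set) k))"
    then obtain A B where A: "A \<in> sets borel" "a = proj_columns -` A \<inter> grassmannian UNIV j"
      and B: "B \<in> sets borel" "b = proj_columns -` B \<inter> grassmannian UNIV k"
      using plane_algebra_eq_vimage by metis
    have "A \<times> B \<in> sets (borel \<Otimes>\<^sub>M borel)" using A B by (intro pair_measureI)
    then have AB: "A \<times> B \<in> sets borel" unfolding borel_prod .
    have eq: "a \<times> b = ?e -` (A \<times> B) \<inter> ?S" using A B by auto
    show "a \<times> b \<in> sets ?V"
      unfolding sV mem_Collect_eq by (rule exI, rule conjI[OF eq AB])
  qed
  from sets.sigma_sets_subset[OF this]
  have "sets (plane_algebra (grassmannian (UNIV :: (real^'n) set) j) \<Otimes>\<^sub>M plane_algebra (grassmannian (UNIV :: (real^'n) set) k)) \<subseteq> sets ?V"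
    by (simp only: sets_pair_measure space_plane_algebra space_vimage_algebra)
  with assms have "A \<in> sets ?V" by blast
  then show ?thesis unfolding sV by blast
qed

lemma measure_eqI_nn_integral:
  assumes "sets M = sets N" "\<And>f. f \<in> borel_measurable M \<Longrightarrow> (\<integral>\<^sup>+x. f x \<partial>M) = (\<integral>\<^sup>+x. f x \<partial>N)"
  shows "M = N"
proof (rule measure_eqI)
  fix A assume A: "A \<in> sets M"
  then show "emeasure M A = emeasure N A" using assms(2)[of "indicator A"] assms(1) by simp
qed fact

text \<open>The orthogonal group is not transitive on all pairs of planes, so uniqueness is applied
  with the orthogonal pairs as the set S of full measure. Invariance of the swapped law follows
  because swapping commutes with applying T to both components.\<close>

theorem flag_law_swap:
  assumes jk: "j + k \<le> CARD('n)"
  shows "distr (flag_law k j) (plane_algebra (grassmannian UNIV j) \<Otimes>\<^sub>M plane_algebra (grassmannian UNIV k)) prod.swap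
    = (flag_law j k :: ((real^'n) set \<times> (real^'n) set) measure)"
    (is "?M = ?N")
proof (rule homogeneous_probability_unique[where e="map_prod proj_columns proj_columns" and
      S="{p \<in> grassmannian UNIV j \<times> grassmannian UNIV k. orthogonal_planes p}"])
  have kj: "k + j \<le> CARD('n)" using jk by simp
  let ?J = "plane_algebra (grassmannian (UNIV :: (real^'n) set) j)" and ?K = "plane_algebra (grassmannian (UNIV :: (real^'n) set) k)"
  have swap [measurable]: "prod.swap \<in> measurable (flag_law k j) (?J \<Otimes>\<^sub>M ?K)"
    unfolding prod.swap_def by measurable
  show "prob_space ?M" using prob_space_flag_law[OF kj] swap by (rule prob_space.prob_space_distr)
  show "prob_space ?N" by (rule prob_space_flag_law[OF jk])
  show "sets ?N = sets ?M" by simp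
  show "map_prod proj_columns proj_columns \<in> borel_measurable ?M"
    unfolding borel_prod[symmetric] map_prod_def split_beta' by measurable
  show "\<exists>B\<in>sets borel. A = map_prod proj_columns proj_columns -` B \<inter> space ?M" if "A \<in> sets ?M" for A
    using flag_algebra_eq_vimage[of A j k] that by (simp add: space_pair_measure)
  have "AE p in ?N. p \<in> space ?N" by (rule AE_space)
  with AE_orthogonal_planes_flag_law[OF jk]
  show "AE p in ?N. p \<in> {p \<in> grassmannian UNIV j \<times> grassmannian UNIV k. orthogonal_planes p}"
    by eventually_elim auto
  have [measurable]: "Measurable.pred (?J \<Otimes>\<^sub>M ?K) orthogonal_planes"
    unfolding orthogonal_planes_def by measurable
  have "AE p in flag_law k j. prod.swap p \<in> {p \<in> space (?J \<Otimes>\<^sub>M ?K). orthogonal_planes (p :: (real^'n) set \<times> (real^'n) set)}"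
    using AE_orthogonal_planes_flag_law[OF kj] AE_space
  proof eventually_elim
    case (elim p)
    then have "subspace (fst p)" "subspace (snd p)" by (auto simp: grassmannian_def)
    moreover have "fst p \<subseteq> (snd p)\<^sup>\<bottom>" using elim orthogonal_planes_iff[OF calculation] by simp
    then have "snd p \<subseteq> (fst p)\<^sup>\<bottom>" using calculation by (metis orthogonal_comp_anti_mono orthogonal_comp_self)
    ultimately show ?case using elim by (cases p) (auto simp: orthogonal_planes_iff space_pair_measure)
  qed
  then have "AE p in ?M. p \<in> {p \<in> space (?J \<Otimes>\<^sub>M ?K). orthogonal_planes p}"
    by (subst AE_distr_iff[OF swap]) auto
  then show "AE p in ?M. p \<in> {p \<in> grassmannian UNIV j \<times> grassmannian UNIV k. orthogonal_planes p}"
    by (simp add: space_pair_measure)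
  fix p q :: "(real^'n) set \<times> (real^'n) set"
  assume "p \<in> {p \<in> grassmannian UNIV j \<times> grassmannian UNIV k. orthogonal_planes p}"
    "q \<in> {p \<in> grassmannian UNIV j \<times> grassmannian UNIV k. orthogonal_planes p}"
  then obtain \<xi> \<eta> \<xi>' \<eta>' where p: "p = (\<xi>, \<eta>)" "q = (\<xi>', \<eta>')"
    and G: "\<xi> \<in> grassmannian UNIV j" "\<xi>' \<in> grassmannian UNIV j" "\<eta> \<in> grassmannian UNIV k" "\<eta>' \<in> grassmannian UNIV k"
    and O: "orthogonal_planes (\<xi>, \<eta>)" "orthogonal_planes (\<xi>', \<eta>')" by (cases p, cases q) auto
  obtain T where T: "orthogonal_transformation T" "T ` \<xi> = \<xi>'" "T ` \<eta> = \<eta>'"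
    using orthogonal_flag_transitive[of \<xi> \<xi>' \<eta> \<eta>'] G O by (auto simp: grassmannian_def orthogonal_planes_iff)
  let ?g = "map_prod ((`) T) ((`) T)"
  have TU: "T ` UNIV = UNIV" using orthogonal_transformation_surj[OF T(1)] .
  have [measurable]: "(`) T \<in> measurable ?J ?J" "(`) T \<in> measurable ?K ?K"
    using measurable_image_orthogonal_transformation[OF T(1), of UNIV] TU by auto
  have g [measurable]: "?g \<in> measurable (?J \<Otimes>\<^sub>M ?K) (?J \<Otimes>\<^sub>M ?K)" "?g \<in> measurable (?K \<Otimes>\<^sub>M ?J) (?K \<Otimes>\<^sub>M ?J)"
    unfolding map_prod_def split_beta' by measurable
  have "distr ?N ?N ?g = ?N"
  proof (rule measure_eqI_nn_integral)
    fix f :: "_ \<Rightarrow> ennreal" assume "f \<in> borel_measurable (distr ?N ?N ?g)"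
    then have [measurable]: "f \<in> borel_measurable (?J \<Otimes>\<^sub>M ?K)" by simp
    show "(\<integral>\<^sup>+p. f p \<partial>distr ?N ?N ?g) = (\<integral>\<^sup>+p. f p \<partial>?N)"
      by (subst nn_integral_distr) (simp_all add: nn_integral_flag_law_image[OF jk T(1)])
  qed simp
  moreover have "distr ?M ?M ?g = ?M"
  proof (rule measure_eqI_nn_integral)
    fix f :: "_ \<Rightarrow> ennreal" assume "f \<in> borel_measurable (distr ?M ?M ?g)"
    then have [measurable]: "f \<in> borel_measurable (?J \<Otimes>\<^sub>M ?K)" by simp
    have "(\<integral>\<^sup>+p. f p \<partial>distr ?M ?M ?g) = (\<integral>\<^sup>+p. f (?g (prod.swap p)) \<partial>flag_law k j)"
      by (simp add: nn_integral_distr)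
    also have "\<dots> = (\<integral>\<^sup>+p. f (prod.swap (?g p)) \<partial>flag_law k j)"
      by (simp add: prod.swap_def map_prod_def split_beta')
    also have "\<dots> = (\<integral>\<^sup>+p. f (prod.swap p) \<partial>flag_law k j)"
      by (rule nn_integral_flag_law_image[OF kj T(1)]) (simp add: prod.swap_def)
    also have "\<dots> = (\<integral>\<^sup>+p. f p \<partial>?M)" by (simp add: nn_integral_distr)
    finally show "(\<integral>\<^sup>+p. f p \<partial>distr ?M ?M ?g) = (\<integral>\<^sup>+p. f p \<partial>?M)" .
  qed simp
  moreover have "dist (map_prod proj_columns proj_columns (?g p)) (map_prod proj_columns proj_columns (?g z))
      = dist (map_prod proj_columns proj_columns p) (map_prod proj_columns proj_columns z)" if "z \<in> space ?M" for z
  proof (cases z)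
    case (Pair a b)
    then have "subspace a" "subspace b" using that by (auto simp: space_pair_measure grassmannian_def)
    then show ?thesis unfolding Pair p
      using dist_proj_columns_image[OF T(1), of \<xi> a] dist_proj_columns_image[OF T(1), of \<eta> b] G
      by (simp add: dist_Pair_Pair grassmannian_subspace)
  qed
  ultimately show "\<exists>g. g p = q \<and> (\<forall>z\<in>space ?M. dist (map_prod proj_columns proj_columns (g p)) (map_prod proj_columns proj_columns (g z))
        = dist (map_prod proj_columns proj_columns p) (map_prod proj_columns proj_columns z)) \<and>
      g \<in> measurable ?M ?M \<and> distr ?M ?M g = ?M \<and> distr ?N ?N g = ?N"
    using T p by (intro exI[of _ ?g]) auto
qed

theorem nn_integral_flag_swap:
  fixes H :: "(real^'n) set \<Rightarrow> (real^'n) set \<Rightarrow> ennreal"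
  assumes jk: "j + k \<le> CARD('n)"
    and H: "(\<lambda>p. H (fst p) (snd p)) \<in> borel_measurable (plane_algebra (grassmannian UNIV j) \<Otimes>\<^sub>M plane_algebra (grassmannian UNIV k))"
  shows "(\<integral>\<^sup>+\<eta>. (\<integral>\<^sup>+\<xi>. H \<xi> \<eta> \<partial>grassmann_law (\<eta>\<^sup>\<bottom>) j) \<partial>grassmann_law UNIV k)
    = (\<integral>\<^sup>+\<xi>. (\<integral>\<^sup>+\<eta>. H \<xi> \<eta> \<partial>grassmann_law (\<xi>\<^sup>\<bottom>) k) \<partial>grassmann_law UNIV j)"
proof -
  let ?J = "plane_algebra (grassmannian (UNIV :: (real^'n) set) j)" and ?K = "plane_algebra (grassmannian (UNIV :: (real^'n) set) k)"
  have kj: "k + j \<le> CARD('n)" using jk by simp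
  have swap: "prod.swap \<in> measurable (flag_law k j) (?J \<Otimes>\<^sub>M ?K)" "prod.swap \<in> measurable (?K \<Otimes>\<^sub>M ?J) (?J \<Otimes>\<^sub>M ?K)"
    unfolding prod.swap_def by measurable
  have "(\<integral>\<^sup>+\<eta>. (\<integral>\<^sup>+\<xi>. H \<xi> \<eta> \<partial>grassmann_law (\<eta>\<^sup>\<bottom>) j) \<partial>grassmann_law UNIV k)
      = (\<integral>\<^sup>+p. H (fst (prod.swap p)) (snd (prod.swap p)) \<partial>flag_law k j)"
    using measurable_compose[OF swap(2) H] by (subst nn_integral_flag_law[OF kj]) simp_all
  also have "\<dots> = (\<integral>\<^sup>+p. H (fst p) (snd p) \<partial>distr (flag_law k j) (?J \<Otimes>\<^sub>M ?K) prod.swap)"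
    using swap H by (subst nn_integral_distr) auto
  also have "\<dots> = (\<integral>\<^sup>+\<xi>. (\<integral>\<^sup>+\<eta>. H \<xi> \<eta> \<partial>grassmann_law (\<xi>\<^sup>\<bottom>) k) \<partial>grassmann_law UNIV j)"
    unfolding flag_law_swap[OF jk] using H by (subst nn_integral_flag_law[OF jk]) simp_all
  finally show ?thesis .
qed

section \<open>Affine planes and duality\<close>

lemma plane_translate_proj:
  fixes \<xi> :: "'a::euclidean_space set"
  assumes "subspace \<xi>" shows "(+) x ` \<xi> = (+) (x - proj \<xi> x) ` \<xi>"
proof
  have p: "proj \<xi> x \<in> \<xi>" using assms by (rule proj_mem)
  show "(+) x ` \<xi> \<subseteq> (+) (x - proj \<xi> x) ` \<xi>"
  proof clarify
    fix y assume "y \<in> \<xi>"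
    then have "proj \<xi> x + y \<in> \<xi>" using p assms by (simp add: subspace_add)
    then show "x + y \<in> (+) (x - proj \<xi> x) ` \<xi>" by (rule rev_image_eqI) simp
  qed
  show "(+) (x - proj \<xi> x) ` \<xi> \<subseteq> (+) x ` \<xi>"
  proof clarify
    fix y assume "y \<in> \<xi>"
    then have "y - proj \<xi> x \<in> \<xi>" using p assms by (simp add: subspace_diff)
    then show "x - proj \<xi> x + y \<in> (+) x ` \<xi>" by (rule rev_image_eqI) simp
  qed
qed

lemma plane_translate_mem:
  assumes "\<xi> \<in> grassmannian V j" shows "(+) x ` \<xi> \<in> affine_grassmannian j"
proof -
  have s: "subspace \<xi>" using assms by (rule grassmannian_subspace)
  show ?thesis unfolding affine_grassmannian_def plane_translate_proj[OF s, of x]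
    using proj_diff_mem[OF s] grassmannian_UNIV[OF assms] by blast
qed

lemma plane_translate_absorb:
  fixes \<xi> :: "'a::euclidean_space set"
  shows "subspace \<xi> \<Longrightarrow> y \<in> \<xi> \<Longrightarrow> (+) (x + y) ` \<xi> = (+) x ` \<xi>"
  using plane_translate_proj[of \<xi> "x + y"] plane_translate_proj[of \<xi> x] by (simp add: proj_add proj_id)

lemma measurable_plane_translate [measurable (raw)]:
  fixes g :: "'x \<Rightarrow> 'a::euclidean_space"
  assumes f [measurable]: "f \<in> measurable M (plane_algebra (grassmannian V j))" and [measurable]: "g \<in> borel_measurable M"
  shows "(\<lambda>x. (+) (g x) ` f x) \<in> measurable M (plane_algebra (affine_grassmannian j))"
proof (rule measurable_plane_range[where h="\<lambda>x z. g x + proj (f x) z"])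
  fix x assume "x \<in> space M"
  then have x: "f x \<in> grassmannian V j" using measurable_space[OF f] by simp
  then show "(+) (g x) ` f x \<in> affine_grassmannian j" by (rule plane_translate_mem)
  have s: "subspace (f x)" using x by (rule grassmannian_subspace)
  have "range (proj (f x)) = f x"
    using proj_mem[OF s] proj_id[OF s] by (metis image_subset_iff rangeI subsetI subset_antisym)
  then show "(+) (g x) ` f x = range (\<lambda>z. g x + proj (f x) z)"
    by (metis image_image)
  show "continuous_on UNIV (\<lambda>z. g x + proj (f x) z)"
    by (intro continuous_intros continuous_on_proj s)
qed measurable

text \<open>The point x ranges over the whole space, weighted by the Gaussian of its component along
  \<xi>. Moving x within a plane thus has total weight 1, and d\<xi> du becomes the push-forward of
  a density on a product whose second factor does not depend on \<xi>.\<close>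

definition affine_law :: "nat \<Rightarrow> (real^'n) set measure" where
  "affine_law j = distr (density (grassmann_law UNIV j \<Otimes>\<^sub>M lborel) (\<lambda>p. ennreal (gauss (proj (fst p) (snd p)))))
     (plane_algebra (affine_grassmannian j)) (\<lambda>p. (+) (snd p) ` fst p)"

lemma space_affine_law [simp]: "space (affine_law j) = affine_grassmannian j"
  and sets_affine_law [measurable_cong, simp]: "sets (affine_law j) = sets (plane_algebra (affine_grassmannian j))"
  by (simp_all add: affine_law_def)

lemma measurable_fst_grassmann_law [measurable]:
  "fst \<in> measurable (grassmann_law V j \<Otimes>\<^sub>M N) (plane_algebra (grassmannian V j))"
  using measurable_fst by (simp cong: measurable_cong_sets)

lemma nn_integral_orthogonal_comp_translate:
  fixes F :: "(real^'n) set \<Rightarrow> ennreal"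
  assumes [measurable]: "F \<in> borel_measurable (plane_algebra (affine_grassmannian j))" and \<xi>: "\<xi> \<in> grassmannian UNIV j"
  shows "(\<integral>\<^sup>+u. F ((+) u ` \<xi>) \<partial>subspace_lborel (\<xi>\<^sup>\<bottom>))
    = (\<integral>\<^sup>+x. ennreal (gauss (proj \<xi> x)) * F ((+) x ` \<xi>) \<partial>lborel)"
proof -
  have [measurable]: "(\<lambda>_. \<xi>) \<in> measurable borel (plane_algebra (grassmannian UNIV j))" using \<xi> by simp
  have s: "subspace \<xi>" using \<xi> by (rule grassmannian_subspace)
  have "(\<integral>\<^sup>+u. F ((+) u ` \<xi>) \<partial>subspace_lborel (\<xi>\<^sup>\<bottom>))
      = (\<integral>\<^sup>+x. F ((+) (x - proj \<xi> x) ` \<xi>) * ennreal (gauss (proj \<xi> x)) \<partial>lborel)"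
    by (subst nn_integral_subspace_lborel_gauss) (simp_all add: subspace_orthogonal_comp proj_orthogonal_comp[OF s])
  then show ?thesis
    using plane_translate_proj[OF s, symmetric] by (simp add: mult.commute)
qed

lemma borel_measurable_nn_integral_orthogonal_comp:
  fixes F :: "(real^'n) set \<Rightarrow> ennreal"
  assumes [measurable]: "F \<in> borel_measurable (plane_algebra (affine_grassmannian j))"
  shows "(\<lambda>\<xi>. \<integral>\<^sup>+u. F ((+) u ` \<xi>) \<partial>subspace_lborel (\<xi>\<^sup>\<bottom>)) \<in> borel_measurable (plane_algebra (grassmannian UNIV j))"
proof -
  have "(\<lambda>\<xi>. \<integral>\<^sup>+x. ennreal (gauss (proj \<xi> x)) * F ((+) x ` \<xi>) \<partial>lborel) \<in> borel_measurable (plane_algebra (grassmannian UNIV j))"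
    by measurable
  then show ?thesis
    by (subst measurable_cong[OF nn_integral_orthogonal_comp_translate[OF assms]]) simp_all
qed

lemma nn_integral_affine_law:
  fixes F :: "(real^'n) set \<Rightarrow> ennreal"
  assumes F [measurable]: "F \<in> borel_measurable (plane_algebra (affine_grassmannian j))"
  shows "(\<integral>\<^sup>+\<tau>. F \<tau> \<partial>affine_law j)
    = (\<integral>\<^sup>+\<xi>. (\<integral>\<^sup>+u. F ((+) u ` \<xi>) \<partial>subspace_lborel (\<xi>\<^sup>\<bottom>)) \<partial>grassmann_law UNIV j)"
proof -
  let ?M = "grassmann_law (UNIV :: (real^'n) set) j \<Otimes>\<^sub>M (lborel :: (real^'n) measure)"
  have "(\<integral>\<^sup>+\<tau>. F \<tau> \<partial>affine_law j)
      = (\<integral>\<^sup>+p. F ((+) (snd p) ` fst p) \<partial>density ?M (\<lambda>p. ennreal (gauss (proj (fst p) (snd p)))))"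
    unfolding affine_law_def by (intro nn_integral_distr) simp_all
  also have "\<dots> = (\<integral>\<^sup>+p. ennreal (gauss (proj (fst p) (snd p))) * F ((+) (snd p) ` fst p) \<partial>?M)"
    by (intro nn_integral_density) measurable
  also have "\<dots> = (\<integral>\<^sup>+\<xi>. (\<integral>\<^sup>+x. ennreal (gauss (proj \<xi> x)) * F ((+) x ` \<xi>) \<partial>lborel) \<partial>grassmann_law UNIV j)"
    by (subst lborel.nn_integral_fst[symmetric]) simp_all
  also have "\<dots> = (\<integral>\<^sup>+\<xi>. (\<integral>\<^sup>+u. F ((+) u ` \<xi>) \<partial>subspace_lborel (\<xi>\<^sup>\<bottom>)) \<partial>grassmann_law UNIV j)"
    by (intro nn_integral_cong nn_integral_orthogonal_comp_translate[OF F, symmetric]) simp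
  finally show ?thesis .
qed

text \<open>\<open>measure_of\<close> returns its set function only if that function is a measure;
  agreement with the measure \<open>affine_law\<close> on all measurable sets shows that it
  is.\<close>

theorem affine_measure_eq:
  assumes "j \<le> CARD('n)"
  shows "affine_measure j = completion (affine_law j :: (real^'n) set measure)"
proof -
  have eq: "grassmann_measure (UNIV :: (real^'n) set) j = grassmann_law UNIV j"
    using assms by (intro grassmann_measure_eq_law) auto
  let ?L = "affine_law j :: (real^'n) set measure"
  let ?\<mu> = "\<lambda>A. \<integral>\<^sup>+\<xi>. (\<integral>\<^sup>+u. indicator A ((+) u ` \<xi>) \<partial>subspace_lborel (\<xi>\<^sup>\<bottom>)) \<partial>grassmann_law (UNIV :: (real^'n) set) j"
  have "measure_of (affine_grassmannian j) (sets (plane_algebra (affine_grassmannian j))) ?\<mu>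
      = measure_of (space ?L) (sets ?L) ?\<mu>" by simp
  also have "\<dots> = measure_of (space ?L) (sets ?L) (emeasure ?L)"
  proof (rule measure_of_eq)
    show "sets ?L \<subseteq> Pow (space ?L)" by (rule sets.space_closed)
    fix A assume "A \<in> sigma_sets (space ?L) (sets ?L)"
    then have A: "A \<in> sets ?L" by (simp only: sets.sigma_sets_eq)
    then have "emeasure ?L A = (\<integral>\<^sup>+\<tau>. indicator A \<tau> \<partial>?L)" by simp
    also have "\<dots> = ?\<mu> A" using A by (intro nn_integral_affine_law) simp
    finally show "?\<mu> A = emeasure ?L A" ..
  qed
  also have "\<dots> = ?L" by (rule measure_of_of_measure)
  finally show ?thesis unfolding affine_measure_def eq by simp
qed

section \<open>Direction and foot of an affine plane\<close>

definition plane_direction :: "'a::euclidean_space set \<Rightarrow> 'a set" where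
  "plane_direction \<tau> = {x - y | x y. x \<in> \<tau> \<and> y \<in> \<tau>}"

text \<open>By polarization this is the point of \<open>\<tau>\<close> nearest to the origin.\<close>

definition plane_foot :: "'a::euclidean_space set \<Rightarrow> 'a" where
  "plane_foot \<tau> = (\<Sum>b\<in>Basis. (((infdist (- b) \<tau>)\<^sup>2 - (infdist b \<tau>)\<^sup>2) / 4) *\<^sub>R b)"

lemma plane_direction_translate: "subspace \<eta> \<Longrightarrow> plane_direction ((+) v ` \<eta>) = \<eta>"
proof -
  assume s: "subspace \<eta>"
  have "z \<in> plane_direction ((+) v ` \<eta>)" if "z \<in> \<eta>" for z
  proof -
    have "z = (v + z) - (v + 0)" by simp
    then show ?thesis unfolding plane_direction_def using that subspace_0[OF s] by blast
  qed
  then show ?thesis using s by (auto simp: plane_direction_def subspace_diff)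
qed

lemma infdist_translate: "infdist x ((+) v ` \<eta>) = infdist (x - v) (\<eta> :: 'a::euclidean_space set)"
  by (simp add: infdist_def image_image dist_norm algebra_simps)

lemma plane_foot_translate:
  assumes s: "subspace \<eta>" and v: "v \<in> \<eta>\<^sup>\<bottom>"
  shows "plane_foot ((+) v ` \<eta>) = v"
proof -
  have "((infdist (- b) ((+) v ` \<eta>))\<^sup>2 - (infdist b ((+) v ` \<eta>))\<^sup>2) / 4 = v \<bullet> b" for b
  proof -
    let ?c = "b - proj \<eta> b"
    have "(b - v) - proj \<eta> (b - v) = ?c - v" "(- b - v) - proj \<eta> (- b - v) = - ?c - v"
      using proj_zero[OF s v] proj_scaleR[OF s, of "-1" b] by (simp_all add: proj_diff[OF s])
    then have "infdist b ((+) v ` \<eta>) = norm (?c - v)" "infdist (- b) ((+) v ` \<eta>) = norm (- ?c - v)"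
      by (simp_all only: infdist_translate infdist_eq_norm_proj[OF s])
    moreover have "v \<bullet> proj \<eta> b = 0" using orthogonal_compD[OF v proj_mem[OF s]] .
    ultimately show ?thesis
      by (simp add: power2_norm_eq_inner inner_diff_left inner_diff_right inner_commute)
  qed
  then show ?thesis unfolding plane_foot_def by (simp add: euclidean_representation)
qed

lemma affine_grassmannianE:
  assumes "\<zeta> \<in> affine_grassmannian k"
  obtains \<eta> v where "\<eta> \<in> grassmannian UNIV k" "v \<in> \<eta>\<^sup>\<bottom>" "\<zeta> = (+) v ` \<eta>"
    "plane_direction \<zeta> = \<eta>" "plane_foot \<zeta> = v"
proof -
  obtain \<eta> v where "\<zeta> = (+) v ` \<eta>" "\<eta> \<in> grassmannian UNIV k" "v \<in> \<eta>\<^sup>\<bottom>"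
    using assms by (auto simp: affine_grassmannian_def)
  moreover from this have s: "subspace \<eta>" by (simp add: grassmannian_subspace)
  ultimately show thesis
    using plane_direction_translate[OF s, of v] plane_foot_translate[OF s, of v] by (intro that) simp_all
qed

text \<open>The differences of points of a plane hit U exactly if the plane hits both members of
  some pair of basic open sets a, b all of whose differences lie in U. There are countably many such
  pairs.\<close>

lemma measurable_plane_direction [measurable]:
  "plane_direction \<in> measurable (plane_algebra (affine_grassmannian k :: 'a::euclidean_space set set)) (plane_algebra (grassmannian UNIV k))"
proof (rule measurable_plane_algebraI)
  show "plane_direction \<tau> \<in> grassmannian UNIV k" if "\<tau> \<in> space (plane_algebra (affine_grassmannian k))" for \<tau> :: "'a set"
    using that by (auto elim: affine_grassmannianE)
  fix U :: "'a set" assume U: "open U"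
  obtain B :: "'a set set" where B: "countable B" "topological_basis B"
    using ex_countable_basis by blast
  define I where "I = {(a, b) \<in> B \<times> B. \<forall>x\<in>a. \<forall>y\<in>b. x - y \<in> U}"
  let ?H = "\<lambda>a. {\<tau> \<in> affine_grassmannian k. \<tau> \<inter> a \<noteq> {}}"
  have iff: "plane_direction \<tau> \<inter> U \<noteq> {} \<longleftrightarrow> (\<exists>p\<in>I. \<tau> \<inter> fst p \<noteq> {} \<and> \<tau> \<inter> snd p \<noteq> {})" for \<tau>
  proof
    assume "plane_direction \<tau> \<inter> U \<noteq> {}"
    then obtain x y where xy: "x \<in> \<tau>" "y \<in> \<tau>" "x - y \<in> U" by (auto simp: plane_direction_def)
    have "open ((\<lambda>p. fst p - snd p) -` U)"
      by (intro open_vimage U continuous_intros)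
    moreover have "(x, y) \<in> (\<lambda>p. fst p - snd p) -` U" using xy by simp
    ultimately obtain A C where AC: "open A" "open C" "(x, y) \<in> A \<times> C" "A \<times> C \<subseteq> (\<lambda>p. fst p - snd p) -` U"
      by (rule open_prod_elim)
    obtain a where a: "a \<in> B" "x \<in> a" "a \<subseteq> A" using topological_basisE[OF B(2) AC(1), of x] AC(3) by auto
    obtain b where b: "b \<in> B" "y \<in> b" "b \<subseteq> C" using topological_basisE[OF B(2) AC(2), of y] AC(3) by auto
    have "(a, b) \<in> I" using a b AC(4) by (fastforce simp: I_def)
    then show "\<exists>p\<in>I. \<tau> \<inter> fst p \<noteq> {} \<and> \<tau> \<inter> snd p \<noteq> {}" using a b xy by (intro bexI[of _ "(a, b)"]) auto
  next
    assume "\<exists>p\<in>I. \<tau> \<inter> fst p \<noteq> {} \<and> \<tau> \<inter> snd p \<noteq> {}"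
    then obtain p x y where p: "p \<in> I" "x \<in> \<tau>" "x \<in> fst p" "y \<in> \<tau>" "y \<in> snd p" by blast
    moreover have "\<forall>x\<in>fst p. \<forall>y\<in>snd p. x - y \<in> U" using p(1) by (simp add: I_def split_beta)
    ultimately have "x - y \<in> plane_direction \<tau>" "x - y \<in> U" by (auto simp: plane_direction_def)
    then show "plane_direction \<tau> \<inter> U \<noteq> {}" by blast
  qed
  have "{\<tau> \<in> space (plane_algebra (affine_grassmannian k)). plane_direction \<tau> \<inter> U \<noteq> {}}
      = (\<Union>p\<in>I. ?H (fst p) \<inter> ?H (snd p))"
    by (simp add: iff) blast
  also have "\<dots> \<in> sets (plane_algebra (affine_grassmannian k))"
  proof (rule sets.countable_UN'')
    have "I \<subseteq> B \<times> B" by (auto simp: I_def)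
    then show "countable I" using B(1) countable_subset countable_SIGMA by metis
    show "?H (fst p) \<inter> ?H (snd p) \<in> sets (plane_algebra (affine_grassmannian k))" if "p \<in> I" for p
      using that B(2) by (intro sets.Int hitting_set_in_plane_algebra) (auto simp: I_def dest: topological_basis_open)
  qed
  finally show "{\<tau> \<in> space (plane_algebra (affine_grassmannian k)). plane_direction \<tau> \<inter> U \<noteq> {}}
      \<in> sets (plane_algebra (affine_grassmannian k))" .
qed

lemma empty_notin_affine_grassmannian: "{} \<notin> affine_grassmannian k"
proof
  assume "{} \<in> affine_grassmannian k"
  then show False
  proof (rule affine_grassmannianE)
    fix \<eta> v assume "\<eta> \<in> grassmannian UNIV k" and eq: "{} = (+) v ` \<eta>"
    then have "0 \<in> \<eta>" using grassmannian_subspace subspace_0 by metis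
    then have "v + 0 \<in> (+) v ` \<eta>" by (rule imageI)
    then show False unfolding eq[symmetric] by simp
  qed
qed

lemma borel_measurable_infdist_affine [measurable]:
  "(\<lambda>\<tau>. infdist (x::'a::euclidean_space) \<tau>) \<in> borel_measurable (plane_algebra (affine_grassmannian k))"
proof -
  have "(\<lambda>\<tau>. (\<tau>, x)) \<in> measurable (plane_algebra (affine_grassmannian k)) (plane_algebra (affine_grassmannian k) \<Otimes>\<^sub>M borel)"
    by (intro measurable_Pair measurable_const measurable_ident) simp_all
  from measurable_compose[OF this borel_measurable_infdist_plane[OF empty_notin_affine_grassmannian]]
  show ?thesis by simp
qed

lemma borel_measurable_plane_foot [measurable]:
  "plane_foot \<in> borel_measurable (plane_algebra (affine_grassmannian k))"
  unfolding plane_foot_def[abs_def] by measurable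

text \<open>The transform with values in [0, \<infinity>], at the plane with direction \<eta> and
  foot v. It allows exchanging integrals before anything is known to be integrable.\<close>

definition radon_nn :: "nat \<Rightarrow> ((real^'n) set \<Rightarrow> ennreal) \<Rightarrow> (real^'n) set \<Rightarrow> real^'n \<Rightarrow> ennreal" where
  "radon_nn j F \<eta> v = (\<integral>\<^sup>+\<xi>. (\<integral>\<^sup>+u. F ((+) (u + v) ` \<xi>) \<partial>subspace_lborel \<eta>) \<partial>grassmann_law (\<eta>\<^sup>\<bottom>) j)"

lemma borel_measurable_radon_nn:
  fixes F :: "(real^'n) set \<Rightarrow> ennreal"
  assumes jk: "j + k \<le> CARD('n)" and F [measurable]: "F \<in> borel_measurable (plane_algebra (affine_grassmannian j))"
  shows "(\<lambda>\<zeta>. radon_nn j F (plane_direction \<zeta>) (plane_foot \<zeta>)) \<in> borel_measurable (plane_algebra (affine_grassmannian k))"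
proof -
  let ?A = "plane_algebra (affine_grassmannian k) :: (real^'n) set measure"
  let ?J = "plane_algebra (grassmannian UNIV j) :: (real^'n) set measure"
  \<comment> \<open>The integral over the direction of a k-plane, rewritten as a Gaussian-weighted
    integral over the whole space, where the plane enters only through measurable functions of
    it.\<close>
  let ?G = "\<lambda>p. \<integral>\<^sup>+x. F ((+) (proj (plane_direction (fst p)) x + plane_foot (fst p)) ` snd p)
      * ennreal (gauss (x - proj (plane_direction (fst p)) x)) \<partial>lborel"
  have G: "?G \<in> borel_measurable (?A \<Otimes>\<^sub>M ?J)" by measurable
  have eq: "(\<integral>\<^sup>+u. F ((+) (u + plane_foot (fst p)) ` snd p) \<partial>subspace_lborel (plane_direction (fst p))) = ?G p"
    if p: "p \<in> space (?A \<Otimes>\<^sub>M ?J)" for p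
  proof -
    obtain \<zeta> \<xi> where \<zeta>: "p = (\<zeta>, \<xi>)" "\<zeta> \<in> affine_grassmannian k" "\<xi> \<in> grassmannian UNIV j"
      using p by (auto simp: space_pair_measure)
    obtain \<eta> where \<eta>: "subspace \<eta>" "plane_direction \<zeta> = \<eta>"
      using affine_grassmannianE[OF \<zeta>(2)] grassmannian_subspace by metis
    have [measurable]: "(\<lambda>_. \<xi>) \<in> measurable borel ?J" using \<zeta> by simp
    show ?thesis
      using nn_integral_subspace_lborel_gauss[OF \<eta>(1), of "\<lambda>u. F ((+) (u + plane_foot \<zeta>) ` \<xi>)"]
      by (simp add: \<zeta>(1) \<eta>(2))
  qed
  have kj: "k + j \<le> CARD('n)" using jk by simp
  show ?thesis unfolding radon_nn_def
    using measurable_cong[OF eq, THEN iffD2, OF _ G]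
    by (intro borel_measurable_nn_integral_grassmann_law[OF kj]) simp_all
qed

theorem nn_integral_radon_nn:
  fixes F :: "(real^'n) set \<Rightarrow> ennreal"
  assumes jk: "j + k \<le> CARD('n)" and F [measurable]: "F \<in> borel_measurable (plane_algebra (affine_grassmannian j))"
  shows "(\<integral>\<^sup>+\<zeta>. radon_nn j F (plane_direction \<zeta>) (plane_foot \<zeta>) * indicator {..<a} (norm (plane_foot \<zeta>)) \<partial>affine_law k)
    = (\<integral>\<^sup>+\<xi>. (\<integral>\<^sup>+\<eta>. (\<integral>\<^sup>+x. F ((+) x ` \<xi>) * indicator {..<a} (norm (x - proj \<eta> x)) \<partial>lborel) \<partial>grassmann_law (\<xi>\<^sup>\<bottom>) k) \<partial>grassmann_law UNIV j)"
proof -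
  note [measurable] = borel_measurable_radon_nn[OF jk F]
  let ?R = "\<lambda>\<zeta>. radon_nn j F (plane_direction \<zeta>) (plane_foot \<zeta>) * indicator {..<a} (norm (plane_foot \<zeta>))"
  let ?H = "\<lambda>\<xi> \<eta>. \<integral>\<^sup>+x. F ((+) x ` \<xi>) * indicator {..<a} (norm (x - proj \<eta> x)) \<partial>lborel"
  \<comment> \<open>For a fixed \<eta> the integrals over its complement and over \<eta> itself
    combine into Lebesgue measure, with x = u + v and v = x - proj \<eta> x.\<close>
  have fibre: "(\<integral>\<^sup>+v. ?R ((+) v ` \<eta>) \<partial>subspace_lborel (\<eta>\<^sup>\<bottom>)) = (\<integral>\<^sup>+\<xi>. ?H \<xi> \<eta> \<partial>grassmann_law (\<eta>\<^sup>\<bottom>) j)"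
    if "\<eta> \<in> space (grassmann_law UNIV k)" for \<eta> :: "(real^'n) set"
  proof -
    let ?L = "subspace_lborel \<eta>" and ?L' = "subspace_lborel (\<eta>\<^sup>\<bottom>)" and ?G = "grassmann_law (\<eta>\<^sup>\<bottom>) j"
    have \<eta>: "\<eta> \<in> grassmannian UNIV k" using that by simp
    have s: "subspace \<eta>" using \<eta> by (rule grassmannian_subspace)
    have s': "subspace (\<eta>\<^sup>\<bottom>)" by (rule subspace_orthogonal_comp)
    have d: "j \<le> dim (\<eta>\<^sup>\<bottom>)" using jk dim_orthogonal_comp[OF s] grassmannian_dim[OF \<eta>] by simp
    interpret L: sigma_finite_measure ?L using s by (rule sigma_finite_subspace_lborel)
    interpret L': sigma_finite_measure ?L' using s' by (rule sigma_finite_subspace_lborel)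
    interpret G: prob_space ?G using s' d by (rule prob_space_grassmann_law)
    interpret P: pair_sigma_finite ?G ?L' by standard
    note [measurable] = borel_measurable_proj[OF s]
    have const: "(\<lambda>_. \<xi>) \<in> measurable borel (plane_algebra (grassmannian (\<eta>\<^sup>\<bottom>) j))" if "\<xi> \<in> space ?G" for \<xi>
      using that by simp
    let ?I = "\<lambda>v. indicator {..<a} (norm v) :: ennreal"
    let ?f = "\<lambda>\<xi> v u. F ((+) (u + v) ` \<xi>)"
    have "(\<integral>\<^sup>+v. ?R ((+) v ` \<eta>) \<partial>?L') = (\<integral>\<^sup>+v. (\<integral>\<^sup>+\<xi>. (\<integral>\<^sup>+u. ?f \<xi> v u \<partial>?L) \<partial>?G) * ?I v \<partial>?L')"
      by (intro nn_integral_cong_AE eventually_mono[OF AE_subspace_lborel[OF s']])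
        (simp add: plane_direction_translate[OF s] plane_foot_translate[OF s] radon_nn_def)
    also have "\<dots> = (\<integral>\<^sup>+v. (\<integral>\<^sup>+\<xi>. (\<integral>\<^sup>+u. ?f \<xi> v u * ?I v \<partial>?L) \<partial>?G) \<partial>?L')"
    proof (intro nn_integral_cong)
      fix v :: "real^'n"
      have m: "(\<lambda>\<xi>. \<integral>\<^sup>+u. ?f \<xi> v u \<partial>?L) \<in> borel_measurable ?G"
        by measurable
      have m': "?f \<xi> v \<in> borel_measurable ?L" if "\<xi> \<in> space ?G" for \<xi>
      proof -
        note [measurable] = const[OF that]
        show ?thesis by measurable
      qed
      show "(\<integral>\<^sup>+\<xi>. (\<integral>\<^sup>+u. ?f \<xi> v u \<partial>?L) \<partial>?G) * ?I v = (\<integral>\<^sup>+\<xi>. (\<integral>\<^sup>+u. ?f \<xi> v u * ?I v \<partial>?L) \<partial>?G)"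
        unfolding nn_integral_multc[OF m, symmetric]
        by (intro nn_integral_cong nn_integral_multc[symmetric] m')
    qed
    also have "\<dots> = (\<integral>\<^sup>+\<xi>. (\<integral>\<^sup>+v. (\<integral>\<^sup>+u. ?f \<xi> v u * ?I v \<partial>?L) \<partial>?L') \<partial>?G)"
      by (intro P.Fubini') measurable
    also have "\<dots> = (\<integral>\<^sup>+\<xi>. ?H \<xi> \<eta> \<partial>?G)"
    proof (intro nn_integral_cong)
      fix \<xi> assume "\<xi> \<in> space ?G"
      note [measurable] = const[OF this]
      have "?H \<xi> \<eta> = (\<integral>\<^sup>+v. (\<integral>\<^sup>+u. F ((+) (v + u) ` \<xi>) * ?I ((v + u) - proj \<eta> (v + u)) \<partial>?L) \<partial>?L')"
        using nn_integral_lborel_split[OF s', of "\<lambda>x. F ((+) x ` \<xi>) * ?I (x - proj \<eta> x)"]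
        by (simp add: orthogonal_comp_self[OF s])
      also have "\<dots> = (\<integral>\<^sup>+v. (\<integral>\<^sup>+u. ?f \<xi> v u * ?I v \<partial>?L) \<partial>?L')"
      proof (rule nn_integral_cong_AE, rule eventually_mono[OF AE_subspace_lborel[OF s']])
        fix v assume v: "v \<in> \<eta>\<^sup>\<bottom>"
        show "(\<integral>\<^sup>+u. F ((+) (v + u) ` \<xi>) * ?I ((v + u) - proj \<eta> (v + u)) \<partial>?L) = (\<integral>\<^sup>+u. ?f \<xi> v u * ?I v \<partial>?L)"
          by (intro nn_integral_cong_AE eventually_mono[OF AE_subspace_lborel[OF s]])
            (simp add: proj_add[OF s] proj_zero[OF s v] proj_id[OF s] add.commute)
      qed
      finally show "(\<integral>\<^sup>+v. (\<integral>\<^sup>+u. ?f \<xi> v u * ?I v \<partial>?L) \<partial>?L') = ?H \<xi> \<eta>" ..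
    qed
    finally show ?thesis .
  qed
  have "(\<integral>\<^sup>+\<zeta>. ?R \<zeta> \<partial>affine_law k) = (\<integral>\<^sup>+\<eta>. (\<integral>\<^sup>+v. ?R ((+) v ` \<eta>) \<partial>subspace_lborel (\<eta>\<^sup>\<bottom>)) \<partial>grassmann_law UNIV k)"
    by (intro nn_integral_affine_law) measurable
  also have "\<dots> = (\<integral>\<^sup>+\<eta>. (\<integral>\<^sup>+\<xi>. ?H \<xi> \<eta> \<partial>grassmann_law (\<eta>\<^sup>\<bottom>) j) \<partial>grassmann_law UNIV k)"
    by (intro nn_integral_cong fibre)
  also have "\<dots> = (\<integral>\<^sup>+\<xi>. (\<integral>\<^sup>+\<eta>. ?H \<xi> \<eta> \<partial>grassmann_law (\<xi>\<^sup>\<bottom>) k) \<partial>grassmann_law UNIV j)"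
    by (intro nn_integral_flag_swap[OF jk]) measurable
  finally show ?thesis .
qed

definition tube_prob :: "nat \<Rightarrow> real \<Rightarrow> 'a::euclidean_space set \<Rightarrow> 'a \<Rightarrow> ennreal" where
  "tube_prob k a V u = (\<integral>\<^sup>+\<eta>. indicator {..<a} (norm (u - proj \<eta> u)) \<partial>grassmann_law V k)"

text \<open>Write x = u + y with y in \<xi> and u orthogonal to \<xi>. As \<eta> is orthogonal to
  \<xi>, the squared distance of x from \<eta> is that of u plus |y|^2. So |y| < a, which costs at
  most the factor (2 a)^j, while u is within a of \<eta> and F does not depend on y.\<close>

theorem nn_integral_radon_nn_le:
  fixes F :: "(real^'n) set \<Rightarrow> ennreal"
  assumes jk: "j + k \<le> CARD('n)" and F [measurable]: "F \<in> borel_measurable (plane_algebra (affine_grassmannian j))"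
    and "0 \<le> a"
  shows "(\<integral>\<^sup>+\<zeta>. radon_nn j F (plane_direction \<zeta>) (plane_foot \<zeta>) * indicator {..<a} (norm (plane_foot \<zeta>)) \<partial>affine_law k)
    \<le> (\<integral>\<^sup>+\<xi>. ennreal ((2 * a) ^ j) * (\<integral>\<^sup>+u. F ((+) u ` \<xi>) * tube_prob k a (\<xi>\<^sup>\<bottom>) u \<partial>subspace_lborel (\<xi>\<^sup>\<bottom>)) \<partial>grassmann_law UNIV j)"
  unfolding nn_integral_radon_nn[OF jk F]
proof (rule nn_integral_mono)
  fix \<xi> assume "\<xi> \<in> space (grassmann_law (UNIV :: (real^'n) set) j)"
  then have \<xi>: "\<xi> \<in> grassmannian UNIV j" by simp
  let ?L = "subspace_lborel \<xi>" and ?L' = "subspace_lborel (\<xi>\<^sup>\<bottom>)" and ?G = "grassmann_law (\<xi>\<^sup>\<bottom>) k"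
  let ?I = "\<lambda>\<eta> x. indicator {..<a} (norm (x - proj \<eta> x)) :: ennreal" and ?c = "ennreal ((2 * a) ^ j)"
  have s: "subspace \<xi>" using \<xi> by (rule grassmannian_subspace)
  have s': "subspace (\<xi>\<^sup>\<bottom>)" by (rule subspace_orthogonal_comp)
  have d: "k \<le> dim (\<xi>\<^sup>\<bottom>)" using jk dim_orthogonal_comp[OF s] grassmannian_dim[OF \<xi>] by simp
  interpret L: sigma_finite_measure ?L using s by (rule sigma_finite_subspace_lborel)
  interpret L': sigma_finite_measure ?L' using s' by (rule sigma_finite_subspace_lborel)
  interpret G: prob_space ?G using s' d by (rule prob_space_grassmann_law)
  interpret P: pair_sigma_finite ?G ?L' by standard
  have [measurable]: "(\<lambda>_. \<xi>) \<in> measurable borel (plane_algebra (grassmannian UNIV j))" using \<xi> by simp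
  have slice: "(\<integral>\<^sup>+x. F ((+) x ` \<xi>) * ?I \<eta> x \<partial>lborel) \<le> (\<integral>\<^sup>+u. ?c * (F ((+) u ` \<xi>) * ?I \<eta> u) \<partial>?L')"
    if "\<eta> \<in> space ?G" for \<eta>
  proof -
    have \<eta>: "subspace \<eta>" "\<eta> \<subseteq> \<xi>\<^sup>\<bottom>" using that by (auto simp: grassmannian_def)
    note [measurable] = borel_measurable_proj[OF \<eta>(1)]
    have "(\<integral>\<^sup>+x. F ((+) x ` \<xi>) * ?I \<eta> x \<partial>lborel) = (\<integral>\<^sup>+u. (\<integral>\<^sup>+y. F ((+) (u + y) ` \<xi>) * ?I \<eta> (u + y) \<partial>?L) \<partial>?L')"
      using nn_integral_lborel_split[OF s', of "\<lambda>x. F ((+) x ` \<xi>) * ?I \<eta> x"]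
      by (simp add: orthogonal_comp_self[OF s])
    also have "\<dots> \<le> (\<integral>\<^sup>+u. ?c * (F ((+) u ` \<xi>) * ?I \<eta> u) \<partial>?L')"
    proof (rule nn_integral_mono_AE, rule eventually_mono[OF AE_subspace_lborel[OF s']])
      fix u assume u: "u \<in> \<xi>\<^sup>\<bottom>"
      let ?b = "F ((+) u ` \<xi>) * ?I \<eta> u"
      have "(\<integral>\<^sup>+y. F ((+) (u + y) ` \<xi>) * ?I \<eta> (u + y) \<partial>?L) \<le> (\<integral>\<^sup>+y. ?b * indicator (ball 0 a) y \<partial>?L)"
      proof (rule nn_integral_mono_AE, rule eventually_mono[OF AE_subspace_lborel[OF s]])
        fix y assume y: "y \<in> \<xi>"
        let ?z = "(u + y) - proj \<eta> (u + y)"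
        have "\<xi> \<subseteq> \<eta>\<^sup>\<bottom>" using \<eta>(2) by (metis orthogonal_comp_anti_mono orthogonal_comp_self[OF s])
        then have py: "proj \<eta> y = 0" using y \<eta> by (intro proj_zero) auto
        have "u - proj \<eta> u \<in> \<xi>\<^sup>\<bottom>" using u \<eta> proj_mem[OF \<eta>(1)] by (intro subspace_diff s') auto
        then have "(u - proj \<eta> u) \<bullet> y = 0" using y by (rule orthogonal_compD)
        then have "(norm ?z)\<^sup>2 = (norm (u - proj \<eta> u))\<^sup>2 + (norm y)\<^sup>2"
          using norm_add_Pythagorean[of "u - proj \<eta> u" y] by (simp add: proj_add[OF \<eta>(1)] py orthogonal_def algebra_simps)
        then have "norm (u - proj \<eta> u) \<le> norm ?z" "norm y \<le> norm ?z"
          by (auto intro!: power2_le_imp_le[OF _ norm_ge_zero])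
        then show "F ((+) (u + y) ` \<xi>) * ?I \<eta> (u + y) \<le> ?b * indicator (ball 0 a) y"
          using plane_translate_absorb[OF s y] by (auto split: split_indicator)
      qed
      also have "\<dots> = ?b * emeasure ?L (ball 0 a)" by (intro nn_integral_cmult_indicator) simp
      also have "\<dots> \<le> ?b * ?c"
        using emeasure_subspace_lborel_ball_le[OF s \<open>0 \<le> a\<close>] grassmannian_dim[OF \<xi>] by (intro mult_left_mono) auto
      finally show "(\<integral>\<^sup>+y. F ((+) (u + y) ` \<xi>) * ?I \<eta> (u + y) \<partial>?L) \<le> ?c * ?b" by (simp add: mult.commute)
    qed
    finally show ?thesis .
  qed
  have "(\<integral>\<^sup>+\<eta>. (\<integral>\<^sup>+x. F ((+) x ` \<xi>) * ?I \<eta> x \<partial>lborel) \<partial>?G) \<le> (\<integral>\<^sup>+\<eta>. (\<integral>\<^sup>+u. ?c * (F ((+) u ` \<xi>) * ?I \<eta> u) \<partial>?L') \<partial>?G)"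
    by (intro nn_integral_mono slice)
  also have "\<dots> = (\<integral>\<^sup>+u. (\<integral>\<^sup>+\<eta>. ?c * (F ((+) u ` \<xi>) * ?I \<eta> u) \<partial>?G) \<partial>?L')"
    by (intro P.Fubini'[symmetric]) measurable
  also have "\<dots> = (\<integral>\<^sup>+u. ?c * (F ((+) u ` \<xi>) * tube_prob k a (\<xi>\<^sup>\<bottom>) u) \<partial>?L')"
    unfolding tube_prob_def by (simp add: nn_integral_cmult)
  also have "\<dots> = ?c * (\<integral>\<^sup>+u. F ((+) u ` \<xi>) * tube_prob k a (\<xi>\<^sup>\<bottom>) u \<partial>?L')"
    unfolding tube_prob_def by (intro nn_integral_cmult) measurable
  finally show "(\<integral>\<^sup>+\<eta>. (\<integral>\<^sup>+x. F ((+) x ` \<xi>) * ?I \<eta> x \<partial>lborel) \<partial>?G)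
      \<le> ?c * (\<integral>\<^sup>+u. F ((+) u ` \<xi>) * tube_prob k a (\<xi>\<^sup>\<bottom>) u \<partial>?L')" .
qed

section \<open>Completions\<close>

lemma measurable_completion_AE_eq:
  assumes g: "g \<in> measurable M N" and eq: "AE x in M. f x = g x" and sp: "\<And>x. x \<in> space M \<Longrightarrow> f x \<in> space N"
  shows "f \<in> measurable (completion M) N"
proof (rule measurableI)
  fix A assume A: "A \<in> sets N"
  from eq obtain Z where Z: "Z \<in> null_sets M" "{x \<in> space M. f x \<noteq> g x} \<subseteq> Z"
    by (auto elim: AE_E simp: null_sets_def)
  show "f -` A \<inter> space (completion M) \<in> sets (completion M)"
  proof (rule sets_completionI)
    show "f -` A \<inter> space (completion M) = (g -` A \<inter> space M - Z) \<union> (f -` A \<inter> space M \<inter> Z)"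
      using Z(2) by auto
    show "f -` A \<inter> space M \<inter> Z \<subseteq> Z" by auto
    show "g -` A \<inter> space M - Z \<in> sets M" using measurable_sets[OF g A] Z(1) by auto
  qed fact
qed (use sp in simp)

text \<open>For each set of a countable basis the preimage is measurable up to a null set. The
  countably many null sets are joined, and f is made constant on their union; only second
  countability of the target is used.\<close>

lemma completion_ex_measurable_version:
  fixes f :: "'a \<Rightarrow> 'b::second_countable_topology"
  assumes f: "f \<in> borel_measurable (completion M)"
  obtains g Z where "g \<in> borel_measurable M" "Z \<in> null_sets M" "\<And>x. x \<in> space M - Z \<Longrightarrow> f x = g x"
proof -
  obtain B :: "'b set set" where B: "countable B" "topological_basis B"
    using ex_countable_basis by blast
  have "\<exists>S Z. S \<in> sets M \<and> Z \<in> null_sets M \<and> S \<subseteq> f -` b \<inter> space M \<and> f -` b \<inter> space M \<subseteq> S \<union> Z" if "b \<in> B" for b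
  proof -
    have "f -` b \<inter> space M \<in> sets (completion M)"
      using measurable_sets[OF f, of b] topological_basis_open[OF B(2) that] by simp
    then obtain S N N' where "f -` b \<inter> space M = S \<union> N" "N \<subseteq> N'" "N' \<in> null_sets M" "S \<in> sets M"
      by (rule sets_completionE)
    then show ?thesis by blast
  qed
  then obtain S Z where SZ: "\<And>b. b \<in> B \<Longrightarrow> S b \<in> sets M \<and> Z b \<in> null_sets M \<and> S b \<subseteq> f -` b \<inter> space M \<and> f -` b \<inter> space M \<subseteq> S b \<union> Z b"
    by metis
  define W where "W = (\<Union>b\<in>B. Z b)"
  have W: "W \<in> null_sets M" unfolding W_def using SZ B(1) by (intro null_sets_UN') auto
  define g where "g x = (if x \<in> W then undefined else f x)" for x
  have gb: "g -` b \<inter> space M \<in> sets M" if "b \<in> B" for b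
  proof -
    have "g -` b \<inter> space M = (S b - W) \<union> (if undefined \<in> b then W \<inter> space M else {})"
      using SZ[OF that] that by (auto simp: g_def W_def split: if_splits)
    then show ?thesis using SZ[OF that] W by auto
  qed
  have "g \<in> borel_measurable M"
  proof (rule borel_measurableI)
    fix U :: "'b set" assume "open U"
    then obtain B' where B': "B' \<subseteq> B" "\<Union>B' = U" using B(2) by (auto simp: topological_basis_def)
    have "g -` U \<inter> space M = (\<Union>b\<in>B'. g -` b \<inter> space M)" unfolding B'(2)[symmetric] by auto
    also have "\<dots> \<in> sets M" using B' gb countable_subset[OF B'(1) B(1)] by (intro sets.countable_UN'') auto
    finally show "g -` U \<inter> space M \<in> sets M" .
  qed
  then show thesis using W that[of g W] by (simp add: g_def)
qed

section \<open>Decay of the tube probability\<close>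

lemma borel_measurable_indicator_ball [measurable]:
  "(indicator (ball x r) :: 'a::euclidean_space \<Rightarrow> ennreal) \<in> borel_measurable borel"
  by (intro borel_measurable_indicator borel_open open_ball)

lemma tube_prob_le_1:
  assumes "subspace V" "k \<le> dim V" shows "tube_prob k a V u \<le> 1"
proof -
  interpret prob_space "grassmann_law V k" using assms by (rule prob_space_grassmann_law)
  have "tube_prob k a V u \<le> (\<integral>\<^sup>+\<eta>. 1 \<partial>grassmann_law V k)"
    unfolding tube_prob_def by (intro nn_integral_mono) (auto split: split_indicator)
  then show ?thesis using emeasure_space_1 by simp
qed

lemma tube_prob_scale:
  assumes "0 \<le> t" "t \<le> 1" shows "tube_prob k a V u \<le> tube_prob k a V (t *\<^sub>R u)"
  unfolding tube_prob_def
proof (rule nn_integral_mono)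
  fix \<eta> assume "\<eta> \<in> space (grassmann_law V k)"
  then have "subspace \<eta>" by (simp add: grassmannian_subspace)
  then have "norm (t *\<^sub>R u - proj \<eta> (t *\<^sub>R u)) = t * norm (u - proj \<eta> u)"
    using assms(1) by (simp add: proj_scaleR scaleR_diff_right[symmetric])
  also have "\<dots> \<le> 1 * norm (u - proj \<eta> u)" using assms(2) by (intro mult_right_mono) auto
  finally show "indicator {..<a} (norm (u - proj \<eta> u)) \<le> (indicator {..<a} (norm (t *\<^sub>R u - proj \<eta> (t *\<^sub>R u))) :: ennreal)"
    by (auto split: split_indicator)
qed

lemma tube_prob_minus: "tube_prob k a V (- u) = tube_prob k a V u"
  unfolding tube_prob_def
proof (intro nn_integral_cong)
  fix \<eta> assume "\<eta> \<in> space (grassmann_law V k)"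
  then have "subspace \<eta>" by (simp add: grassmannian_subspace)
  then have "- u - proj \<eta> (- u) = - (u - proj \<eta> u)" using proj_scaleR[of \<eta> "-1" u] by simp
  then show "indicator {..<a} (norm (- u - proj \<eta> (- u))) = (indicator {..<a} (norm (u - proj \<eta> u)) :: ennreal)"
    by (simp only: norm_minus_cancel)
qed

lemma tube_prob_orthogonal_transformation:
  fixes T :: "'a::euclidean_space \<Rightarrow> 'a"
  assumes T: "orthogonal_transformation T" "T ` V = V" and V: "subspace V" "k \<le> dim V"
  shows "tube_prob k a V (T u) = tube_prob k a V u"
proof -
  have "tube_prob k a V (T u) = (\<integral>\<^sup>+\<eta>. indicator {..<a} (norm (T u - proj \<eta> (T u))) \<partial>grassmann_law (T ` V) k)"
    by (simp add: tube_prob_def T(2))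
  also have "\<dots> = (\<integral>\<^sup>+\<eta>. indicator {..<a} (norm (T u - proj (T ` \<eta>) (T u))) \<partial>grassmann_law V k)"
    by (rule nn_integral_grassmann_law_image[OF T(1) V]) measurable
  also have "\<dots> = tube_prob k a V u"
    unfolding tube_prob_def
  proof (intro nn_integral_cong)
    fix \<eta> assume "\<eta> \<in> space (grassmann_law V k)"
    then have "subspace \<eta>" by (simp add: grassmannian_subspace)
    then have "T u - proj (T ` \<eta>) (T u) = T (u - proj \<eta> u)"
      by (simp add: proj_image[OF T(1)] linear_diff[OF orthogonal_transformation_linear[OF T(1)]])
    then show "indicator {..<a} (norm (T u - proj (T ` \<eta>) (T u))) = (indicator {..<a} (norm (u - proj \<eta> u)) :: ennreal)"
      by (simp add: orthogonal_transformation_norm[OF T(1)])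
  qed
  finally show ?thesis .
qed

text \<open>Shrinking u to the norm of v can only increase the value, because distances to subspaces
  scale. An orthogonal map preserving V then takes the line of the shrunk vector to that of v, hence
  the vector to v or -v, and the sign does not matter.\<close>

lemma tube_prob_antimono:
  assumes V: "subspace V" "k \<le> dim V" and uv: "u \<in> V" "v \<in> V" "norm v \<le> norm u"
  shows "tube_prob k a V u \<le> tube_prob k a V v"
proof (cases "v = 0")
  case True
  then show ?thesis using tube_prob_scale[of 0 k a V u] by simp
next
  case False
  then have "u \<noteq> 0" using uv by auto
  define t where "t = norm v / norm u"
  have t: "0 < t" "t \<le> 1" using False \<open>u \<noteq> 0\<close> uv by (auto simp: t_def)
  define w where "w = t *\<^sub>R u"
  have w: "w \<in> V" "norm w = norm v" "w \<noteq> 0"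
    using V uv t \<open>u \<noteq> 0\<close> False by (auto simp: w_def t_def subspace_scale)
  have "V\<^sup>\<bottom>\<^sup>\<bottom> = V" using V(1) by (rule orthogonal_comp_self)
  then have sub: "span {w} \<subseteq> V\<^sup>\<bottom>\<^sup>\<bottom>" "span {v} \<subseteq> V\<^sup>\<bottom>\<^sup>\<bottom>"
    using span_minimal[of "{w}" V] span_minimal[of "{v}" V] w uv V by simp_all
  have dim: "dim (span {w}) = dim (span {v})" using w False by simp
  obtain T where T: "orthogonal_transformation T" "T ` span {w} = span {v}" "T ` (V\<^sup>\<bottom>) = V\<^sup>\<bottom>"
    by (rule orthogonal_flag_transitive[OF subspace_span subspace_span dim subspace_orthogonal_comp subspace_orthogonal_comp refl sub])
  have TV: "T ` V = V" using orthogonal_comp_image[OF T(1), of "V\<^sup>\<bottom>"] T(3) \<open>V\<^sup>\<bottom>\<^sup>\<bottom> = V\<close> by simp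
  have "T w \<in> span {v}" using T(2) by (metis imageI insertI1 span_base)
  then obtain c where c: "T w = c *\<^sub>R v" by (auto simp: span_singleton)
  have "norm (T w) = norm v" using orthogonal_transformation_norm[OF T(1), of w] w by simp
  then have "\<bar>c\<bar> = 1" using c False by simp
  then have "T w = v \<or> T w = - v" using c by (auto simp: abs_if split: if_splits)
  then have "tube_prob k a V (T w) = tube_prob k a V v" by (auto simp: tube_prob_minus)
  moreover have "tube_prob k a V (T w) = tube_prob k a V w"
    by (rule tube_prob_orthogonal_transformation[OF T(1) TV V])
  moreover have "tube_prob k a V u \<le> tube_prob k a V w" unfolding w_def using t by (intro tube_prob_scale) auto
  ultimately show ?thesis by simp
qed

text \<open>As \<open>tube_prob\<close> is radially decreasing, its value at \<open>u\<close> is at most its mean over the ball of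
  radius \<open>norm u\<close>, which Fubini evaluates as the average volume of the tubes about \<open>k\<close>-planes.\<close>

lemma tube_prob_mult_ball_le:
  fixes V :: "'a::euclidean_space set"
  assumes V: "subspace V" "k \<le> dim V" and u: "u \<in> V" and "0 \<le> a"
  shows "tube_prob k a V u * emeasure (subspace_lborel V) (ball 0 (norm u)) \<le> ennreal ((2 * norm u) ^ k * (2 * a) ^ (dim V - k))"
proof -
  let ?R = "norm u"
  interpret L: sigma_finite_measure "subspace_lborel V" using V(1) by (rule sigma_finite_subspace_lborel)
  interpret G: prob_space "grassmann_law V k" using V by (rule prob_space_grassmann_law)
  interpret P: pair_sigma_finite "grassmann_law V k" "subspace_lborel V" by standard
  have "tube_prob k a V u * emeasure (subspace_lborel V) (ball 0 ?R) = (\<integral>\<^sup>+v. tube_prob k a V u * indicator (ball 0 ?R) v \<partial>subspace_lborel V)"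
    by (subst nn_integral_cmult_indicator) simp_all
  also have "\<dots> \<le> (\<integral>\<^sup>+v. tube_prob k a V v * indicator (ball 0 ?R) v \<partial>subspace_lborel V)"
    by (intro nn_integral_mono_AE eventually_mono[OF AE_subspace_lborel[OF V(1)]])
      (auto intro!: tube_prob_antimono[OF V u] split: split_indicator)
  also have "\<dots> = (\<integral>\<^sup>+v. (\<integral>\<^sup>+\<eta>. indicator {..<a} (norm (v - proj \<eta> v)) * indicator {..<?R} (norm v) \<partial>grassmann_law V k) \<partial>subspace_lborel V)"
  proof (intro nn_integral_cong)
    fix v :: 'a
    have "indicator (ball 0 ?R) v = (indicator {..<?R} (norm v) :: ennreal)" by (auto split: split_indicator)
    then show "tube_prob k a V v * indicator (ball 0 ?R) v = (\<integral>\<^sup>+\<eta>. indicator {..<a} (norm (v - proj \<eta> v)) * indicator {..<?R} (norm v) \<partial>grassmann_law V k)"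
      unfolding tube_prob_def by (simp add: nn_integral_multc)
  qed
  also have "\<dots> = (\<integral>\<^sup>+\<eta>. (\<integral>\<^sup>+v. indicator {..<a} (norm (v - proj \<eta> v)) * indicator {..<?R} (norm v) \<partial>subspace_lborel V) \<partial>grassmann_law V k)"
    by (intro P.Fubini') measurable
  also have "\<dots> \<le> (\<integral>\<^sup>+\<eta>. ennreal ((2 * ?R) ^ k * (2 * a) ^ (dim V - k)) \<partial>grassmann_law V k)"
  proof (rule nn_integral_mono)
    fix \<eta> assume "\<eta> \<in> space (grassmann_law V k)"
    then have \<eta>: "subspace \<eta>" "\<eta> \<subseteq> V" "dim \<eta> = k" by (auto simp: grassmannian_def)
    note [measurable] = borel_measurable_proj[OF \<eta>(1)]
    let ?W = "V \<inter> \<eta>\<^sup>\<bottom>"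
    have W: "subspace ?W" using V by (simp add: subspace_inter subspace_orthogonal_comp)
    have dW: "dim ?W = dim V - k"
    proof -
      have "{y \<in> V. \<forall>x\<in>\<eta>. orthogonal x y} = ?W" by (auto simp: orthogonal_comp_def)
      with dim_subspace_orthogonal_to_vectors[OF \<eta>(1) V(1) \<eta>(2)] \<eta>(3) show ?thesis by simp
    qed
    have "(\<integral>\<^sup>+v. indicator {..<a} (norm (v - proj \<eta> v)) * indicator {..<?R} (norm v) \<partial>subspace_lborel V)
        = (\<integral>\<^sup>+y. (\<integral>\<^sup>+z. indicator {..<a} (norm ((y + z) - proj \<eta> (y + z))) * indicator {..<?R} (norm (y + z)) \<partial>subspace_lborel ?W) \<partial>subspace_lborel \<eta>)"
      by (intro nn_integral_subspace_lborel_split \<eta> V) measurable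
    \<comment> \<open>In the coordinates y along \<eta> and z in its complement within V, the
      truncated tube lies in the product of a ball of radius |u| and a ball of radius a.\<close>
    also have "\<dots> \<le> (\<integral>\<^sup>+y. (\<integral>\<^sup>+z. indicator (ball 0 ?R) y * indicator (ball 0 a) z \<partial>subspace_lborel ?W) \<partial>subspace_lborel \<eta>)"
    proof (rule nn_integral_mono_AE, rule eventually_mono[OF AE_subspace_lborel[OF \<eta>(1)]])
      fix y assume y: "y \<in> \<eta>"
      show "(\<integral>\<^sup>+z. indicator {..<a} (norm ((y + z) - proj \<eta> (y + z))) * indicator {..<?R} (norm (y + z)) \<partial>subspace_lborel ?W)
          \<le> (\<integral>\<^sup>+z. indicator (ball 0 ?R) y * indicator (ball 0 a) z \<partial>subspace_lborel ?W)"
      proof (rule nn_integral_mono_AE, rule eventually_mono[OF AE_subspace_lborel[OF W]])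
        fix z assume z: "z \<in> ?W"
        have p: "proj \<eta> (y + z) = y" using y z by (simp add: proj_add[OF \<eta>(1)] proj_id[OF \<eta>(1)] proj_zero[OF \<eta>(1)])
        then have "norm y \<le> norm (y + z)" using norm_proj_le[OF \<eta>(1), of "y + z"] by simp
        then show "indicator {..<a} (norm ((y + z) - proj \<eta> (y + z))) * indicator {..<?R} (norm (y + z))
            \<le> (indicator (ball 0 ?R) y * indicator (ball 0 a) z :: ennreal)"
          unfolding p by (auto split: split_indicator)
      qed
    qed
    also have "\<dots> = emeasure (subspace_lborel \<eta>) (ball 0 ?R) * emeasure (subspace_lborel ?W) (ball 0 a)"
      by (simp add: nn_integral_cmult_indicator nn_integral_multc)
    also have "\<dots> \<le> ennreal ((2 * ?R) ^ k) * ennreal ((2 * a) ^ (dim V - k))"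
      using emeasure_subspace_lborel_ball_le[OF \<eta>(1), of ?R] emeasure_subspace_lborel_ball_le[OF W \<open>0 \<le> a\<close>] \<eta>(3) dW
      by (intro mult_mono) auto
    also have "\<dots> = ennreal ((2 * ?R) ^ k * (2 * a) ^ (dim V - k))"
      using \<open>0 \<le> a\<close> by (simp add: ennreal_mult)
    finally show "(\<integral>\<^sup>+v. indicator {..<a} (norm (v - proj \<eta> v)) * indicator {..<?R} (norm v) \<partial>subspace_lborel V)
        \<le> ennreal ((2 * ?R) ^ k * (2 * a) ^ (dim V - k))" .
  qed
  also have "\<dots> = ennreal ((2 * ?R) ^ k * (2 * a) ^ (dim V - k))"
    using G.emeasure_space_1 by simp
  finally show ?thesis .
qed

text \<open>The preceding bound is divided by the cube bound (2 |u| / m)^m for the ball, where m =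
  dim V. Of the powers of |u| there remains |u|^(k - m); the other factors form the
  constant.\<close>

lemma tube_prob_decay:
  assumes V: "subspace V" "k \<le> dim V" "0 < dim V" and u: "u \<in> V" "u \<noteq> 0" and "0 \<le> a"
  shows "tube_prob k a V u \<le> ennreal (2 ^ k * (2 * a) ^ (dim V - k) * (dim V / 2) ^ dim V / norm u ^ (dim V - k))"
proof -
  let ?m = "dim V" and ?R = "norm u"
  have R: "0 < ?R" using u by simp
  obtain t where t: "tube_prob k a V u = ennreal t" "0 \<le> t"
    using tube_prob_le_1[OF V(1,2), of a u] by (cases "tube_prob k a V u") (auto simp: top_unique)
  have "ennreal t * ennreal ((2 * ?R / ?m) ^ ?m) \<le> ennreal t * emeasure (subspace_lborel V) (ball 0 ?R)"
    by (rule mult_left_mono[OF emeasure_subspace_lborel_ball_ge[OF V(1) R V(3)] zero_le])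
  also have "\<dots> \<le> ennreal ((2 * ?R) ^ k * (2 * a) ^ (?m - k))"
    using tube_prob_mult_ball_le[OF V(1,2) u(1) \<open>0 \<le> a\<close>] unfolding t(1) .
  finally have "ennreal t * ennreal ((2 * ?R / ?m) ^ ?m) \<le> ennreal ((2 * ?R) ^ k * (2 * a) ^ (?m - k))" .
  then have "ennreal (t * (2 * ?R / ?m) ^ ?m) \<le> ennreal ((2 * ?R) ^ k * (2 * a) ^ (?m - k))"
    using t R by (simp add: ennreal_mult)
  then have "t * (2 * ?R / ?m) ^ ?m \<le> (2 * ?R) ^ k * (2 * a) ^ (?m - k)"
    using \<open>0 \<le> a\<close> by (subst (asm) ennreal_le_iff) auto
  then have "t \<le> (2 * ?R) ^ k * (2 * a) ^ (?m - k) / (2 * ?R / ?m) ^ ?m"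
    using R V(3) by (simp add: pos_le_divide_eq del: dim_eq_0)
  also have "\<dots> = 2 ^ k * (2 * a) ^ (?m - k) * (?m / 2) ^ ?m / ?R ^ (?m - k)"
  proof -
    have "?R ^ ?m = ?R ^ k * ?R ^ (?m - k)" using V(2) by (simp add: power_add[symmetric])
    then have 1: "(2 * ?R / ?m) ^ ?m = ?R ^ k * ?R ^ (?m - k) * (2 / ?m) ^ ?m"
      by (simp add: power_mult_distrib power_divide)
    have 2: "(real ?m / 2) ^ ?m = 1 / (2 / ?m) ^ ?m" by (simp add: power_divide)
    have 3: "p * r * A / (r * s * X) = p * A * (1 / X) / s" if "r \<noteq> 0" for p r A s X :: real
      using that by simp
    show ?thesis unfolding 1 2 power_mult_distrib[of 2 ?R k] using R by (intro 3) simp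
  qed
  finally show ?thesis unfolding t(1) by (intro ennreal_leI)
qed

text \<open>For \<beta> > 1, the value 0 collects all r < 1, and the value i + 1 means \<beta>^i
  \<le> r < \<beta>^(i + 1). Functions of the shell turn radial integrals into series and replace
  polar coordinates.\<close>

definition shell :: "real \<Rightarrow> real \<Rightarrow> nat" where
  "shell \<beta> r = (LEAST i. r < \<beta> ^ i)"

lemma measurable_shell [measurable]: "shell \<beta> \<in> measurable borel (count_space UNIV)"
  unfolding shell_def[abs_def] by measurable

lemma less_power_shell: assumes "1 < \<beta>" shows "r < \<beta> ^ shell \<beta> r"
  unfolding shell_def using real_arch_pow[OF assms, of r] by (rule LeastI_ex)

lemma shell_le: "r < \<beta> ^ i \<Longrightarrow> shell \<beta> r \<le> i"
  unfolding shell_def by (rule Least_le)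

lemma power_le_of_shell_Suc: "shell \<beta> r = Suc i \<Longrightarrow> \<beta> ^ i \<le> r"
  using shell_le[of r \<beta> i] by linarith

text \<open>Each shell is enlarged to the ball that contains it. With geometrically growing radii
  this does not change the order of magnitude of the volumes.\<close>

lemma nn_integral_shell_le:
  fixes c :: "nat \<Rightarrow> ennreal" and V :: "'a::euclidean_space set"
  assumes V: "subspace V" and "1 < \<beta>"
  shows "(\<integral>\<^sup>+u. c (shell \<beta> (norm u)) \<partial>subspace_lborel V) \<le> (\<Sum>i. c i * ennreal ((2 * \<beta> ^ i) ^ dim V))"
proof -
  have "c (shell \<beta> (norm u)) \<le> (\<Sum>i. c i * indicator (ball 0 (\<beta> ^ i)) u)" for u :: 'a
  proof -
    let ?s = "shell \<beta> (norm u)"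
    have "c ?s = (\<Sum>i\<in>{?s}. c i * indicator (ball 0 (\<beta> ^ i)) u)"
      using less_power_shell[OF \<open>1 < \<beta>\<close>, of "norm u"] by simp
    also have "\<dots> \<le> (\<Sum>i. c i * indicator (ball 0 (\<beta> ^ i)) u)" by (intro sum_le_suminf) auto
    finally show ?thesis .
  qed
  then have "(\<integral>\<^sup>+u. c (shell \<beta> (norm u)) \<partial>subspace_lborel V) \<le> (\<integral>\<^sup>+u. (\<Sum>i. c i * indicator (ball 0 (\<beta> ^ i)) u) \<partial>subspace_lborel V)"
    by (intro nn_integral_mono)
  also have "\<dots> = (\<Sum>i. c i * emeasure (subspace_lborel V) (ball 0 (\<beta> ^ i)))"
    by (subst nn_integral_suminf) (simp_all add: nn_integral_cmult_indicator)
  also have "\<dots> \<le> (\<Sum>i. c i * ennreal ((2 * \<beta> ^ i) ^ dim V))"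
    using \<open>1 < \<beta>\<close> by (intro suminf_le mult_left_mono emeasure_subspace_lborel_ball_le[OF V]) auto
  finally show ?thesis .
qed

text \<open>The bound is uniform in V, because it is later integrated over all directions \<xi> with
  V the complement of \<xi>.\<close>

lemma nn_integral_tube_prob_powr_bound:
  assumes k: "k < m" and "0 \<le> a" and q: "0 < q" "real m < real (m - k) * q"
  obtains K where "K < \<infinity>" "\<And>V :: 'a::euclidean_space set. subspace V \<Longrightarrow> dim V = m \<Longrightarrow>
    (\<integral>\<^sup>+u. ennreal (enn2real (tube_prob k a V u) powr q) \<partial>subspace_lborel V) \<le> K"
proof
  define D where "D = 2 ^ k * (2 * a) ^ (m - k) * (real m / 2) ^ m"
  \<comment> \<open>Shell 0, where the decay estimate is useless, gets the trivial bound 1; on shell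
    l + 1 the norm is at least 2^l.\<close>
  define t where "t i = (case i of 0 \<Rightarrow> 1 | Suc l \<Rightarrow> D / (2 ^ l) ^ (m - k))" for i :: nat
  have D: "0 \<le> D" using \<open>0 \<le> a\<close> by (simp add: D_def)
  have t: "0 \<le> t i" for i using D by (simp add: t_def split: nat.split)
  let ?K = "\<Sum>i. ennreal (t i powr q) * ennreal ((2 * 2 ^ i) ^ m)"
  show "?K < \<infinity>"
  proof -
    \<comment> \<open>The ratio of a geometric series: volumes grow like 2^(m l), while the q-th
      powers of the bounds decay like 2^(-(m - k) q l).\<close>
    define \<rho> where "\<rho> = 2 powr (real m - real (m - k) * q)"
    have \<rho>: "0 < \<rho>" "\<rho> < 1" using q powr_less_mono[of "real m - real (m - k) * q" 0 2] by (simp_all add: \<rho>_def del: of_nat_diff)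
    have "t (Suc l) powr q * (2 * 2 ^ Suc l) ^ m = D powr q * 4 ^ m * \<rho> ^ l" for l
    proof -
      have "t (Suc l) = D / 2 powr (real l * real (m - k))"
        by (simp add: t_def powr_realpow[symmetric] powr_powr)
      then have "t (Suc l) powr q = D powr q / 2 powr (real l * real (m - k) * q)"
        using D by (simp add: powr_divide powr_powr)
      moreover have "(2 * 2 ^ Suc l :: real) ^ m = 4 ^ m * 2 powr (real l * real m)"
      proof -
        have "(2 * 2 ^ Suc l :: real) = 4 * 2 ^ l" by simp
        then have "(2 * 2 ^ Suc l :: real) ^ m = 4 ^ m * 2 ^ (l * m)"
          by (simp only: power_mult_distrib power_mult)
        then show ?thesis by (simp add: powr_realpow[symmetric])
      qed
      moreover have "\<rho> ^ l = 2 powr (real l * real m) / 2 powr (real l * real (m - k) * q)"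
      proof -
        have "\<rho> ^ l = \<rho> powr real l" using \<rho> by (simp add: powr_realpow)
        also have "\<dots> = 2 powr (real l * real m - real l * real (m - k) * q)"
          by (simp add: \<rho>_def powr_powr algebra_simps)
        finally show ?thesis by (simp add: powr_diff)
      qed
      ultimately show ?thesis by simp
    qed
    then have eq: "(\<lambda>l. t (Suc l) powr q * (2 * 2 ^ Suc l) ^ m) = (\<lambda>l. D powr q * 4 ^ m * \<rho> ^ l)"
      by (rule ext)
    have "summable (\<lambda>l. t (Suc l) powr q * (2 * 2 ^ Suc l) ^ m)"
      unfolding eq using \<rho> by (intro summable_mult summable_geometric) simp
    then have "summable (\<lambda>i. t i powr q * (2 * 2 ^ i) ^ m)"
      by (rule summable_Suc_iff[THEN iffD1])
    then have "(\<Sum>i. ennreal (t i powr q * (2 * 2 ^ i) ^ m)) \<noteq> \<infinity>"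
      unfolding infinity_ennreal_def by (intro ennreal_suminf_neq_top) auto
    then show ?thesis by (simp add: ennreal_mult less_top)
  qed
  fix V :: "'a set" assume V: "subspace V" "dim V = m"
  have "(\<integral>\<^sup>+u. ennreal (enn2real (tube_prob k a V u) powr q) \<partial>subspace_lborel V)
      \<le> (\<integral>\<^sup>+u. ennreal (t (shell 2 (norm u)) powr q) \<partial>subspace_lborel V)"
  proof (rule nn_integral_mono_AE, rule eventually_mono[OF AE_subspace_lborel[OF V(1)]])
    fix u assume u: "u \<in> V"
    have "tube_prob k a V u \<le> ennreal (t (shell 2 (norm u)))"
    proof (cases "shell 2 (norm u)")
      case 0
      then show ?thesis using tube_prob_le_1[OF V(1), of k a u] V k by (simp add: t_def)
    next
      case (Suc l)
      then have l: "2 ^ l \<le> norm u" by (rule power_le_of_shell_Suc)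
      then have "0 < norm u" by (rule less_le_trans[rotated]) simp
      then have "u \<noteq> 0" by simp
      have "tube_prob k a V u \<le> ennreal (D / norm u ^ (m - k))"
        using tube_prob_decay[OF V(1) _ _ u \<open>u \<noteq> 0\<close> \<open>0 \<le> a\<close>, of k] k unfolding D_def V(2) by simp
      also have "\<dots> \<le> ennreal (D / (2 ^ l) ^ (m - k))"
        using D l by (intro ennreal_leI divide_left_mono power_mono mult_pos_pos zero_less_power \<open>0 < norm u\<close>) auto
      finally show ?thesis by (simp add: t_def Suc)
    qed
    then have "enn2real (tube_prob k a V u) \<le> t (shell 2 (norm u))"
      using t by (intro enn2real_leI)
    then show "ennreal (enn2real (tube_prob k a V u) powr q) \<le> ennreal (t (shell 2 (norm u)) powr q)"
      using q by (intro ennreal_leI powr_mono2) auto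
  qed
  also have "\<dots> \<le> (\<Sum>i. ennreal (t i powr q) * ennreal ((2 * 2 ^ i) ^ dim V))"
    by (rule nn_integral_shell_le[OF V(1), of 2 "\<lambda>i. ennreal (t i powr q)"]) simp
  finally show "(\<integral>\<^sup>+u. ennreal (enn2real (tube_prob k a V u) powr q) \<partial>subspace_lborel V) \<le> ?K"
    by (simp add: V(2))
qed

section \<open>Finiteness below the critical exponent\<close>

text \<open>Young's inequality splits the integrand of the dual estimate into g^r, whose integral is
  finite by assumption, and a power of \<open>tube_prob\<close> whose integral over each complement
  is at most K. The directions carry a probability measure, so K survives the last integration
  unchanged.\<close>

lemma nn_integral_radon_nn_finite:
  fixes g :: "(real^'n) set \<Rightarrow> real"
  assumes jk: "j + k < CARD('n)" "0 < k" and r: "1 \<le> r" "r < (real CARD('n) - real j) / real k" and "0 \<le> a"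
    and [measurable]: "g \<in> borel_measurable (plane_algebra (affine_grassmannian j))"
    and g: "\<And>\<tau>. 0 \<le> g \<tau>" "(\<integral>\<^sup>+\<tau>. ennreal (g \<tau> powr r) \<partial>affine_law j) < \<infinity>"
  shows "(\<integral>\<^sup>+\<zeta>. radon_nn j (\<lambda>\<tau>. ennreal (g \<tau>)) (plane_direction \<zeta>) (plane_foot \<zeta>)
    * indicator {..<a} (norm (plane_foot \<zeta>)) \<partial>affine_law k) < \<infinity>"
proof -
  let ?m = "CARD('n) - j"
  have m: "k < ?m" "real ?m = real CARD('n) - real j" using jk by auto
  \<comment> \<open>For r = 1 the conjugate exponent is infinite; the entry 0 records that the bound
    of \<open>tube_prob\<close> by 1 then suffices alone.\<close>
  obtain K where K: "K < \<infinity>" "\<And>V :: (real^'n) set. subspace V \<Longrightarrow> dim V = ?m \<Longrightarrow>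
      (\<integral>\<^sup>+u. (if r = 1 then 0 else ennreal (enn2real (tube_prob k a V u) powr (r / (r - 1)))) \<partial>subspace_lborel V) \<le> K"
  proof (cases "r = 1")
    case True
    then show thesis by (intro that[of 0]) auto
  next
    case False
    then have r1: "1 < r" using r by simp
    \<comment> \<open>For r > 1 and m = n - j, the condition k r < m is equivalent to m < (m - k) r
      / (r - 1), the requirement for integrability of the conjugate power.\<close>
    have "real k * r < real ?m" using r(2) jk m(2) by (simp add: pos_less_divide_eq mult.commute)
    then have "real ?m * (r - 1) < (real ?m - real k) * r" by (simp add: algebra_simps)
    moreover have "real ?m - real k = real (?m - k)" using m(1) by (simp only: of_nat_diff less_imp_le)
    ultimately have "real ?m * (r - 1) < real (?m - k) * r" by (simp only:)
    then have qm: "real ?m < real (?m - k) * (r / (r - 1))"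
      using r1 by (simp only: times_divide_eq_right pos_less_divide_eq diff_gt_0_iff_gt)
    have q0: "0 < r / (r - 1)" using r1 by simp
    show thesis
    proof (rule nn_integral_tube_prob_powr_bound[OF m(1) \<open>0 \<le> a\<close> q0 qm, where 'a="real^'n"])
      fix K assume "K < \<infinity>" and "\<And>V :: (real^'n) set. subspace V \<Longrightarrow> dim V = ?m \<Longrightarrow>
        (\<integral>\<^sup>+u. ennreal (enn2real (tube_prob k a V u) powr (r / (r - 1))) \<partial>subspace_lborel V) \<le> K"
      then show thesis using False by (intro that[of K]) simp_all
    qed
  qed
  let ?h = "\<lambda>V u. if r = 1 then 0 else ennreal (enn2real (tube_prob k a V u) powr (r / (r - 1)))"
  let ?c = "ennreal ((2 * a) ^ j)"
  have young: "ennreal (g \<tau>) * tube_prob k a V u \<le> ennreal (g \<tau> powr r) + ?h V u"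
    if V: "subspace V" "k \<le> dim V" for \<tau> V and u :: "real^'n"
  proof -
    define t where "t = enn2real (tube_prob k a V u)"
    have le: "tube_prob k a V u \<le> 1" using V by (rule tube_prob_le_1)
    then have t: "tube_prob k a V u = ennreal t" "0 \<le> t" "t \<le> 1"
      by (auto simp: t_def enn2real_leI intro!: ennreal_enn2real[symmetric] le_less_trans[OF le])
    show ?thesis
    proof (cases "r = 1")
      case True
      have "ennreal (g \<tau>) * ennreal t \<le> ennreal (g \<tau>) * 1" using t by (intro mult_left_mono) auto
      then show ?thesis using True t g(1)[of \<tau>] by simp
    next
      case False
      then have r1: "1 < r" using r by simp
      let ?q = "r / (r - 1)"
      have q: "1 < ?q" "1 / r + 1 / ?q = 1" using r1 by (auto simp: field_simps)
      have "g \<tau> * t \<le> g \<tau> powr r / r + t powr ?q / ?q"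
        using Youngs_inequality[OF r1 q] g(1)[of \<tau>] t by simp
      also have "\<dots> \<le> g \<tau> powr r + t powr ?q"
      proof (rule add_mono)
        have "x / c \<le> x" if "0 \<le> x" "1 < c" for x c :: real
          using that by (simp add: divide_le_eq mult_le_cancel_left1)
        from this[OF powr_ge_zero r1] this[OF powr_ge_zero q(1)]
        show "g \<tau> powr r / r \<le> g \<tau> powr r" "t powr ?q / ?q \<le> t powr ?q" .
      qed
      finally have "ennreal (g \<tau> * t) \<le> ennreal (g \<tau> powr r + t powr ?q)" by (rule ennreal_leI)
      moreover have "ennreal (g \<tau>) * tube_prob k a V u = ennreal (g \<tau> * t)"
        by (simp only: t(1) ennreal_mult[OF g(1) t(2)])
      moreover have "ennreal (g \<tau> powr r + t powr ?q) = ennreal (g \<tau> powr r) + ?h V u"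
        using False by (simp only: t_def if_False ennreal_plus[OF powr_ge_zero powr_ge_zero])
      ultimately show ?thesis by (simp only:)
    qed
  qed
  have prob: "prob_space (grassmann_law (UNIV :: (real^'n) set) j)"
    using jk by (intro prob_space_grassmann_law) auto
  have "(\<integral>\<^sup>+\<zeta>. radon_nn j (\<lambda>\<tau>. ennreal (g \<tau>)) (plane_direction \<zeta>) (plane_foot \<zeta>) * indicator {..<a} (norm (plane_foot \<zeta>)) \<partial>affine_law k)
      \<le> (\<integral>\<^sup>+\<xi>. ?c * (\<integral>\<^sup>+u. ennreal (g ((+) u ` \<xi>)) * tube_prob k a (\<xi>\<^sup>\<bottom>) u \<partial>subspace_lborel (\<xi>\<^sup>\<bottom>)) \<partial>grassmann_law UNIV j)"
    using jk \<open>0 \<le> a\<close> by (intro nn_integral_radon_nn_le) auto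
  also have "\<dots> \<le> (\<integral>\<^sup>+\<xi>. ?c * ((\<integral>\<^sup>+u. ennreal (g ((+) u ` \<xi>) powr r) \<partial>subspace_lborel (\<xi>\<^sup>\<bottom>)) + K) \<partial>grassmann_law UNIV j)"
  proof (intro nn_integral_mono mult_left_mono)
    fix \<xi> assume "\<xi> \<in> space (grassmann_law (UNIV :: (real^'n) set) j)"
    then have \<xi>: "\<xi> \<in> grassmannian UNIV j" by simp
    have s: "subspace \<xi>" using \<xi> by (rule grassmannian_subspace)
    have s': "subspace (\<xi>\<^sup>\<bottom>)" by (rule subspace_orthogonal_comp)
    have d: "dim (\<xi>\<^sup>\<bottom>) = ?m" using dim_orthogonal_comp[OF s] grassmannian_dim[OF \<xi>] by simp
    have [measurable]: "(\<lambda>_. \<xi>) \<in> measurable borel (plane_algebra (grassmannian UNIV j))" using \<xi> by simp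
    have "(\<integral>\<^sup>+u. ennreal (g ((+) u ` \<xi>)) * tube_prob k a (\<xi>\<^sup>\<bottom>) u \<partial>subspace_lborel (\<xi>\<^sup>\<bottom>))
        \<le> (\<integral>\<^sup>+u. ennreal (g ((+) u ` \<xi>) powr r) + ?h (\<xi>\<^sup>\<bottom>) u \<partial>subspace_lborel (\<xi>\<^sup>\<bottom>))"
      using m d by (intro nn_integral_mono young[OF s']) simp
    also have "\<dots> = (\<integral>\<^sup>+u. ennreal (g ((+) u ` \<xi>) powr r) \<partial>subspace_lborel (\<xi>\<^sup>\<bottom>)) + (\<integral>\<^sup>+u. ?h (\<xi>\<^sup>\<bottom>) u \<partial>subspace_lborel (\<xi>\<^sup>\<bottom>))"
    proof (rule nn_integral_add)
      interpret G: prob_space "grassmann_law (\<xi>\<^sup>\<bottom>) k" using s' m d by (intro prob_space_grassmann_law) auto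
      have "(\<lambda>u. tube_prob k a (\<xi>\<^sup>\<bottom>) u) \<in> borel_measurable (subspace_lborel (\<xi>\<^sup>\<bottom>))"
        unfolding tube_prob_def by measurable
      then show "?h (\<xi>\<^sup>\<bottom>) \<in> borel_measurable (subspace_lborel (\<xi>\<^sup>\<bottom>))" by measurable
    qed measurable
    also have "\<dots> \<le> (\<integral>\<^sup>+u. ennreal (g ((+) u ` \<xi>) powr r) \<partial>subspace_lborel (\<xi>\<^sup>\<bottom>)) + K"
      using K(2)[OF s' d] by (intro add_left_mono) auto
    finally show "(\<integral>\<^sup>+u. ennreal (g ((+) u ` \<xi>)) * tube_prob k a (\<xi>\<^sup>\<bottom>) u \<partial>subspace_lborel (\<xi>\<^sup>\<bottom>))
        \<le> (\<integral>\<^sup>+u. ennreal (g ((+) u ` \<xi>) powr r) \<partial>subspace_lborel (\<xi>\<^sup>\<bottom>)) + K" .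
  qed simp
  also have "\<dots> = ?c * ((\<integral>\<^sup>+\<tau>. ennreal (g \<tau> powr r) \<partial>affine_law j) + K)"
  proof -
    have [measurable]: "(\<lambda>\<xi>. \<integral>\<^sup>+u. ennreal (g ((+) u ` \<xi>) powr r) \<partial>subspace_lborel (\<xi>\<^sup>\<bottom>)) \<in> borel_measurable (plane_algebra (grassmannian UNIV j))"
      by (intro borel_measurable_nn_integral_orthogonal_comp) measurable
    have "(\<integral>\<^sup>+\<xi>. K \<partial>grassmann_law (UNIV :: (real^'n) set) j) = K"
      using prob_space.emeasure_space_1[OF prob] by simp
    moreover have "(\<integral>\<^sup>+\<tau>. ennreal (g \<tau> powr r) \<partial>affine_law j)
        = (\<integral>\<^sup>+\<xi>. (\<integral>\<^sup>+u. ennreal (g ((+) u ` \<xi>) powr r) \<partial>subspace_lborel (\<xi>\<^sup>\<bottom>)) \<partial>grassmann_law UNIV j)"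
      by (intro nn_integral_affine_law) measurable
    ultimately show ?thesis by (simp add: nn_integral_cmult nn_integral_add)
  qed
  also have "\<dots> < \<infinity>"
    using g(2) K(1) by (simp add: ennreal_mult_less_top)
  finally show ?thesis .
qed

text \<open>Almost every direction \<xi> has a null fibre in Z, so the dual estimate with F the
  indicator of Z vanishes for every a. Letting a run through the natural numbers exhausts all
  k-planes. This is what permits replacing f by a Borel version.\<close>

lemma AE_radon_nn_zero:
  fixes Z :: "(real^'n) set set"
  assumes jk: "j + k < CARD('n)" and Z: "Z \<in> null_sets (affine_law j)"
  shows "AE \<zeta> in affine_law k. radon_nn j (indicator Z) (plane_direction \<zeta>) (plane_foot \<zeta>) = 0"
proof -
  have [measurable]: "Z \<in> sets (plane_algebra (affine_grassmannian j))" using Z by auto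
  have jk': "j + k \<le> CARD('n)" using jk by simp
  note [measurable] = borel_measurable_radon_nn[OF jk', of "indicator Z"]
  have zero: "(\<integral>\<^sup>+\<zeta>. radon_nn j (indicator Z) (plane_direction \<zeta>) (plane_foot \<zeta>) * indicator {..<real a} (norm (plane_foot \<zeta>)) \<partial>affine_law k) = 0"
    for a :: nat
  proof -
    have "AE \<xi> in grassmann_law UNIV j. (\<integral>\<^sup>+u. indicator Z ((+) u ` \<xi>) \<partial>subspace_lborel (\<xi>\<^sup>\<bottom>)) = 0"
    proof -
      have "(\<integral>\<^sup>+\<xi>. (\<integral>\<^sup>+u. indicator Z ((+) u ` \<xi>) \<partial>subspace_lborel (\<xi>\<^sup>\<bottom>)) \<partial>grassmann_law UNIV j) = (\<integral>\<^sup>+\<tau>. indicator Z \<tau> \<partial>affine_law j)"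
        by (intro nn_integral_affine_law[symmetric]) measurable
      also have "\<dots> = 0" using Z by (simp add: null_sets_def)
      finally show ?thesis
        using borel_measurable_nn_integral_orthogonal_comp[of "indicator Z" j] by (subst (asm) nn_integral_0_iff_AE) auto
    qed
    then have AE: "AE \<xi> in grassmann_law UNIV j. ennreal ((2 * real a) ^ j) *
        (\<integral>\<^sup>+u. indicator Z ((+) u ` \<xi>) * tube_prob k (real a) (\<xi>\<^sup>\<bottom>) u \<partial>subspace_lborel (\<xi>\<^sup>\<bottom>)) = 0"
      using AE_space
    proof eventually_elim
      case (elim \<xi>)
      then have \<xi>: "\<xi> \<in> grassmannian UNIV j" by simp
      have s: "subspace \<xi>" using \<xi> by (rule grassmannian_subspace)
      have "k \<le> dim (\<xi>\<^sup>\<bottom>)" using jk dim_orthogonal_comp[OF s] grassmannian_dim[OF \<xi>] by simp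
      then have "(\<integral>\<^sup>+u. indicator Z ((+) u ` \<xi>) * tube_prob k (real a) (\<xi>\<^sup>\<bottom>) u \<partial>subspace_lborel (\<xi>\<^sup>\<bottom>))
          \<le> (\<integral>\<^sup>+u. indicator Z ((+) u ` \<xi>) \<partial>subspace_lborel (\<xi>\<^sup>\<bottom>))"
        using tube_prob_le_1[OF subspace_orthogonal_comp]
        by (intro nn_integral_mono) (auto split: split_indicator)
      then show ?case using elim by simp
    qed
    have "(\<integral>\<^sup>+\<zeta>. radon_nn j (indicator Z) (plane_direction \<zeta>) (plane_foot \<zeta>) * indicator {..<real a} (norm (plane_foot \<zeta>)) \<partial>affine_law k)
        \<le> (\<integral>\<^sup>+\<xi>. ennreal ((2 * real a) ^ j) * (\<integral>\<^sup>+u. indicator Z ((+) u ` \<xi>) * tube_prob k (real a) (\<xi>\<^sup>\<bottom>) u \<partial>subspace_lborel (\<xi>\<^sup>\<bottom>)) \<partial>grassmann_law UNIV j)"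
      by (intro nn_integral_radon_nn_le[OF jk']) auto
    also have "\<dots> = (\<integral>\<^sup>+\<xi>. 0 \<partial>grassmann_law (UNIV :: (real^'n) set) j)" using AE by (rule nn_integral_cong_AE)
    finally show ?thesis by simp
  qed
  then have "AE \<zeta> in affine_law k. \<forall>a::nat. radon_nn j (indicator Z) (plane_direction \<zeta>) (plane_foot \<zeta>) * indicator {..<real a} (norm (plane_foot \<zeta>)) = 0"
    unfolding AE_all_countable by (subst nn_integral_0_iff_AE[symmetric]) auto
  then show ?thesis
  proof eventually_elim
    case (elim \<zeta>)
    obtain a :: nat where "norm (plane_foot \<zeta>) < real a" using reals_Archimedean2 by blast
    then show ?case using elim[rule_format, of a] by simp
  qed
qed

lemma AE_radon_nn_finite:
  fixes g :: "(real^'n) set \<Rightarrow> real"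
  assumes jk: "j + k < CARD('n)" "0 < k" and r: "1 \<le> r" "r < (real CARD('n) - real j) / real k"
    and g_meas: "g \<in> borel_measurable (plane_algebra (affine_grassmannian j))"
    and g: "\<And>\<tau>. 0 \<le> g \<tau>" "(\<integral>\<^sup>+\<tau>. ennreal (g \<tau> powr r) \<partial>affine_law j) < \<infinity>"
  shows "AE \<zeta> in affine_law k. radon_nn j (\<lambda>\<tau>. ennreal (g \<tau>)) (plane_direction \<zeta>) (plane_foot \<zeta>) < \<infinity>"
proof -
  have jk': "j + k \<le> CARD('n)" using jk by simp
  note [measurable] = g_meas
  have [measurable]: "(\<lambda>\<zeta>. radon_nn j (\<lambda>\<tau>. ennreal (g \<tau>)) (plane_direction \<zeta>) (plane_foot \<zeta>)) \<in> borel_measurable (plane_algebra (affine_grassmannian k))"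
    by (intro borel_measurable_radon_nn[OF jk']) measurable
  have "AE \<zeta> in affine_law k. radon_nn j (\<lambda>\<tau>. ennreal (g \<tau>)) (plane_direction \<zeta>) (plane_foot \<zeta>)
      * indicator {..<real a} (norm (plane_foot \<zeta>)) \<noteq> \<infinity>" for a :: nat
    using nn_integral_radon_nn_finite[OF jk r _ g_meas g, of "real a"]
    by (intro nn_integral_noteq_infinite) auto
  then have "AE \<zeta> in affine_law k. \<forall>a::nat. radon_nn j (\<lambda>\<tau>. ennreal (g \<tau>)) (plane_direction \<zeta>) (plane_foot \<zeta>)
      * indicator {..<real a} (norm (plane_foot \<zeta>)) \<noteq> \<infinity>"
    unfolding AE_all_countable by blast
  then show ?thesis
  proof eventually_elim
    case (elim \<zeta>)
    obtain a :: nat where "norm (plane_foot \<zeta>) < real a" using reals_Archimedean2 by blast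
    then show ?case using elim[rule_format, of a] by (simp add: less_top)
  qed
qed

text \<open>f' is a Borel version of f away from Z. Since the transform of the indicator of Z
  vanishes at this plane, f and f' agree almost everywhere along almost every fibre, so f inherits
  measurability for the completed measures and integrability from f', for the inner and the outer
  integral in turn.\<close>

lemma mixed_radon_finiteI:
  fixes f f' :: "(real^'n) set \<Rightarrow> 'b::{banach, second_countable_topology}"
  assumes jk: "j + k < CARD('n)"
    and [measurable]: "f' \<in> borel_measurable (plane_algebra (affine_grassmannian j))"
    and [measurable]: "Z \<in> sets (plane_algebra (affine_grassmannian j))"
    and eq: "\<And>\<tau>. \<tau> \<in> affine_grassmannian j - Z \<Longrightarrow> f \<tau> = f' \<tau>"
    and \<eta>: "\<eta> \<in> grassmannian UNIV k" and v: "v \<in> \<eta>\<^sup>\<bottom>"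
    and null: "radon_nn j (indicator Z) \<eta> v = 0"
    and fin: "radon_nn j (\<lambda>\<tau>. ennreal (norm (f' \<tau>))) \<eta> v < \<infinity>"
  shows "mixed_radon_finite j f ((+) v ` \<eta>)"
proof -
  let ?G = "grassmann_law (\<eta>\<^sup>\<bottom>) j" and ?L = "subspace_lborel \<eta>"
  have s: "subspace \<eta>" using \<eta> by (rule grassmannian_subspace)
  have s': "subspace (\<eta>\<^sup>\<bottom>)" by (rule subspace_orthogonal_comp)
  have d: "j \<le> dim (\<eta>\<^sup>\<bottom>)" using jk dim_orthogonal_comp[OF s] grassmannian_dim[OF \<eta>] by simp
  have gm: "grassmann_measure (\<eta>\<^sup>\<bottom>) j = ?G" using s' d by (rule grassmann_measure_eq_law)
  interpret L: sigma_finite_measure ?L using s by (rule sigma_finite_subspace_lborel)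
  define H where "H \<xi> = (\<integral>u. f' ((+) (u + v) ` \<xi>) \<partial>?L)" for \<xi>
  have "(\<integral>\<^sup>+\<xi>. (\<integral>\<^sup>+u. indicator Z ((+) (u + v) ` \<xi>) \<partial>?L) \<partial>?G) = 0"
    using null unfolding radon_nn_def .
  then have AE1: "AE \<xi> in ?G. (\<integral>\<^sup>+u. indicator Z ((+) (u + v) ` \<xi>) \<partial>?L) = 0"
    by (subst (asm) nn_integral_0_iff_AE) measurable
  have "(\<integral>\<^sup>+\<xi>. (\<integral>\<^sup>+u. ennreal (norm (f' ((+) (u + v) ` \<xi>))) \<partial>?L) \<partial>?G) \<noteq> \<infinity>"
    using fin unfolding radon_nn_def by simp
  then have AE2: "AE \<xi> in ?G. (\<integral>\<^sup>+u. ennreal (norm (f' ((+) (u + v) ` \<xi>))) \<partial>?L) \<noteq> \<infinity>"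
    by (intro nn_integral_noteq_infinite) measurable
  have AE: "AE \<xi> in ?G. integrable (completion ?L) (\<lambda>u. f ((+) (u + v) ` \<xi>)) \<and>
      (\<integral>u. f ((+) (u + v) ` \<xi>) \<partial>completion ?L) = H \<xi> \<and>
      ennreal (norm (H \<xi>)) \<le> (\<integral>\<^sup>+u. ennreal (norm (f' ((+) (u + v) ` \<xi>))) \<partial>?L)"
    using AE1 AE2 AE_space
  proof eventually_elim
    case (elim \<xi>)
    then have \<xi>: "\<xi> \<in> grassmannian (\<eta>\<^sup>\<bottom>) j" by simp
    then have [measurable]: "(\<lambda>_. \<xi>) \<in> measurable borel (plane_algebra (grassmannian (\<eta>\<^sup>\<bottom>) j))" by simp
    have m: "(\<lambda>u. f' ((+) (u + v) ` \<xi>)) \<in> borel_measurable ?L" by measurable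
    have "AE u in ?L. indicator Z ((+) (u + v) ` \<xi>) = (0::ennreal)"
      using elim(1) by (subst (asm) nn_integral_0_iff_AE) measurable
    then have ae: "AE u in ?L. f ((+) (u + v) ` \<xi>) = f' ((+) (u + v) ` \<xi>)"
    proof eventually_elim
      case (elim u)
      then have "(+) (u + v) ` \<xi> \<notin> Z" by (simp split: split_indicator_asm)
      then show ?case using eq plane_translate_mem[OF \<xi>] by simp
    qed
    have int: "integrable ?L (\<lambda>u. f' ((+) (u + v) ` \<xi>))"
      using elim(2) m by (intro integrableI_bounded) (auto simp: less_top)
    have fm: "(\<lambda>u. f ((+) (u + v) ` \<xi>)) \<in> borel_measurable (completion ?L)"
      by (rule measurable_completion_AE_eq[OF m ae]) simp
    have ae': "AE u in completion ?L. f ((+) (u + v) ` \<xi>) = f' ((+) (u + v) ` \<xi>)"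
      using ae by (rule AE_completion)
    have "integrable (completion ?L) (\<lambda>u. f ((+) (u + v) ` \<xi>))"
      using integrable_cong_AE[OF fm measurable_completion[OF m] ae'] int integrable_completion[OF m] by simp
    moreover have "(\<integral>u. f ((+) (u + v) ` \<xi>) \<partial>completion ?L) = H \<xi>"
      unfolding H_def using integral_cong_AE[OF fm measurable_completion[OF m] ae'] integral_completion[OF m] by simp
    moreover have "ennreal (norm (H \<xi>)) \<le> (\<integral>\<^sup>+u. ennreal (norm (f' ((+) (u + v) ` \<xi>))) \<partial>?L)"
      unfolding H_def using int by (rule integral_norm_bound_ennreal)
    ultimately show ?case by simp
  qed
  have Hm: "H \<in> borel_measurable ?G"
    unfolding H_def[abs_def] by (intro L.borel_measurable_lebesgue_integral) measurable
  have "(\<integral>\<^sup>+\<xi>. ennreal (norm (H \<xi>)) \<partial>?G) \<le> radon_nn j (\<lambda>\<tau>. ennreal (norm (f' \<tau>))) \<eta> v"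
    unfolding radon_nn_def using AE by (intro nn_integral_mono_AE) (auto elim: eventually_mono)
  then have Hint: "integrable ?G H"
    using fin Hm by (intro integrableI_bounded) auto
  let ?I = "\<lambda>\<xi>. \<integral>u. f ((+) (u + v) ` \<xi>) \<partial>completion ?L"
  have ae: "AE \<xi> in ?G. ?I \<xi> = H \<xi>" using AE by (auto elim: eventually_mono)
  have Im: "?I \<in> borel_measurable (completion ?G)"
    by (rule measurable_completion_AE_eq[OF Hm ae]) simp
  have "integrable (completion ?G) ?I"
    using integrable_cong_AE[OF Im measurable_completion[OF Hm] AE_completion[OF ae]] Hint integrable_completion[OF Hm] by simp
  then have "has_bochner_integral (completion ?G) ?I (integral\<^sup>L (completion ?G) ?I)"
    by (rule has_bochner_integral_integrable)
  moreover have "AE \<xi> in ?G. integrable (completion ?L) (\<lambda>u. f ((+) (u + v) ` \<xi>))"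
    using AE by (auto elim: eventually_mono)
  ultimately show ?thesis
    unfolding mixed_radon_finite_def has_mixed_radon_def using s v gm by metis
qed

theorem AE_mixed_radon_finite:
  fixes f :: "(real^'n) set \<Rightarrow> 'b::{banach, second_countable_topology}"
  assumes jk: "j + k < CARD('n)" "0 < k" and p: "1 \<le> p" "p < ennreal ((real CARD('n) - real j) / real k)"
    and f: "in_Lp p (affine_measure j) f"
  shows "AE \<zeta> in affine_measure k. mixed_radon_finite j f \<zeta>"
proof -
  have am: "affine_measure j = completion (affine_law j :: (real^'n) set measure)"
    "affine_measure k = completion (affine_law k :: (real^'n) set measure)"
    using jk by (auto intro: affine_measure_eq)
  obtain r where r: "p = ennreal r" "0 \<le> r" using p by (cases p) (auto simp: top_unique)
  have r1: "1 \<le> r" using p(1) r by (simp add: ennreal_1[symmetric] del: ennreal_1)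
  have r2: "r < (real CARD('n) - real j) / real k"
    using p(2) r jk by (simp add: ennreal_less_iff)
  have fm: "f \<in> borel_measurable (completion (affine_law j))"
    and fi: "(\<integral>\<^sup>+\<tau>. ennreal (norm (f \<tau>) powr r) \<partial>completion (affine_law j)) < \<infinity>"
    using f r by (auto simp: in_Lp_def am)
  obtain f' Z where f': "f' \<in> borel_measurable (affine_law j)" "Z \<in> null_sets (affine_law j)"
    "\<And>\<tau>. \<tau> \<in> space (affine_law j) - Z \<Longrightarrow> f \<tau> = f' \<tau>"
    using completion_ex_measurable_version[OF fm] by metis
  have f'm [measurable]: "f' \<in> borel_measurable (plane_algebra (affine_grassmannian j))"
    using f'(1) by (simp cong: measurable_cong_sets)
  have Zm: "Z \<in> sets (plane_algebra (affine_grassmannian j))" using f'(2) by auto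
  have "AE \<tau> in affine_law j. f \<tau> = f' \<tau>"
    using AE_not_in[OF f'(2)] AE_space by eventually_elim (use f'(3) in auto)
  then have "(\<integral>\<^sup>+\<tau>. ennreal (norm (f' \<tau>) powr r) \<partial>affine_law j) = (\<integral>\<^sup>+\<tau>. ennreal (norm (f \<tau>) powr r) \<partial>affine_law j)"
    by (intro nn_integral_cong_AE) (auto elim: eventually_mono)
  then have fin: "(\<integral>\<^sup>+\<tau>. ennreal (norm (f' \<tau>) powr r) \<partial>affine_law j) < \<infinity>"
    using fi by (simp add: nn_integral_completion)
  have "AE \<zeta> in affine_law k. radon_nn j (\<lambda>\<tau>. ennreal (norm (f' \<tau>))) (plane_direction \<zeta>) (plane_foot \<zeta>) < \<infinity>"
    using fin by (intro AE_radon_nn_finite[OF jk r1 r2]) auto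
  moreover have "AE \<zeta> in affine_law k. radon_nn j (indicator Z) (plane_direction \<zeta>) (plane_foot \<zeta>) = 0"
    using f'(2) by (rule AE_radon_nn_zero[OF jk(1)])
  ultimately have "AE \<zeta> in affine_law k. mixed_radon_finite j f \<zeta>"
    using AE_space
  proof eventually_elim
    case (elim \<zeta>)
    then have "\<zeta> \<in> affine_grassmannian k" by simp
    then obtain \<eta> v where \<eta>: "\<eta> \<in> grassmannian UNIV k" "v \<in> \<eta>\<^sup>\<bottom>" "\<zeta> = (+) v ` \<eta>"
      "plane_direction \<zeta> = \<eta>" "plane_foot \<zeta> = v" by (rule affine_grassmannianE)
    show ?case unfolding \<eta>(3)
      by (rule mixed_radon_finiteI[OF jk(1) f'm Zm _ \<eta>(1,2)]) (use elim \<eta>(4,5) f'(3) in auto)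
  qed
  then show ?thesis unfolding am by (rule AE_completion)
qed

section \<open>Sharpness\<close>

text \<open>On the shell \<open>\<beta>\<^sup>i\<^sup>-\<^sup>1 \<le> \<bar>\<tau>\<bar> < \<beta>\<^sup>i\<close> the critical function is \<open>\<beta>\<^sup>-\<^sup>k\<^sup>i / (i + 1)\<close>. The base \<open>\<beta> = 2 k\<close> makes
  the crude cube bounds on the volume of a \<open>k\<close>-dimensional ball strong enough to bound the volume of a
  shell from below.\<close>

definition critical_profile :: "nat \<Rightarrow> nat \<Rightarrow> real" where
  "critical_profile k i = 1 / (real (Suc i) * (2 * real k) ^ (k * i))"

definition critical_function :: "nat \<Rightarrow> (real^'n) set \<Rightarrow> real" where
  "critical_function k \<tau> = critical_profile k (shell (2 * real k) (infdist 0 \<tau>))"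

lemma critical_profile_pos: "0 < k \<Longrightarrow> 0 < critical_profile k i"
  by (simp add: critical_profile_def)

lemma critical_profile_antimono:
  assumes "0 < k" "i \<le> l" shows "critical_profile k l \<le> critical_profile k i"
proof -
  have "real (Suc i) * (2 * real k) ^ (k * i) \<le> real (Suc l) * (2 * real k) ^ (k * l)"
    using assms by (intro mult_mono power_increasing) auto
  then show ?thesis unfolding critical_profile_def using assms(1)
    by (intro divide_left_mono) (auto intro!: mult_pos_pos)
qed

lemma critical_function_nonneg: "0 < k \<Longrightarrow> 0 \<le> critical_function k \<tau>"
  by (simp add: critical_function_def critical_profile_pos less_imp_le)

lemma critical_profile_le_1: "0 < k \<Longrightarrow> critical_profile k i \<le> 1"
  using critical_profile_antimono[of k 0 i] by (simp add: critical_profile_def)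

lemma borel_measurable_critical_function [measurable]:
  "critical_function k \<in> borel_measurable (plane_algebra (affine_grassmannian j))"
  unfolding critical_function_def[abs_def] by measurable

text \<open>On shell i the r-th power contributes \<beta>^(-k i r), against a volume of order
  \<beta>^(m i) with m = n - j. As k r \<ge> m, at most the sum of (i + 1)^(-r) is left, up to a
  constant, and it converges because r \<ge> m / k > 1. The logarithmic factor is thus needed
  exactly at the endpoint.\<close>

lemma nn_integral_critical_function_powr:
  assumes jk: "j + k < CARD('n)" "0 < k" and r: "(real CARD('n) - real j) / real k \<le> r"
  shows "(\<integral>\<^sup>+\<tau>. ennreal (critical_function k \<tau> powr r) \<partial>(affine_law j :: (real^'n) set measure)) < \<infinity>"
proof -
  define \<beta> where "\<beta> = 2 * real k"
  let ?m = "CARD('n) - j"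
  let ?K = "\<Sum>i. ennreal (critical_profile k i powr r) * ennreal ((2 * \<beta> ^ i) ^ ?m)"
  have \<beta>: "1 < \<beta>" "0 < \<beta>" using jk by (simp_all add: \<beta>_def)
  have m: "real ?m = real CARD('n) - real j" "k < ?m" using jk by auto
  have kr: "real ?m \<le> real k * r" using r jk(2) m(1) by (simp add: pos_divide_le_eq mult.commute)
  have "real k < real k * r" using kr m(2) by simp
  then have r1: "1 < r" using jk(2) by simp
  have "?K < \<infinity>"
  proof -
    have le: "critical_profile k i powr r * (2 * \<beta> ^ i) ^ ?m \<le> 2 ^ ?m * real (Suc i) powr (- r)" for i
    proof -
      have "(\<beta> ^ (k * i)) powr r = \<beta> powr (real i * (real k * r))"
        by (simp add: powr_realpow[OF \<beta>(2), symmetric] powr_powr algebra_simps)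
      then have "critical_profile k i powr r = real (Suc i) powr (- r) / \<beta> powr (real i * (real k * r))"
        using \<beta> by (simp add: critical_profile_def \<beta>_def[symmetric] powr_divide powr_mult powr_minus_divide del: of_nat_Suc)
      moreover have "(2 * \<beta> ^ i) ^ ?m = 2 ^ ?m * \<beta> powr (real i * real ?m)"
        by (simp only: power_mult_distrib power_mult[symmetric] powr_realpow[OF \<beta>(2)] of_nat_mult[symmetric])
      moreover have "\<beta> powr (real i * real ?m) \<le> \<beta> powr (real i * (real k * r))"
        using \<beta> kr by (intro powr_mono mult_left_mono) auto
      ultimately show ?thesis
        using \<beta> by (simp add: divide_le_eq mult_left_mono mult_ac del: of_nat_Suc of_nat_diff)
    qed
    have "summable (\<lambda>i. real i powr (- r))" using r1 by (simp add: summable_real_powr_iff)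
    then have "summable (\<lambda>i. real (Suc i) powr (- r))" by (rule summable_Suc_iff[THEN iffD2])
    then have "summable (\<lambda>i. 2 ^ ?m * real (Suc i) powr (- r))" by (rule summable_mult)
    then have "summable (\<lambda>i. critical_profile k i powr r * (2 * \<beta> ^ i) ^ ?m)"
    proof (rule summable_comparison_test'[where N=0])
      fix i
      show "norm (critical_profile k i powr r * (2 * \<beta> ^ i) ^ ?m) \<le> 2 ^ ?m * real (Suc i) powr (- r)"
        using le[of i] \<beta> by (simp add: abs_mult del: of_nat_Suc)
    qed
    then have "(\<Sum>i. ennreal (critical_profile k i powr r * (2 * \<beta> ^ i) ^ ?m)) \<noteq> \<infinity>"
      unfolding infinity_ennreal_def using \<beta> by (intro ennreal_suminf_neq_top) simp_all
    then show ?thesis using \<beta> by (simp add: ennreal_mult less_top)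
  qed
  have "(\<integral>\<^sup>+\<tau>. ennreal (critical_function k \<tau> powr r) \<partial>(affine_law j :: (real^'n) set measure))
      = (\<integral>\<^sup>+\<xi>. (\<integral>\<^sup>+u. ennreal (critical_function k ((+) u ` \<xi>) powr r) \<partial>subspace_lborel (\<xi>\<^sup>\<bottom>)) \<partial>grassmann_law (UNIV :: (real^'n) set) j)"
    by (intro nn_integral_affine_law) measurable
  also have "\<dots> \<le> (\<integral>\<^sup>+\<xi>. ?K \<partial>grassmann_law (UNIV :: (real^'n) set) j)"
  proof (rule nn_integral_mono)
    fix \<xi> assume "\<xi> \<in> space (grassmann_law (UNIV :: (real^'n) set) j)"
    then have \<xi>: "\<xi> \<in> grassmannian UNIV j" by simp
    have s: "subspace \<xi>" using \<xi> by (rule grassmannian_subspace)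
    have s': "subspace (\<xi>\<^sup>\<bottom>)" by (rule subspace_orthogonal_comp)
    have d: "dim (\<xi>\<^sup>\<bottom>) = ?m" using dim_orthogonal_comp[OF s] grassmannian_dim[OF \<xi>] by simp
    have "(\<integral>\<^sup>+u. ennreal (critical_function k ((+) u ` \<xi>) powr r) \<partial>subspace_lborel (\<xi>\<^sup>\<bottom>))
        = (\<integral>\<^sup>+u. ennreal (critical_profile k (shell \<beta> (norm u)) powr r) \<partial>subspace_lborel (\<xi>\<^sup>\<bottom>))"
      by (intro nn_integral_cong_AE eventually_mono[OF AE_subspace_lborel[OF s']])
        (simp add: critical_function_def \<beta>_def infdist_translate infdist_eq_norm_proj[OF s]
          proj_zero[OF s subspace_neg[OF s']])
    also have "\<dots> \<le> ?K"
      using nn_integral_shell_le[OF s' \<beta>(1), of "\<lambda>i. ennreal (critical_profile k i powr r)"] by (simp add: d)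
    finally show "(\<integral>\<^sup>+u. ennreal (critical_function k ((+) u ` \<xi>) powr r) \<partial>subspace_lborel (\<xi>\<^sup>\<bottom>)) \<le> ?K" .
  qed
  also have "\<dots> = ?K"
    using prob_space.emeasure_space_1[OF prob_space_grassmann_law[of "UNIV :: (real^'n) set" j]] jk by simp
  finally show ?thesis using \<open>?K < \<infinity>\<close> by (rule le_less_trans)
qed

text \<open>With \<beta> = 2 k the inner cube of the larger ball has side 2 \<beta>^(i + 1) / k = 4
  \<beta>^i, while the outer cube of the smaller ball has side 2 \<beta>^i. The difference of their
  volumes bounds the annulus from below.\<close>

lemma emeasure_subspace_lborel_annulus_ge:
  assumes V: "subspace V" "dim V = k" "0 < k"
  shows "ennreal ((2 * real k) ^ (k * i)) \<le> emeasure (subspace_lborel V) (ball 0 ((2 * real k) ^ Suc i) - ball 0 ((2 * real k) ^ i))"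
proof -
  let ?\<beta> = "2 * real k"
  let ?L = "subspace_lborel V"
  have \<beta>: "1 < ?\<beta>" using V by simp
  have d: "0 < dim V" using V by simp
  have fin: "emeasure ?L (ball 0 (?\<beta> ^ i)) \<noteq> \<infinity>"
    using emeasure_subspace_lborel_ball_le[OF V(1), of "?\<beta> ^ i"] \<beta> by (auto simp: top_unique)
  have "?\<beta> ^ i \<le> ?\<beta> ^ Suc i" using \<beta> by (intro power_increasing) auto
  then have sub: "ball 0 (?\<beta> ^ i) \<subseteq> (ball 0 (?\<beta> ^ Suc i) :: 'a set)" by (rule subset_ball)
  have "2 * ?\<beta> ^ Suc i / dim V = 4 * ?\<beta> ^ i" using V by simp
  then have upper: "ennreal ((4 * ?\<beta> ^ i) ^ k) \<le> emeasure ?L (ball 0 (?\<beta> ^ Suc i))"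
    using emeasure_subspace_lborel_ball_ge[OF V(1) _ d, of "?\<beta> ^ Suc i"] V \<beta> by (simp del: power_Suc)
  have lower: "emeasure ?L (ball 0 (?\<beta> ^ i)) \<le> ennreal ((2 * ?\<beta> ^ i) ^ k)"
    using emeasure_subspace_lborel_ball_le[OF V(1), of "?\<beta> ^ i"] V \<beta> by simp
  \<comment> \<open>After division by \<beta>^(k i) this is 1 + 2^k \<le> 4^k, valid for k \<ge>
    1.\<close>
  have "?\<beta> ^ (k * i) + (2 * ?\<beta> ^ i) ^ k \<le> (4 * ?\<beta> ^ i) ^ k"
  proof -
    have "(1 + 2 ^ k :: real) \<le> 2 ^ k + 2 ^ k" by simp
    also have "\<dots> = 2 * 2 ^ k" by simp
    also have "\<dots> \<le> 2 ^ k * 2 ^ k" using V(3) by (intro mult_right_mono self_le_power) auto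
    also have "\<dots> = (4::real) ^ k" by (simp add: power_mult_distrib[symmetric])
    finally have "(1 + 2 ^ k) * ?\<beta> ^ (k * i) \<le> 4 ^ k * ?\<beta> ^ (k * i)" by (intro mult_right_mono) auto
    then show ?thesis by (simp add: power_mult_distrib power_mult[symmetric] algebra_simps)
  qed
  then have "?\<beta> ^ (k * i) \<le> (4 * ?\<beta> ^ i) ^ k - (2 * ?\<beta> ^ i) ^ k" by simp
  then have "ennreal (?\<beta> ^ (k * i)) \<le> ennreal ((4 * ?\<beta> ^ i) ^ k - (2 * ?\<beta> ^ i) ^ k)" by (rule ennreal_leI)
  also have "\<dots> = ennreal ((4 * ?\<beta> ^ i) ^ k) - ennreal ((2 * ?\<beta> ^ i) ^ k)"
    by (intro ennreal_minus[symmetric]) simp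
  also have "\<dots> \<le> emeasure ?L (ball 0 (?\<beta> ^ Suc i)) - emeasure ?L (ball 0 (?\<beta> ^ i))"
    using upper lower by (rule ennreal_minus_mono)
  also have "\<dots> = emeasure ?L (ball 0 (?\<beta> ^ Suc i) - ball 0 (?\<beta> ^ i))"
    using sub fin by (intro emeasure_Diff[symmetric]) auto
  finally show ?thesis .
qed

text \<open>The distance of u + v + \<xi> from the origin is at most |u + v|, and the critical
  function decreases with this distance. On the annulus of index i + s it is at least a constant
  times \<beta>^(-k (i + s)) / (i + s + 3), against a volume of at least \<beta>^(k (i + s)): what
  remains is a tail of the harmonic series.\<close>

lemma nn_integral_critical_function_translate:
  fixes v :: "real^'n"
  assumes \<eta>: "subspace \<eta>" "dim \<eta> = k" "0 < k" and \<xi>: "subspace \<xi>"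
  shows "(\<integral>\<^sup>+u. ennreal (critical_function k ((+) (u + v) ` \<xi>)) \<partial>subspace_lborel \<eta>) = \<infinity>"
proof -
  let ?\<beta> = "2 * real k" and ?L = "subspace_lborel \<eta>"
  have \<beta>: "1 < ?\<beta>" "2 \<le> ?\<beta>" using \<eta> by simp_all
  \<comment> \<open>Only annuli from index s on are used, so that v is dominated by the outer
    radius.\<close>
  obtain s where s: "norm v < ?\<beta> ^ s" using real_arch_pow[OF \<beta>(1)] by blast
  let ?S = "\<lambda>i. ball 0 (?\<beta> ^ Suc (i + s)) - ball 0 (?\<beta> ^ (i + s)) :: (real^'n) set"
  \<comment> \<open>The offset 2: on annulus i + s one has |u + v| < 2 \<beta>^(i + s + 1) \<le>
    \<beta>^(i + s + 2), because \<beta> \<ge> 2.\<close>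
  let ?c = "\<lambda>i. ennreal (critical_profile k (i + s + 2))"
  have S: "?S i \<in> sets ?L" for i
    unfolding sets_subspace_lborel by (intro sets.Diff borel_open open_ball)
  \<comment> \<open>The annuli are disjoint, so at most one term of the series is nonzero at
    u.\<close>
  have pt: "(\<Sum>i. ?c i * indicator (?S i) u) \<le> ennreal (critical_function k ((+) (u + v) ` \<xi>))" for u
  proof (rule suminf_le_const[OF summableI])
    fix N
    show "(\<Sum>i<N. ?c i * indicator (?S i) u) \<le> ennreal (critical_function k ((+) (u + v) ` \<xi>))"
    proof (cases "\<exists>l<N. u \<in> ?S l")
      case True
      then obtain l where l: "l < N" "u \<in> ?S l" by blast
      have other: "u \<notin> ?S i" if ne: "i \<noteq> l" for i
      proof -
        consider "Suc (i + s) \<le> l + s" | "Suc (l + s) \<le> i + s" using ne by linarith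
        then show ?thesis
        proof cases
          case 1
          then have "?\<beta> ^ Suc (i + s) \<le> ?\<beta> ^ (l + s)" using \<beta> by (intro power_increasing) auto
          then show ?thesis using l(2) by (auto simp del: power_Suc)
        next
          case 2
          then have "?\<beta> ^ Suc (l + s) \<le> ?\<beta> ^ (i + s)" using \<beta> by (intro power_increasing) auto
          then show ?thesis using l(2) by (auto simp del: power_Suc)
        qed
      qed
      have "(\<Sum>i<N. ?c i * indicator (?S i) u) = (\<Sum>i<N. if i = l then ?c l else 0)"
        using other l(2) by (intro sum.cong) auto
      also have "\<dots> = ?c l" using l(1) by simp
      also have "\<dots> \<le> ennreal (critical_function k ((+) (u + v) ` \<xi>))"
      proof (intro ennreal_leI)
        have "infdist 0 ((+) (u + v) ` \<xi>) \<le> dist 0 (u + v + 0)"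
          using subspace_0[OF \<xi>] by (intro infdist_le) blast
        also have "\<dots> \<le> norm u + norm v" by (simp add: norm_triangle_ineq)
        also have "\<dots> < ?\<beta> ^ Suc (l + s) + ?\<beta> ^ Suc (l + s)"
        proof (rule add_strict_mono)
          show "norm u < ?\<beta> ^ Suc (l + s)" using l(2) by simp
          have "?\<beta> ^ s \<le> ?\<beta> ^ Suc (l + s)" using \<beta> by (intro power_increasing) auto
          then show "norm v < ?\<beta> ^ Suc (l + s)" using s by simp
        qed
        also have "\<dots> = 2 * ?\<beta> ^ Suc (l + s)" by simp
        also have "\<dots> \<le> ?\<beta> * ?\<beta> ^ Suc (l + s)" using \<beta> by (intro mult_right_mono) auto
        also have "\<dots> = ?\<beta> ^ (l + s + 2)" by simp
        finally have "shell ?\<beta> (infdist 0 ((+) (u + v) ` \<xi>)) \<le> l + s + 2" by (rule shell_le)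
        then show "critical_profile k (l + s + 2) \<le> critical_function k ((+) (u + v) ` \<xi>)"
          unfolding critical_function_def using \<eta>(3) by (intro critical_profile_antimono)
      qed
      finally show ?thesis .
    next
      case False
      then have "(\<Sum>i<N. ?c i * indicator (?S i) u) = 0" by (intro sum.neutral) auto
      then show ?thesis by simp
    qed
  qed
  have "\<infinity> = (\<Sum>i. ennreal (1 / (?\<beta> ^ (2 * k)) * inverse (real (i + (s + 3)))))"
  proof -
    have "\<not> summable (\<lambda>i. inverse (real (i + (s + 3))))"
      using not_summable_harmonic[where 'a=real] summable_iff_shift[of "\<lambda>i. inverse (real i)" "s + 3"] by simp
    then have "\<not> summable (\<lambda>i. 1 / (?\<beta> ^ (2 * k)) * inverse (real (i + (s + 3))))"
      using \<beta> by (subst summable_cmult_iff) auto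
    then show ?thesis using \<beta> by (subst summable_iff_suminf_neq_top) auto
  qed
  also have "\<dots> \<le> (\<Sum>i. ?c i * emeasure ?L (?S i))"
  proof (rule suminf_le[OF _ summableI summableI])
    fix i
    have "1 / (?\<beta> ^ (2 * k)) * inverse (real (i + (s + 3))) = critical_profile k (i + s + 2) * ?\<beta> ^ (k * (i + s))"
    proof -
      have "k * (i + s + 2) = 2 * k + k * (i + s)" by (simp add: algebra_simps)
      then have 1: "?\<beta> ^ (k * (i + s + 2)) = ?\<beta> ^ (2 * k) * ?\<beta> ^ (k * (i + s))"
        by (simp only: power_add)
      have 2: "1 / A * inverse R = 1 / (R * (A * B)) * B" if "B \<noteq> 0" for A B R :: real
        using that by (simp add: divide_inverse)
      have 3: "real (Suc (i + s + 2)) = real (i + (s + 3))" by simp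
      show ?thesis unfolding critical_profile_def 1 3 using \<beta> by (intro 2) simp
    qed
    then have "ennreal (1 / (?\<beta> ^ (2 * k)) * inverse (real (i + (s + 3)))) = ?c i * ennreal (?\<beta> ^ (k * (i + s)))"
      using \<beta> critical_profile_pos[OF \<eta>(3), of "i + s + 2"] by (simp add: ennreal_mult)
    also have "\<dots> \<le> ?c i * emeasure ?L (?S i)"
      by (intro mult_left_mono emeasure_subspace_lborel_annulus_ge \<eta>) simp
    finally show "ennreal (1 / (?\<beta> ^ (2 * k)) * inverse (real (i + (s + 3)))) \<le> ?c i * emeasure ?L (?S i)" .
  qed
  also have "\<dots> = (\<Sum>i. \<integral>\<^sup>+u. ?c i * indicator (?S i) u \<partial>?L)"
    using S by (simp only: nn_integral_cmult_indicator)
  also have "\<dots> = (\<integral>\<^sup>+u. (\<Sum>i. ?c i * indicator (?S i) u) \<partial>?L)"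
    by (rule nn_integral_suminf[symmetric])
      (intro borel_measurable_times_ennreal borel_measurable_const borel_measurable_indicator S)
  also have "\<dots> \<le> (\<integral>\<^sup>+u. ennreal (critical_function k ((+) (u + v) ` \<xi>)) \<partial>?L)"
    by (intro nn_integral_mono pt)
  finally show ?thesis by (simp add: top_unique)
qed

text \<open>The inner integral diverges for every \<xi>, so the \<open>AE\<close> clause of
  \<open>has_mixed_radon\<close> would make the empty set one of full measure. The transform
  therefore fails to exist at every plane, not only on a set of positive measure.\<close>

lemma not_mixed_radon_finite_critical_function:
  fixes \<zeta> :: "(real^'n) set"
  assumes jk: "j + k < CARD('n)" "0 < k" and \<zeta>: "\<zeta> \<in> affine_grassmannian k"
  shows "\<not> mixed_radon_finite j (\<lambda>\<tau>. of_real (critical_function k \<tau>) :: 'b::{real_normed_field, banach, second_countable_topology}) \<zeta>"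
proof
  let ?f = "\<lambda>\<tau> :: (real^'n) set. of_real (critical_function k \<tau>) :: 'b"
  assume "mixed_radon_finite j ?f \<zeta>"
  then obtain \<eta> v where \<eta>: "subspace \<eta>" "\<zeta> = (+) v ` \<eta>"
    and ae: "AE \<xi> in grassmann_measure (\<eta>\<^sup>\<bottom>) j. integrable (completion (subspace_lborel \<eta>)) (\<lambda>u. ?f ((+) (u + v) ` \<xi>))"
    unfolding mixed_radon_finite_def has_mixed_radon_def by blast
  \<comment> \<open>The witness \<eta> comes without a dimension; being the direction of \<zeta>, it
    has dimension k.\<close>
  have "plane_direction \<zeta> \<in> grassmannian UNIV k" using \<zeta> by (rule affine_grassmannianE) simp
  then have d: "dim \<eta> = k" using plane_direction_translate[OF \<eta>(1)] \<eta>(2) by (simp add: grassmannian_def)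
  have j: "j \<le> dim (\<eta>\<^sup>\<bottom>)" using jk dim_orthogonal_comp[OF \<eta>(1)] d by simp
  have gm: "grassmann_measure (\<eta>\<^sup>\<bottom>) j = grassmann_law (\<eta>\<^sup>\<bottom>) j"
    using subspace_orthogonal_comp j by (rule grassmann_measure_eq_law)
  interpret G: prob_space "grassmann_law (\<eta>\<^sup>\<bottom>) j" using subspace_orthogonal_comp j by (rule prob_space_grassmann_law)
  have "AE \<xi> in grassmann_law (\<eta>\<^sup>\<bottom>) j. False"
    using ae[unfolded gm] AE_space
  proof eventually_elim
    case (elim \<xi>)
    then have \<xi>: "subspace \<xi>" by (simp add: grassmannian_subspace)
    have "(\<integral>\<^sup>+u. ennreal (norm (?f ((+) (u + v) ` \<xi>))) \<partial>completion (subspace_lborel \<eta>)) < \<infinity>"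
      using elim(1) by (simp only: integrable_iff_bounded)
    then show False
      using nn_integral_critical_function_translate[OF \<eta>(1) d jk(2) \<xi>, of v]
      by (simp add: nn_integral_completion critical_function_nonneg[OF jk(2)])
  qed
  then show False by simp
qed

text \<open>One function refutes all exponents from the bound upwards. For the infinite exponent its
  boundedness by 1 is enough.\<close>

theorem critical_exponent_sharp:
  fixes p :: ennreal
  assumes jk: "j + k < CARD('n)" "0 < k" and p: "ennreal ((real CARD('n) - real j) / real k) \<le> p"
  shows "\<not> (\<forall>f :: (real^'n) set \<Rightarrow> 'b::{real_normed_field, banach, second_countable_topology}.
    in_Lp p (affine_measure j) f \<longrightarrow> (AE \<zeta> in affine_measure k. mixed_radon_finite j f \<zeta>))"
proof
  assume all: "\<forall>f :: (real^'n) set \<Rightarrow> 'b. in_Lp p (affine_measure j) f \<longrightarrow> (AE \<zeta> in affine_measure k. mixed_radon_finite j f \<zeta>)"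
  let ?f = "\<lambda>\<tau> :: (real^'n) set. of_real (critical_function k \<tau>) :: 'b"
  have am: "affine_measure j = completion (affine_law j :: (real^'n) set measure)"
    "affine_measure k = completion (affine_law k :: (real^'n) set measure)"
    using jk by (auto intro: affine_measure_eq)
  have nf: "norm (?f \<tau>) = critical_function k \<tau>" for \<tau>
    by (simp add: critical_function_nonneg[OF jk(2)])
  have "?f \<in> borel_measurable (affine_law j)" by measurable
  then have fm: "?f \<in> borel_measurable (completion (affine_law j))" by (rule measurable_completion)
  have "in_Lp p (affine_measure j) ?f"
  proof (cases "p = \<infinity>")
    case True
    have "norm (?f \<tau>) \<le> 1" for \<tau>
      unfolding nf using critical_profile_le_1[OF jk(2)] by (simp add: critical_function_def)
    then show ?thesis using True fm unfolding in_Lp_def am by (auto intro!: exI[of _ 1])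
  next
    case False
    then obtain r where r: "p = ennreal r" "0 \<le> r" by (cases p) auto
    have "(real CARD('n) - real j) / real k \<le> r" using p r jk by (simp add: ennreal_le_iff)
    then have "(\<integral>\<^sup>+\<tau>. ennreal (critical_function k \<tau> powr r) \<partial>(affine_law j :: (real^'n) set measure)) < \<infinity>"
      by (rule nn_integral_critical_function_powr[OF jk])
    then show ?thesis using False fm r unfolding in_Lp_def am nf by (simp add: nn_integral_completion)
  qed
  with all have "AE \<zeta> in affine_measure k. mixed_radon_finite j ?f \<zeta>" by blast
  then have "AE \<zeta> in affine_law k. mixed_radon_finite j ?f \<zeta>"
    unfolding am by (simp only: AE_completion_iff)
  then have "AE \<zeta> in (affine_law k :: (real^'n) set measure). False"
    using AE_space by eventually_elim (use not_mixed_radon_finite_critical_function[OF jk, where 'b='b] in auto)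
  then have "(\<integral>\<^sup>+\<zeta>. 1 \<partial>(affine_law k :: (real^'n) set measure)) = (\<integral>\<^sup>+\<zeta>. 0 \<partial>(affine_law k :: (real^'n) set measure))"
    by (intro nn_integral_cong_AE) (auto elim: eventually_mono)
  \<comment> \<open>A property that fails everywhere could still hold almost everywhere for the zero
    measure. The total mass here is at least the integral of the Gaussian over the complements,
    which is 1.\<close>
  moreover have "1 \<le> (\<integral>\<^sup>+\<zeta>. 1 \<partial>(affine_law k :: (real^'n) set measure))"
  proof -
    interpret G: prob_space "grassmann_law (UNIV :: (real^'n) set) k" using jk by (intro prob_space_grassmann_law) auto
    have "1 = (\<integral>\<^sup>+\<eta>. 1 \<partial>grassmann_law (UNIV :: (real^'n) set) k)" using G.emeasure_space_1 by simp
    also have "\<dots> = (\<integral>\<^sup>+\<eta>. (\<integral>\<^sup>+u. gauss u \<partial>subspace_lborel (\<eta>\<^sup>\<bottom>)) \<partial>grassmann_law (UNIV :: (real^'n) set) k)"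
      by (intro nn_integral_cong) (simp add: nn_integral_gauss_subspace_lborel subspace_orthogonal_comp)
    also have "\<dots> \<le> (\<integral>\<^sup>+\<eta>. (\<integral>\<^sup>+u. 1 \<partial>subspace_lborel (\<eta>\<^sup>\<bottom>)) \<partial>grassmann_law (UNIV :: (real^'n) set) k)"
      by (intro nn_integral_mono) (simp add: gauss_le_1 ennreal_le_1)
    also have "\<dots> = (\<integral>\<^sup>+\<zeta>. 1 \<partial>(affine_law k :: (real^'n) set measure))"
      by (intro nn_integral_affine_law[symmetric]) simp
    finally show ?thesis .
  qed
  ultimately show False by simp
qed

theorem corollary5p4:
  fixes j k :: nat
  assumes "j > 0" and "k > 0" and "j + k < CARD('n::finite)"
  shows
    "(\<forall>p::ennreal. 1 \<le> p \<and> p < ennreal ((real CARD('n) - real j) / real k) \<longrightarrow>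
        (\<forall>f :: (real ^ 'n) set \<Rightarrow> 'b::{real_normed_field, banach, second_countable_topology}.
           in_Lp p (affine_measure j) f \<longrightarrow> (AE \<zeta> in affine_measure k. mixed_radon_finite j f \<zeta>))) \<and>
     (\<forall>q::ennreal. 1 \<le> q \<and> q < ennreal ((real CARD('n) - real k) / real j) \<longrightarrow>
        (\<forall>\<phi> :: (real ^ 'n) set \<Rightarrow> 'b.
           in_Lp q (affine_measure k) \<phi> \<longrightarrow> (AE \<tau> in affine_measure j. mixed_radon_finite k \<phi> \<tau>))) \<and>
     (\<forall>p::ennreal. p \<ge> ennreal ((real CARD('n) - real j) / real k) \<longrightarrow>
        \<not> (\<forall>f :: (real ^ 'n) set \<Rightarrow> 'b.
             in_Lp p (affine_measure j) f \<longrightarrow> (AE \<zeta> in affine_measure k. mixed_radon_finite j f \<zeta>))) \<and>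
     (\<forall>q::ennreal. q \<ge> ennreal ((real CARD('n) - real k) / real j) \<longrightarrow>
        \<not> (\<forall>\<phi> :: (real ^ 'n) set \<Rightarrow> 'b.
             in_Lp q (affine_measure k) \<phi> \<longrightarrow> (AE \<tau> in affine_measure j. mixed_radon_finite k \<phi> \<tau>)))"
proof (intro conjI allI impI)
  have kj: "k + j < CARD('n)" using assms(3) by simp
  show "AE \<zeta> in affine_measure k. mixed_radon_finite j f \<zeta>"
    if "1 \<le> p \<and> p < ennreal ((real CARD('n) - real j) / real k)" "in_Lp p (affine_measure j) f"
    for p and f :: "(real^'n) set \<Rightarrow> 'b"
    using that by (intro AE_mixed_radon_finite[OF assms(3,2)]) auto
  show "AE \<tau> in affine_measure j. mixed_radon_finite k \<phi> \<tau>"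
    if "1 \<le> q \<and> q < ennreal ((real CARD('n) - real k) / real j)" "in_Lp q (affine_measure k) \<phi>"
    for q and \<phi> :: "(real^'n) set \<Rightarrow> 'b"
    using that by (intro AE_mixed_radon_finite[OF kj assms(1)]) auto
  show "\<not> (\<forall>f :: (real^'n) set \<Rightarrow> 'b. in_Lp p (affine_measure j) f \<longrightarrow> (AE \<zeta> in affine_measure k. mixed_radon_finite j f \<zeta>))"
    if "p \<ge> ennreal ((real CARD('n) - real j) / real k)" for p
    using that by (rule critical_exponent_sharp[OF assms(3,2)])
  show "\<not> (\<forall>\<phi> :: (real^'n) set \<Rightarrow> 'b. in_Lp q (affine_measure k) \<phi> \<longrightarrow> (AE \<tau> in affine_measure j. mixed_radon_finite k \<phi> \<tau>))"
    if "q \<ge> ennreal ((real CARD('n) - real k) / real j)" for q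
    using that by (rule critical_exponent_sharp[OF kj assms(1)])
qed

end
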